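(* (Linearizability) In the Ctrie algorithm described in the context, executed concurrently by any number of threads starting from the empty Ctrie, the operations insert, lookup and remove are linearizable with respect to the abstract set semantics: each invocation appears to take effect atomically at a single point in time between its invocation and its completion.
   Context: Setting. A Ctrie is a concurrent shared-memory map from keys to values, accessed by several threads using atomic reads and single-word compare-and-swap, written CAS$(x,e,n)$: atomically, if location $x$ holds $e$ then write $n$ and succeed, otherwise fail. Keys have hashcodes (bit strings). Fix the branching width $W\ge1$. The hashcode chunk of key $k$ at level $l$ (levels are multiples of $W$) is $m(l,k)=(hashcode(k)\gg l)\bmod 2^W$. Nodes. An inode has one mutable field $main$, holding $null$, a cnode or an snode. A cnode has an integer bitmap $bmp$ of $2^W$ bits and an array of references to inodes or snodes. An snode has a key $k$, a value $v$ and a boolean $tomb$. Fields of cnodes and snodes are set only at creation. A mutable reference $root$ holds $null$ or an inode. For a cnode at level $l$, the entry for key $k$ exists iff bit $m(l,k)$ of $bmp$ is set, and is then $array(\#(((1\ll m(l,k))-1)\wedge bmp))$ ($\#$ = bit count, $\wedge$ = bitwise AND). Terminology. A null-inode is an inode with $main=null$; a tomb-inode is an inode whose $main$ is a tombed snode. A singleton is an snode or a tomb-inode. Algorithm (restart means re-invoke the top-level operation). insert$(k,v)$: read $r=root$; if $r=null$ or $r$ is a null-inode, CAS $root$ from $r$ to a new inode whose $main$ is a new cnode containing only a new untombed snode $(k,v)$, restarting on failure; otherwise call iinsert$(r,k,v,0,null)$ and restart if it fails. iinsert$(i,k,v,lev,parent)$: read $cn=i.main$. If it is a cnode: if the flag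 for $m(lev,k)$ is unset, return the result of CAS $i.main$ from $cn$ to a copy of $cn$ with a new snode $(k,v)$ inserted; if the entry is an inode, recurse with level $lev+W$ and parent $i$; if the entry is an untombed snode $sn$ with $sn.k=k$, return the result of CAS $i.main$ from $cn$ to a copy with that entry replaced by a new snode $(k,v)$; if $sn.k\ne k$, return the result of CAS $i.main$ from $cn$ to a copy with that entry replaced by a new inode whose $main$ is a new cnode at level $lev+W$ containing $sn$ and a new snode $(k,v)$. If $i.main$ is a tombed snode or $null$: call clean$(parent)$ if $parent\ne null$, and fail. lookup$(k)$ / remove$(k)$: read $r=root$; if $r=null$ return NOTFOUND; if $r$ is a null-inode, CAS $root$ from $r$ to $null$ and restart; otherwise call ilookup$(r,k,0,null)$ / iremove$(r,k,0,null)$ and restart on RESTART. ilookup$(i,k,lev,parent)$: read $i.main$; if it is a cnode: return NOTFOUND if the flag is unset; recurse on an inode entry; on an untombed snode entry return its value if its key is $k$, else NOTFOUND. If $i.main$ is a tombed snode or $null$: clean$(parent)$ if $parent\ne null$, return RESTART. iremove$(i,k,lev,parent)$: as ilookup, except that on an untombed snode entry $sn$ with $sn.k=k$ it CASes $i.main$ from $cn$ to a copy without that entry (or to $null$ if $cn$ had a single entry), returning RESTART on failure; after a successful removal, if $parent\ne null$ it calls tombCompress$(i)$ and, if that returns true, contractParent$(parent,i,hashcode(k),lev-W)$, and returns $sn.v$. toCompressed$(cn)$: if $cn$ has exactly one entry and it is a tomb-inode, return its tombed snode; otherwise drop null-inode entries and replace tomb-inode entries by untombed copies of their snodes, returning the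 result if nonempty and $null$ otherwise. toWeakTombed$(cn)$: drop null-inode entries; if more than one entry remains return $cn$; if exactly one remains and it is a singleton return a tombed snode with its key and value; if exactly one remains otherwise return the one-entry cnode; if none remain return $null$. clean$(i)$: read $m=i.main$; if a cnode, CAS $i.main$ from $m$ to toCompressed$(m)$. tombCompress$(i)$: read $m=i.main$; if not a cnode return false; $w=$toWeakTombed$(m)$; if $w=m$ return false; CAS $i.main$ from $m$ to $w$; on success return true iff $w$ is $null$ or a tombed snode; on failure repeat. contractParent$(parent,i,hc,lev)$: read $m=i.main$ and $pm=parent.main$; if $pm$ is a cnode $cn$ whose entry for $hc$ at level $lev$ exists and equals $i$: if $m=null$ CAS $parent.main$ from $cn$ to $cn$ without that entry; if $m$ is a tombed snode CAS $parent.main$ from $cn$ to $cn$ with that entry replaced by an untombed copy; on CAS failure repeat; otherwise return. Memory is garbage-collected and new nodes are freshly allocated. Abstract semantics. The Ctrie state represents the abstract set of keys $k$ for which an snode with key $k$ is reachable from $root$ along the path determined by the hashcode chunks of $k$ (through inodes' $main$ fields and cnode entries). insert$(k,v)$ adds $k$, remove$(k)$ removes $k$ (returning its value or NOTFOUND), lookup$(k)$ returns the value of $k$ or NOTFOUND. *)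

theory Defs
  imports Complex_Main
begin

unbundle bit_operations_syntax

section \<open>Operations, histories and linearizability\<close>

datatype ('k, 'v) oper = Insert 'k 'v | Lookup 'k | Remove 'k

datatype 'v result = Done | NotFound | Found 'v

fun key :: "('k, 'v) oper \<Rightarrow> 'k" where
  "key (Insert k v) = k"
| "key (Lookup k) = k"
| "key (Remove k) = k"

abbreviation to_result :: "'v option \<Rightarrow> 'v result" where
  "to_result x \<equiv> (case x of None \<Rightarrow> NotFound | Some v \<Rightarrow> Found v)"

text \<open>The sequential specification. The abstract state is a set of keys, each carrying
  the value that \<open>lookup\<close> and \<open>remove\<close> have to return.\<close>

fun spec_result :: "('k, 'v) oper \<Rightarrow> ('k \<rightharpoonup> 'v) \<Rightarrow> 'v result" where
  "spec_result (Insert k v) A = Done"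
| "spec_result (Lookup k) A = to_result (A k)"
| "spec_result (Remove k) A = to_result (A k)"

fun spec_state :: "('k, 'v) oper \<Rightarrow> ('k \<rightharpoonup> 'v) \<Rightarrow> ('k \<rightharpoonup> 'v)" where
  "spec_state (Insert k v) A = A(k \<mapsto> v)"
| "spec_state (Lookup k) A = A"
| "spec_state (Remove k) A = A(k := None)"

fun legal :: "('k \<rightharpoonup> 'v) \<Rightarrow> (('k, 'v) oper \<times> 'v result) list \<Rightarrow> ('k \<rightharpoonup> 'v) \<Rightarrow> bool" where
  "legal A [] B \<longleftrightarrow> A = B"
| "legal A ((op, r) # xs) B \<longleftrightarrow> spec_result op A = r \<and> legal (spec_state op A) xs B"

datatype ('t, 'k, 'v) event =
  is_Inv: Inv (tid: 't) (inv_oper: "('k, 'v) oper")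
| is_Resp: Resp (tid: 't) (resp_result: "'v result")

type_synonym ('t, 'k, 'v) history = "('t, 'k, 'v) event list"

text \<open>An invocation is identified with its position in the history, and the response matching
  it is the next event of the same thread.\<close>

definition matches :: "('t, 'k, 'v) history \<Rightarrow> nat \<Rightarrow> nat \<Rightarrow> bool" where
  "matches h i j \<longleftrightarrow> i < j \<and> j < length h \<and> is_Inv (h ! i) \<and> is_Resp (h ! j) \<and>
     tid (h ! j) = tid (h ! i) \<and> (\<forall>n. i < n \<and> n < j \<longrightarrow> tid (h ! n) \<noteq> tid (h ! i))"

text \<open>Time is measured so that the \<open>i\<close>-th event of the history happens at time \<open>i\<close>. The invocations
  in \<open>L\<close> take effect, invocation \<open>i\<close> at time \<open>pt i\<close> and with result \<open>\<rho> i\<close>. Every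
  completed invocation has to be in \<open>L\<close>; a pending one may or may not have taken effect.
  \<open>A\<close> is the abstract state after all these effects.\<close>

definition linearization ::
  "('t, 'k, 'v) history \<Rightarrow> nat list \<Rightarrow> (nat \<Rightarrow> real) \<Rightarrow> (nat \<Rightarrow> 'v result) \<Rightarrow> ('k \<rightharpoonup> 'v) \<Rightarrow> bool"
where
  "linearization h L pt \<rho> A \<longleftrightarrow>
     sorted_wrt (\<lambda>i j. pt i < pt j) L \<and>
     (\<forall>i \<in> set L. i < length h \<and> is_Inv (h ! i) \<and> real i < pt i) \<and>
     (\<forall>i j. matches h i j \<longrightarrow>
        i \<in> set L \<and> pt i < real j \<and> \<rho> i = resp_result (h ! j)) \<and>
     legal Map.empty (map (\<lambda>i. (inv_oper (h ! i), \<rho> i)) L) A"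

definition linearizable_to :: "('t, 'k, 'v) history \<Rightarrow> ('k \<rightharpoonup> 'v) \<Rightarrow> bool" where
  "linearizable_to h A \<longleftrightarrow> (\<exists>L pt \<rho>. linearization h L pt \<rho> A)"


section \<open>Nodes and memory\<close>

type_synonym ref = nat

text \<open>The only mutable fields are \<open>rootp\<close> and the field of an \<open>INode\<close>. A reference is an address,
  \<open>null\<close> is \<open>None\<close>, and CAS compares references, not contents. Addresses are never
  reused; garbage collection is otherwise unobservable and is not modelled.\<close>

datatype ('k, 'v) node =
  INode (main: "ref option")
| CNode (bmp: nat) (arr: "ref list")
| SNode (skey: 'k) (sval: 'v) (tomb: bool)

type_synonym ('k, 'v) heap = "ref \<rightharpoonup> ('k, 'v) node"

record ('k, 'v) mem =
  rootp :: "ref option"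
  heap :: "('k, 'v) heap"

definition empty_mem :: "('k, 'v) mem" where
  "empty_mem = \<lparr>rootp = None, heap = Map.empty\<rparr>"

definition alloc :: "('k, 'v) heap \<Rightarrow> ('k, 'v) node \<Rightarrow> ('k, 'v) heap \<Rightarrow> ref \<Rightarrow> bool" where
  "alloc H n H' a \<longleftrightarrow> H a = None \<and> H' = H(a \<mapsto> n)"

definition null_inode :: "('k, 'v) heap \<Rightarrow> ref \<Rightarrow> bool" where
  "null_inode H i \<longleftrightarrow> H i = Some (INode None)"

definition tomb_inode :: "('k, 'v) heap \<Rightarrow> ref \<Rightarrow> bool" where
  "tomb_inode H i \<longleftrightarrow> (\<exists>s k v. H i = Some (INode (Some s)) \<and> H s = Some (SNode k v True))"

definition singleton :: "('k, 'v) heap \<Rightarrow> ref \<Rightarrow> 'k \<Rightarrow> 'v \<Rightarrow> bool" where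
  "singleton H e k v \<longleftrightarrow> (\<exists>t. H e = Some (SNode k v t)) \<or>
     (\<exists>s. H e = Some (INode (Some s)) \<and> H s = Some (SNode k v True))"

definition bit_count :: "nat \<Rightarrow> nat" where
  "bit_count n = card {b. bit n b}"

text \<open>A cnode given by the list of its entries, each with its bit, in increasing order of bits.\<close>

definition mk_cnode :: "(nat \<times> ref) list \<Rightarrow> ('k, 'v) node" where
  "mk_cnode es = CNode (foldr (\<lambda>(b, _). set_bit b) es 0) (map snd es)"


section \<open>Control states of a thread\<close>

text \<open>All recursive calls of the algorithm are tail calls, so no call stack is needed. Conventions for
  the arguments: \<open>i\<close> an inode with level \<open>l\<close> and parent \<open>p\<close>, \<open>c\<close> the cnode that was read from
  the field to be updated, \<open>w\<close> the new value for that field. After a successful removal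
  only the removed key \<open>k\<close> and the value \<open>v\<close> to be returned are still needed.\<close>

datatype ('k, 'v) pc =
  Idle
| Return "'v result"
| Start "('k, 'v) oper"
| CheckRoot "('k, 'v) oper" ref
| CasRoot "('k, 'v) oper" "ref option"
\<comment> \<open>\<open>iinsert\<close>, \<open>ilookup\<close>, \<open>iremove\<close>: \<open>Walk op i l p\<close>, \<open>InsertCas k v i l c\<close>, \<open>RemoveCas k v i l p c\<close>\<close>
| Walk "('k, 'v) oper" ref nat "ref option"
| InsertCas 'k 'v ref nat ref
| RemoveCas 'k 'v ref nat "ref option" ref
\<comment> \<open>\<open>clean(p)\<close>, after which \<open>op\<close> restarts; scans take entries still to be visited and entries kept\<close>
| Clean "('k, 'v) oper" ref
| CompressOne "('k, 'v) oper" ref ref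
| CompressDrop "('k, 'v) oper" ref ref "(nat \<times> ref) list" "(nat \<times> ref) list"
| CompressUntomb "('k, 'v) oper" ref ref "(nat \<times> ref) list" "(nat \<times> ref) list"
| CleanCas "('k, 'v) oper" ref ref "ref option"
\<comment> \<open>\<open>tombCompress(i)\<close>: \<open>Tomb k v i l p\<close>\<close>
| Tomb 'k 'v ref nat ref
| TombDrop 'k 'v ref nat ref ref "(nat \<times> ref) list" "(nat \<times> ref) list"
| TombCas 'k 'v ref nat ref ref "ref option"
\<comment> \<open>\<open>contractParent(p, i, hashcode(k), l)\<close>: \<open>Contract k v p i l\<close>; here \<open>l\<close> is the level of \<open>p\<close>,
  and \<open>m\<close> in \<open>ContractParent k v p i l m\<close> is the value read from \<open>i\<close>\<close>
| Contract 'k 'v ref ref nat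
| ContractParent 'k 'v ref ref nat "ref option"
| ContractCas 'k 'v ref ref nat "ref option" ref


section \<open>The algorithm\<close>

locale ctrie =
  fixes W :: nat
    and hashcode :: "'k \<Rightarrow> nat"
begin

definition chunk :: "nat \<Rightarrow> 'k \<Rightarrow> nat" where
  "chunk l k = drop_bit l (hashcode k) mod 2 ^ W"

definition flag :: "nat \<Rightarrow> nat \<Rightarrow> 'k \<Rightarrow> bool" where
  "flag bm l k \<longleftrightarrow> bit bm (chunk l k)"

definition pos :: "nat \<Rightarrow> nat \<Rightarrow> 'k \<Rightarrow> nat" where
  "pos bm l k = bit_count ((push_bit (chunk l k) 1 - 1) AND bm)"

definition entry :: "nat \<Rightarrow> ref list \<Rightarrow> nat \<Rightarrow> 'k \<Rightarrow> ref option" where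
  "entry bm ar l k = (if flag bm l k then Some (ar ! pos bm l k) else None)"

definition entries :: "nat \<Rightarrow> ref list \<Rightarrow> (nat \<times> ref) list" where
  "entries bm ar = zip (filter (bit bm) [0..<2 ^ W]) ar"

definition inserted :: "nat \<Rightarrow> ref list \<Rightarrow> nat \<Rightarrow> 'k \<Rightarrow> ref \<Rightarrow> ('k, 'v) node" where
  "inserted bm ar l k e =
     CNode (set_bit (chunk l k) bm) (take (pos bm l k) ar @ [e] @ drop (pos bm l k) ar)"

definition replaced :: "nat \<Rightarrow> ref list \<Rightarrow> nat \<Rightarrow> 'k \<Rightarrow> ref \<Rightarrow> ('k, 'v) node" where
  "replaced bm ar l k e = CNode bm (ar[pos bm l k := e])"

definition removed :: "nat \<Rightarrow> ref list \<Rightarrow> nat \<Rightarrow> 'k \<Rightarrow> ('k, 'v) node" where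
  "removed bm ar l k =
     CNode (unset_bit (chunk l k) bm) (take (pos bm l k) ar @ drop (Suc (pos bm l k)) ar)"

text \<open>Allocation of a new inode whose cnode at level \<open>l\<close> contains two snodes with different keys. While
  the chunks of the keys agree, they share an entry, which is again such an inode. If the
  hashcodes collide on all levels the construction does not terminate: no derivation exists,
  so a thread that needs it makes no further step.\<close>

inductive branch ::
  "('k, 'v) heap \<Rightarrow> nat \<Rightarrow> 'k \<Rightarrow> ref \<Rightarrow> 'k \<Rightarrow> ref \<Rightarrow> ('k, 'v) heap \<Rightarrow> ref \<Rightarrow> bool"
where
  split:
  "\<lbrakk>chunk l k1 \<noteq> chunk l k2;
    es = (if chunk l k1 < chunk l k2 then [(chunk l k1, s1), (chunk l k2, s2)]
          else [(chunk l k2, s2), (chunk l k1, s1)]);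
    alloc H (mk_cnode es) H1 c; alloc H1 (INode (Some c)) H2 i\<rbrakk>
   \<Longrightarrow> branch H l k1 s1 k2 s2 H2 i"
| deepen:
  "\<lbrakk>chunk l k1 = chunk l k2; branch H (l + W) k1 s1 k2 s2 H1 j;
    alloc H1 (mk_cnode [(chunk l k1, j)]) H2 c; alloc H2 (INode (Some c)) H3 i\<rbrakk>
   \<Longrightarrow> branch H l k1 s1 k2 s2 H3 i"

text \<open>The new cnode \<open>c'\<close> by which \<open>iinsert\<close> at level \<open>l\<close> wants to replace \<open>c\<close>.\<close>

inductive insert_copy ::
  "('k, 'v) heap \<Rightarrow> 'k \<Rightarrow> 'v \<Rightarrow> nat \<Rightarrow> ref \<Rightarrow> ('k, 'v) heap \<Rightarrow> ref \<Rightarrow> bool"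
where
  add:
  "\<lbrakk>H c = Some (CNode bm ar); entry bm ar l k = None;
    alloc H (SNode k v False) H1 s; alloc H1 (inserted bm ar l k s) H2 c'\<rbrakk>
   \<Longrightarrow> insert_copy H k v l c H2 c'"
| overwrite:
  "\<lbrakk>H c = Some (CNode bm ar); entry bm ar l k = Some e; H e = Some (SNode k v0 False);
    alloc H (SNode k v False) H1 s; alloc H1 (replaced bm ar l k s) H2 c'\<rbrakk>
   \<Longrightarrow> insert_copy H k v l c H2 c'"
| extend:
  "\<lbrakk>H c = Some (CNode bm ar); entry bm ar l k = Some e; H e = Some (SNode k0 v0 False); k0 \<noteq> k;
    alloc H (SNode k v False) H1 s; branch H1 (l + W) k0 e k s H2 j;
    alloc H2 (replaced bm ar l k j) H3 c'\<rbrakk>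
   \<Longrightarrow> insert_copy H k v l c H3 c'"

inductive remove_copy ::
  "('k, 'v) heap \<Rightarrow> 'k \<Rightarrow> nat \<Rightarrow> ref \<Rightarrow> ('k, 'v) heap \<Rightarrow> ref option \<Rightarrow> bool"
where
  last:
  "\<lbrakk>H c = Some (CNode bm ar); length ar = 1\<rbrakk> \<Longrightarrow> remove_copy H k l c H None"
| drop:
  "\<lbrakk>H c = Some (CNode bm ar); length ar \<noteq> 1; alloc H (removed bm ar l k) H' c'\<rbrakk>
   \<Longrightarrow> remove_copy H k l c H' (Some c')"

text \<open>The new cnode by which \<open>contractParent\<close> wants to replace \<open>c\<close>, if \<open>m\<close> is what it read from
  the inode to be contracted.\<close>

inductive contract_copy ::
  "('k, 'v) heap \<Rightarrow> 'k \<Rightarrow> nat \<Rightarrow> ref option \<Rightarrow> ref \<Rightarrow> ('k, 'v) heap \<Rightarrow> ref \<Rightarrow> bool"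
where
  null:
  "\<lbrakk>H c = Some (CNode bm ar); alloc H (removed bm ar l k) H' c'\<rbrakk>
   \<Longrightarrow> contract_copy H k l None c H' c'"
| tombed:
  "\<lbrakk>H c = Some (CNode bm ar); H s = Some (SNode k' v' True);
    alloc H (SNode k' v' False) H1 s'; alloc H1 (replaced bm ar l k s') H2 c'\<rbrakk>
   \<Longrightarrow> contract_copy H k l (Some s) c H2 c'"

text \<open>The result of \<open>toWeakTombed(c)\<close>, given the entries \<open>es\<close> that were kept; it is \<open>c\<close> itself
  iff more than one entry was kept.\<close>

inductive weak_tombed ::
  "('k, 'v) heap \<Rightarrow> ref \<Rightarrow> (nat \<times> ref) list \<Rightarrow> ('k, 'v) heap \<Rightarrow> ref option \<Rightarrow> bool"
where
  many: "length es > 1 \<Longrightarrow> weak_tombed H c es H (Some c)"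
| none: "weak_tombed H c [] H None"
| single: "\<lbrakk>singleton H e k v; alloc H (SNode k v True) H' s\<rbrakk>
   \<Longrightarrow> weak_tombed H c [(b, e)] H' (Some s)"
| other: "\<lbrakk>\<nexists>k v. singleton H e k v; alloc H (mk_cnode [(b, e)]) H' c'\<rbrakk>
   \<Longrightarrow> weak_tombed H c [(b, e)] H' (Some c')"

text \<open>A step of one thread accesses the mutable shared memory (\<open>rootp\<close> or the field of an inode) at most
  once, either by a read or by a CAS. It may also do thread-local work: read immutable
  fields and allocate nodes that no other thread can see yet. The nodes built for a CAS that fails
  in the same step are garbage and left out of the new memory.\<close>

inductive step ::
  "('k, 'v) mem \<Rightarrow> ('k, 'v) pc \<Rightarrow> ('k, 'v) mem \<Rightarrow> ('k, 'v) pc \<Rightarrow> bool"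
where
\<comment> \<open>top level\<close>
  start_null_insert:
  "rootp m = None \<Longrightarrow> step m (Start (Insert k v)) m (CasRoot (Insert k v) None)"
| start_null_lookup:
  "rootp m = None \<Longrightarrow> step m (Start (Lookup k)) m (Return NotFound)"
| start_null_remove:
  "rootp m = None \<Longrightarrow> step m (Start (Remove k)) m (Return NotFound)"
| start:
  "rootp m = Some r \<Longrightarrow> step m (Start op) m (CheckRoot op r)"
| check_root_null:
  "null_inode (heap m) r \<Longrightarrow> step m (CheckRoot op r) m (CasRoot op (Some r))"
| check_root:
  "\<not> null_inode (heap m) r \<Longrightarrow> step m (CheckRoot op r) m (Walk op r 0 None)"
| cas_root_insert:
  "\<lbrakk>rootp m = r; alloc (heap m) (SNode k v False) H1 s;
    alloc H1 (mk_cnode [(chunk 0 k, s)]) H2 c; alloc H2 (INode (Some c)) H3 i\<rbrakk>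
   \<Longrightarrow> step m (CasRoot (Insert k v) r) \<lparr>rootp = Some i, heap = H3\<rparr> (Return Done)"
| cas_root_lookup:
  "rootp m = r \<Longrightarrow> step m (CasRoot (Lookup k) r) (m\<lparr>rootp := None\<rparr>) (Start (Lookup k))"
| cas_root_remove:
  "rootp m = r \<Longrightarrow> step m (CasRoot (Remove k) r) (m\<lparr>rootp := None\<rparr>) (Start (Remove k))"
| cas_root_fail:
  "rootp m \<noteq> r \<Longrightarrow> step m (CasRoot op r) m (Start op)"

\<comment> \<open>\<open>iinsert\<close>, \<open>ilookup\<close>, \<open>iremove\<close>\<close>
| walk_null:
  "heap m i = Some (INode None)
   \<Longrightarrow> step m (Walk op i l p) m (case p of None \<Rightarrow> Start op | Some p' \<Rightarrow> Clean op p')"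
| walk_tomb:
  "\<lbrakk>heap m i = Some (INode (Some s)); heap m s = Some (SNode k' v' True)\<rbrakk>
   \<Longrightarrow> step m (Walk op i l p) m (case p of None \<Rightarrow> Start op | Some p' \<Rightarrow> Clean op p')"
| walk_down:
  "\<lbrakk>heap m i = Some (INode (Some c)); heap m c = Some (CNode bm ar);
    entry bm ar l (key op) = Some j; heap m j = Some (INode x)\<rbrakk>
   \<Longrightarrow> step m (Walk op i l p) m (Walk op j (l + W) (Some i))"
| walk_unset_insert:
  "\<lbrakk>heap m i = Some (INode (Some c)); heap m c = Some (CNode bm ar); entry bm ar l k = None\<rbrakk>
   \<Longrightarrow> step m (Walk (Insert k v) i l p) m (InsertCas k v i l c)"
| walk_snode_insert:
  "\<lbrakk>heap m i = Some (INode (Some c)); heap m c = Some (CNode bm ar);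
    entry bm ar l k = Some s; heap m s = Some (SNode k' v' False)\<rbrakk>
   \<Longrightarrow> step m (Walk (Insert k v) i l p) m (InsertCas k v i l c)"
| walk_unset_lookup:
  "\<lbrakk>heap m i = Some (INode (Some c)); heap m c = Some (CNode bm ar); entry bm ar l k = None\<rbrakk>
   \<Longrightarrow> step m (Walk (Lookup k) i l p) m (Return NotFound)"
| walk_snode_lookup:
  "\<lbrakk>heap m i = Some (INode (Some c)); heap m c = Some (CNode bm ar);
    entry bm ar l k = Some s; heap m s = Some (SNode k' v' False)\<rbrakk>
   \<Longrightarrow> step m (Walk (Lookup k) i l p) m (Return (if k' = k then Found v' else NotFound))"
| walk_unset_remove:
  "\<lbrakk>heap m i = Some (INode (Some c)); heap m c = Some (CNode bm ar); entry bm ar l k = None\<rbrakk>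
   \<Longrightarrow> step m (Walk (Remove k) i l p) m (Return NotFound)"
| walk_snode_remove:
  "\<lbrakk>heap m i = Some (INode (Some c)); heap m c = Some (CNode bm ar);
    entry bm ar l k = Some s; heap m s = Some (SNode k' v' False)\<rbrakk>
   \<Longrightarrow> step m (Walk (Remove k) i l p) m
         (if k' = k then RemoveCas k v' i l p c else Return NotFound)"
| insert_cas:
  "\<lbrakk>heap m i = Some (INode (Some c)); insert_copy (heap m) k v l c H c'\<rbrakk>
   \<Longrightarrow> step m (InsertCas k v i l c) (m\<lparr>heap := H(i \<mapsto> INode (Some c'))\<rparr>) (Return Done)"
| insert_cas_fail:
  "\<lbrakk>heap m i \<noteq> Some (INode (Some c)); insert_copy (heap m) k v l c H c'\<rbrakk>
   \<Longrightarrow> step m (InsertCas k v i l c) m (Start (Insert k v))"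
| remove_cas:
  "\<lbrakk>heap m i = Some (INode (Some c)); remove_copy (heap m) k l c H w\<rbrakk>
   \<Longrightarrow> step m (RemoveCas k v i l p c) (m\<lparr>heap := H(i \<mapsto> INode w)\<rparr>)
         (case p of None \<Rightarrow> Return (Found v) | Some p' \<Rightarrow> Tomb k v i l p')"
| remove_cas_fail:
  "heap m i \<noteq> Some (INode (Some c))
   \<Longrightarrow> step m (RemoveCas k v i l p c) m (Start (Remove k))"

\<comment> \<open>\<open>clean\<close> and \<open>toCompressed\<close>\<close>
| clean:
  "\<lbrakk>heap m p = Some (INode (Some c)); heap m c = Some (CNode bm ar)\<rbrakk>
   \<Longrightarrow> step m (Clean op p) m
         (if length ar = 1 then CompressOne op p c else CompressDrop op p c (entries bm ar) [])"
| clean_skip: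
  "\<lbrakk>heap m p = Some (INode x);
    \<nexists>c bm ar. x = Some c \<and> heap m c = Some (CNode bm ar)\<rbrakk>
   \<Longrightarrow> step m (Clean op p) m (Start op)"
| compress_one_tomb:
  "\<lbrakk>heap m c = Some (CNode bm [e]); heap m e = Some (INode (Some s));
    heap m s = Some (SNode k' v' True)\<rbrakk>
   \<Longrightarrow> step m (CompressOne op p c) m (CleanCas op p c (Some s))"
| compress_one_other:
  "\<lbrakk>heap m c = Some (CNode bm [e]); \<not> tomb_inode (heap m) e\<rbrakk>
   \<Longrightarrow> step m (CompressOne op p c) m (CompressDrop op p c (entries bm [e]) [])"
| compress_drop:
  "step m (CompressDrop op p c ((b, e) # es) ks) m
     (CompressDrop op p c es (if null_inode (heap m) e then ks else ks @ [(b, e)]))"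
| compress_drop_done:
  "step m (CompressDrop op p c [] ks) m (CompressUntomb op p c ks [])"
| compress_untomb:
  "\<lbrakk>heap m e = Some (INode (Some s)); heap m s = Some (SNode k' v' True);
    alloc (heap m) (SNode k' v' False) H s'\<rbrakk>
   \<Longrightarrow> step m (CompressUntomb op p c ((b, e) # es) ks) (m\<lparr>heap := H\<rparr>)
         (CompressUntomb op p c es (ks @ [(b, s')]))"
| compress_untomb_keep:
  "\<not> tomb_inode (heap m) e
   \<Longrightarrow> step m (CompressUntomb op p c ((b, e) # es) ks) m
         (CompressUntomb op p c es (ks @ [(b, e)]))"
| compress_null:
  "step m (CompressUntomb op p c [] []) m (CleanCas op p c None)"
| compress_cnode:
  "\<lbrakk>ks \<noteq> []; alloc (heap m) (mk_cnode ks) H c'\<rbrakk>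
   \<Longrightarrow> step m (CompressUntomb op p c [] ks) (m\<lparr>heap := H\<rparr>) (CleanCas op p c (Some c'))"
| clean_cas:
  "heap m p = Some (INode (Some c))
   \<Longrightarrow> step m (CleanCas op p c w) (m\<lparr>heap := (heap m)(p \<mapsto> INode w)\<rparr>) (Start op)"
| clean_cas_fail:
  "heap m p \<noteq> Some (INode (Some c)) \<Longrightarrow> step m (CleanCas op p c w) m (Start op)"

\<comment> \<open>\<open>tombCompress\<close> and \<open>toWeakTombed\<close>\<close>
| tomb:
  "\<lbrakk>heap m i = Some (INode (Some c)); heap m c = Some (CNode bm ar)\<rbrakk>
   \<Longrightarrow> step m (Tomb k v i l p) m (TombDrop k v i l p c (entries bm ar) [])"
| tomb_skip:
  "\<lbrakk>heap m i = Some (INode x);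
    \<nexists>c bm ar. x = Some c \<and> heap m c = Some (CNode bm ar)\<rbrakk>
   \<Longrightarrow> step m (Tomb k v i l p) m (Return (Found v))"
| tomb_drop:
  "step m (TombDrop k v i l p c ((b, e) # es) ks) m
     (TombDrop k v i l p c es (if null_inode (heap m) e then ks else ks @ [(b, e)]))"
| tomb_drop_done:
  "weak_tombed (heap m) c ks H w
   \<Longrightarrow> step m (TombDrop k v i l p c [] ks) (m\<lparr>heap := H\<rparr>)
         (if w = Some c then Return (Found v) else TombCas k v i l p c w)"
| tomb_cas_contract:
  "\<lbrakk>heap m i = Some (INode (Some c));
    w = None \<or> (\<exists>s k' v'. w = Some s \<and> heap m s = Some (SNode k' v' True))\<rbrakk>
   \<Longrightarrow> step m (TombCas k v i l p c w) (m\<lparr>heap := (heap m)(i \<mapsto> INode w)\<rparr>)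
         (Contract k v p i (l - W))"
| tomb_cas:
  "\<lbrakk>heap m i = Some (INode (Some c)); w = Some c'; heap m c' = Some (CNode bm ar)\<rbrakk>
   \<Longrightarrow> step m (TombCas k v i l p c w) (m\<lparr>heap := (heap m)(i \<mapsto> INode w)\<rparr>)
         (Return (Found v))"
| tomb_cas_fail:
  "heap m i \<noteq> Some (INode (Some c)) \<Longrightarrow> step m (TombCas k v i l p c w) m (Tomb k v i l p)"

\<comment> \<open>\<open>contractParent\<close>\<close>
| contract:
  "heap m i = Some (INode x) \<Longrightarrow> step m (Contract k v p i l) m (ContractParent k v p i l x)"
| contract_parent:
  "\<lbrakk>heap m p = Some (INode (Some c)); heap m c = Some (CNode bm ar); entry bm ar l k = Some i;
    x = None \<or> (\<exists>s k' v'. x = Some s \<and> heap m s = Some (SNode k' v' True))\<rbrakk>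
   \<Longrightarrow> step m (ContractParent k v p i l x) m (ContractCas k v p i l x c)"
| contract_skip:
  "\<lbrakk>heap m p = Some (INode y);
    \<not> ((\<exists>c bm ar. y = Some c \<and> heap m c = Some (CNode bm ar) \<and> entry bm ar l k = Some i) \<and>
       (x = None \<or> (\<exists>s k' v'. x = Some s \<and> heap m s = Some (SNode k' v' True))))\<rbrakk>
   \<Longrightarrow> step m (ContractParent k v p i l x) m (Return (Found v))"
| contract_cas:
  "\<lbrakk>heap m p = Some (INode (Some c)); contract_copy (heap m) k l x c H c'\<rbrakk>
   \<Longrightarrow> step m (ContractCas k v p i l x c) (m\<lparr>heap := H(p \<mapsto> INode (Some c'))\<rparr>)
         (Return (Found v))"
| contract_cas_fail:
  "heap m p \<noteq> Some (INode (Some c))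
   \<Longrightarrow> step m (ContractCas k v p i l x c) m (Contract k v p i l)"

text \<open>\<open>execution h m P\<close>: starting from the empty Ctrie with all threads idle, the threads can reach memory
  \<open>m\<close> and control states \<open>P\<close> after the history \<open>h\<close> of invocations and responses.\<close>

inductive execution ::
  "('t, 'k, 'v) history \<Rightarrow> ('k, 'v) mem \<Rightarrow> ('t \<Rightarrow> ('k, 'v) pc) \<Rightarrow> bool"
where
  init: "execution [] empty_mem (\<lambda>_. Idle)"
| invoke: "\<lbrakk>execution h m P; P t = Idle\<rbrakk> \<Longrightarrow> execution (h @ [Inv t op]) m (P(t := Start op))"
| internal: "\<lbrakk>execution h m P; step m (P t) m' q\<rbrakk> \<Longrightarrow> execution h m' (P(t := q))"
| respond: "\<lbrakk>execution h m P; P t = Return r\<rbrakk> \<Longrightarrow> execution (h @ [Resp t r]) m (P(t := Idle))"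


subsection \<open>The abstract state represented by the memory\<close>

inductive reaches :: "('k, 'v) heap \<Rightarrow> 'k \<Rightarrow> nat \<Rightarrow> ref \<Rightarrow> 'v \<Rightarrow> bool" for H k where
  main_snode:
  "\<lbrakk>H i = Some (INode (Some s)); H s = Some (SNode k v t)\<rbrakk> \<Longrightarrow> reaches H k l i v"
| entry_snode:
  "\<lbrakk>H i = Some (INode (Some c)); H c = Some (CNode bm ar); entry bm ar l k = Some s;
    H s = Some (SNode k v t)\<rbrakk> \<Longrightarrow> reaches H k l i v"
| entry_inode:
  "\<lbrakk>H i = Some (INode (Some c)); H c = Some (CNode bm ar); entry bm ar l k = Some j;
    reaches H k (l + W) j v\<rbrakk> \<Longrightarrow> reaches H k l i v"

text \<open>The domain of \<open>A\<close> is the set of keys that are in the Ctrie.\<close>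

definition represents :: "('k, 'v) mem \<Rightarrow> ('k \<rightharpoonup> 'v) \<Rightarrow> bool" where
  "represents m A \<longleftrightarrow>
     (\<forall>k v. A k = Some v \<longleftrightarrow> (\<exists>r. rootp m = Some r \<and> reaches (heap m) k 0 r v))"

end

end

theory Submission
  imports Defs
begin

text \<open>Every operation takes effect at one of its own steps: an insertion at its successful CAS, a removal
  at the CAS that drops the snode, and a lookup or an unsuccessful removal at its last read of the
  root or of an inode. Two facts make this work. First, an inode never changes any more once it holds null or a
  tombed snode, and only such inodes are unlinked. Hence an inode that still holds a cnode is
  still in the tree, on the path of exactly those keys for which it was created, and the
  result of reading it, or of a CAS on it, determines the abstract state at these keys. Second,
  cleaning and contracting only exploit what was seen in such dead inodes, so a successful CAS of
  this kind does not change the abstract state, however old the information is.\<close>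

section \<open>Linearizations of growing histories\<close>

text \<open>Being in the tree is never expressed as reachability from the root.
  \<open>rooted\<close> only asks that every inode holding a cnode is the root or an entry of a
  cnode held by some inode. That inode holds a cnode too, and its level is smaller because
  \<open>W\<close> is positive, so climbing ends at the root. The condition is local: a write to one
  field only has to keep the live entries of the cnode that it overwrites.

  There is no room for live garbage. Cnodes and snodes may be built long before the CAS that
  publishes them, but inodes are created only in the very step whose CAS links them.

  Paths are recorded in a ghost map \<open>loc\<close>, fixed at allocation. A thread may therefore
  keep the location of an inode for as long as it likes, whereas the fact that the inode is in the
  tree is derived afresh at each access, from the cnode found in it.\<close>

definition pending :: "('t, 'k, 'v) history \<Rightarrow> 't \<Rightarrow> nat \<Rightarrow> bool" where
  "pending h t i \<longleftrightarrow> i < length h \<and> is_Inv (h ! i) \<and> tid (h ! i) = t \<and>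
     (\<forall>n. i < n \<and> n < length h \<longrightarrow> tid (h ! n) \<noteq> t)"

lemma pending_unique: "pending h t i \<Longrightarrow> pending h t j \<Longrightarrow> i = j"
  unfolding pending_def by (metis nat_neq_iff)

lemma pending_snoc:
  "pending (h @ [e]) t i \<longleftrightarrow>
     (tid e \<noteq> t \<and> pending h t i) \<or> (i = length h \<and> is_Inv e \<and> tid e = t)"
  unfolding pending_def by (auto simp: nth_append less_Suc_eq)

lemma matches_snoc:
  "matches (h @ [e]) i j \<longleftrightarrow>
     matches h i j \<or> (j = length h \<and> is_Resp e \<and> pending h (tid e) i)"
  unfolding matches_def pending_def by (auto simp: nth_append less_Suc_eq)

lemma legal_append: "legal A (xs @ ys) C \<longleftrightarrow> (\<exists>B. legal A xs B \<and> legal B ys C)"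
  by (induction A xs C rule: legal.induct) auto

text \<open>Appending an event can only complete the invocation pending in the thread of
  \<open>e\<close>. The response then happens at time \<open>length h\<close>, and
  \<open>early\<close> puts the point of the operation before it.\<close>

lemma linearization_snoc:
  assumes lin: "linearization h L pt \<rho> A"
    and early: "\<forall>i\<in>set L. pt i < real (length h)"
    and resp: "\<And>i. is_Resp e \<Longrightarrow> pending h (tid e) i \<Longrightarrow> i \<in> set L \<and> \<rho> i = resp_result e"
  shows "linearization (h @ [e]) L pt \<rho> A"
proof -
  have M: "map (\<lambda>i. (inv_oper ((h @ [e]) ! i), \<rho> i)) L = map (\<lambda>i. (inv_oper (h ! i), \<rho> i)) L"
    using lin by (auto simp: linearization_def nth_append)
  have "i \<in> set L \<and> pt i < real j \<and> \<rho> i = resp_result ((h @ [e]) ! j)"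
    if "matches (h @ [e]) i j" for i j
  proof (cases "matches h i j")
    case True
    then have "j < length h"
      by (simp add: matches_def)
    then show ?thesis
      using True lin by (simp add: linearization_def nth_append)
  next
    case False
    then have "j = length h" "is_Resp e" "pending h (tid e) i"
      using that by (auto simp: matches_snoc)
    then show ?thesis
      using resp early by simp
  qed
  moreover have "i < length (h @ [e]) \<and> is_Inv ((h @ [e]) ! i) \<and> real i < pt i" if "i \<in> set L" for i
    using that lin by (auto simp: linearization_def nth_append)
  ultimately show ?thesis
    using lin unfolding linearization_def M by blast
qed

text \<open>Since time is dense, there is room after the invocation and all points chosen so far,
  yet before the next event, which will happen at time \<open>length h\<close>. The new operation
  thus comes last and acts on the current state \<open>A\<close>.\<close>

lemma linearization_point:
  assumes lin: "linearization h L pt \<rho> A"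
    and early: "\<forall>j\<in>set L. pt j < real (length h)"
    and i: "pending h t i" "i \<notin> set L"
  obtains pt' where
    "linearization h (L @ [i]) pt' (\<rho>(i := spec_result (inv_oper (h ! i)) A))
       (spec_state (inv_oper (h ! i)) A)"
    "\<forall>j\<in>set (L @ [i]). pt' j < real (length h)"
proof -
  \<comment> \<open>Including \<open>real i\<close> puts the new point after the invocation, and
    makes the maximum meaningful when \<open>L\<close> is empty.\<close>
  let ?M = "Max (insert (real i) (pt ` set L))"
  have "?M < real (length h)"
    using early i by (auto simp: pending_def)
  then obtain x where x: "?M < x" "x < real (length h)"
    using dense by blast
  then have x': "real i < x" "\<And>j. j \<in> set L \<Longrightarrow> pt j < x"
    by auto
  let ?pt = "pt(i := x)" and ?r = "spec_result (inv_oper (h ! i)) A"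
  have "sorted_wrt (\<lambda>i j. ?pt i < ?pt j) L"
    using lin i(2) by (auto simp: linearization_def intro: sorted_wrt_mono_rel[rotated])
  then have "sorted_wrt (\<lambda>i j. ?pt i < ?pt j) (L @ [i])"
    using x' i by (auto simp: sorted_wrt_append)
  moreover have M: "map (\<lambda>j. (inv_oper (h ! j), (\<rho>(i := ?r)) j)) (L @ [i]) =
      map (\<lambda>j. (inv_oper (h ! j), \<rho> j)) L @ [(inv_oper (h ! i), ?r)]"
    using i(2) by auto
  have "legal Map.empty (map (\<lambda>j. (inv_oper (h ! j), (\<rho>(i := ?r)) j)) (L @ [i]))
      (spec_state (inv_oper (h ! i)) A)"
    unfolding M using lin by (auto simp: legal_append linearization_def)
  moreover have "j < length h \<and> is_Inv (h ! j) \<and> real j < ?pt j" if "j \<in> set (L @ [i])" for j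
    using that lin x' i by (auto simp: linearization_def pending_def)
  moreover have "j \<in> set (L @ [i]) \<and> ?pt j < real n \<and> (\<rho>(i := ?r)) j = resp_result (h ! n)"
    if "matches h j n" for j n
  proof -
    have "j \<in> set L \<and> pt j < real n \<and> \<rho> j = resp_result (h ! n)"
      using that lin by (simp add: linearization_def)
    then show ?thesis
      using i(2) by auto
  qed
  ultimately have "linearization h (L @ [i]) ?pt (\<rho>(i := ?r)) (spec_state (inv_oper (h ! i)) A)"
    unfolding linearization_def by blast
  moreover have "\<forall>j\<in>set (L @ [i]). ?pt j < real (length h)"
    using early x by auto
  ultimately show thesis by (rule that)
qed

text \<open>A pending operation is before or after its linearization point.\<close>

datatype ('k, 'v) phase = Quiet | Before "('k, 'v) oper" | After "'v result"

text \<open>In phase \<open>After r\<close> the result is already fixed by \<open>\<rho>\<close>, so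
  a thread can only respond with \<open>r\<close>.\<close>

fun phase_ok ::
  "('t, 'k, 'v) history \<Rightarrow> nat list \<Rightarrow> (nat \<Rightarrow> 'v result) \<Rightarrow> 't \<Rightarrow> ('k, 'v) phase \<Rightarrow> bool" where
  "phase_ok h L \<rho> t Quiet \<longleftrightarrow> (\<forall>i. \<not> pending h t i)"
| "phase_ok h L \<rho> t (Before op) \<longleftrightarrow> (\<exists>i. pending h t i \<and> i \<notin> set L \<and> inv_oper (h ! i) = op)"
| "phase_ok h L \<rho> t (After r) \<longleftrightarrow> (\<exists>i. pending h t i \<and> i \<in> set L \<and> \<rho> i = r)"

lemma phase_ok_snoc:
  assumes "phase_ok h L \<rho> t ph" "tid e \<noteq> t"
  shows "phase_ok (h @ [e]) L \<rho> t ph"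
proof -
  have "(h @ [e]) ! i = h ! i" if "pending h t i" for i
    using that by (simp add: pending_def nth_append)
  then show ?thesis
    using assms by (cases ph) (auto simp: pending_snoc)
qed

lemma phase_ok_point:
  assumes "phase_ok h L \<rho> t ph" "pending h u i" "u \<noteq> t"
  shows "phase_ok h (L @ [i]) (\<rho>(i := r)) t ph"
proof -
  have "j \<noteq> i" if "pending h t j" for j
    using that assms by (auto simp: pending_def)
  then show ?thesis
    using assms by (cases ph) (fastforce+)
qed

text \<open>The bound on the points keeps them before every event still to come, in particular
  before the responses of operations that have taken effect but are still pending.\<close>

definition lin_inv ::
  "('t, 'k, 'v) history \<Rightarrow> ('k \<rightharpoonup> 'v) \<Rightarrow> ('t \<Rightarrow> ('k, 'v) phase) \<Rightarrow> bool" where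
  "lin_inv h A \<Phi> \<longleftrightarrow> (\<exists>L pt \<rho>. linearization h L pt \<rho> A \<and> (\<forall>i\<in>set L. pt i < real (length h)) \<and>
     (\<forall>t. phase_ok h L \<rho> t (\<Phi> t)))"

lemma lin_inv_linearizable: "lin_inv h A \<Phi> \<Longrightarrow> linearizable_to h A"
  unfolding lin_inv_def linearizable_to_def by blast

lemma lin_inv_Nil: "lin_inv [] Map.empty (\<lambda>_. Quiet)"
  unfolding lin_inv_def
  by (rule exI[of _ "[]"]) (auto simp: linearization_def matches_def pending_def)

lemma lin_inv_invoke:
  assumes "lin_inv h A \<Phi>" "\<Phi> t = Quiet"
  shows "lin_inv (h @ [Inv t op]) A (\<Phi>(t := Before op))"
proof -
  from assms(1) obtain L pt \<rho> where L: "linearization h L pt \<rho> A"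
    "\<forall>i\<in>set L. pt i < real (length h)" and ph: "\<And>t. phase_ok h L \<rho> t (\<Phi> t)"
    unfolding lin_inv_def by blast
  have "linearization (h @ [Inv t op]) L pt \<rho> A"
    by (rule linearization_snoc[OF L]) auto
  moreover have "\<forall>i\<in>set L. pt i < real (length (h @ [Inv t op]))"
    using L(2) by auto
  moreover have "length h \<notin> set L"
    using L(1) by (auto simp: linearization_def)
  then have "phase_ok (h @ [Inv t op]) L \<rho> u ((\<Phi>(t := Before op)) u)" for u
    using phase_ok_snoc[OF ph[of u]] by (cases "u = t") (auto simp: pending_snoc)
  ultimately show ?thesis
    unfolding lin_inv_def by blast
qed

lemma lin_inv_respond:
  assumes "lin_inv h A \<Phi>" "\<Phi> t = After r"
  shows "lin_inv (h @ [Resp t r]) A (\<Phi>(t := Quiet))"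
proof -
  from assms(1) obtain L pt \<rho> where L: "linearization h L pt \<rho> A"
    "\<forall>i\<in>set L. pt i < real (length h)" and ph: "\<And>t. phase_ok h L \<rho> t (\<Phi> t)"
    unfolding lin_inv_def by blast
  have "linearization (h @ [Resp t r]) L pt \<rho> A"
    by (rule linearization_snoc[OF L]) (use ph[of t] assms(2) pending_unique in fastforce)
  moreover have "\<forall>i\<in>set L. pt i < real (length (h @ [Resp t r]))"
    using L(2) by auto
  moreover have "phase_ok (h @ [Resp t r]) L \<rho> u ((\<Phi>(t := Quiet)) u)" for u
    using phase_ok_snoc[OF ph[of u]] by (cases "u = t") (auto simp: pending_snoc)
  ultimately show ?thesis
    unfolding lin_inv_def by blast
qed

lemma lin_inv_point:
  assumes "lin_inv h A \<Phi>" "\<Phi> t = Before op"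
  shows "lin_inv h (spec_state op A) (\<Phi>(t := After (spec_result op A)))"
proof -
  from assms(1) obtain L pt \<rho> where L: "linearization h L pt \<rho> A"
    "\<forall>i\<in>set L. pt i < real (length h)" and ph: "\<And>t. phase_ok h L \<rho> t (\<Phi> t)"
    unfolding lin_inv_def by blast
  obtain i where i: "pending h t i" "i \<notin> set L" "inv_oper (h ! i) = op"
    using ph[of t] assms(2) by auto
  obtain pt' where pt': "linearization h (L @ [i]) pt' (\<rho>(i := spec_result op A)) (spec_state op A)"
    "\<forall>j\<in>set (L @ [i]). pt' j < real (length h)"
    using linearization_point[OF L i(1,2)] i(3) by metis
  have "phase_ok h (L @ [i]) (\<rho>(i := spec_result op A)) u ((\<Phi>(t := After (spec_result op A))) u)" for u
    using phase_ok_point[OF ph[of u] i(1)] i(1) by (cases "u = t") auto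
  then show ?thesis
    using pt' unfolding lin_inv_def by blast
qed


section \<open>Cnodes as finite maps\<close>

context ctrie
begin

definition wf_cnode :: "nat \<Rightarrow> ref list \<Rightarrow> bool" where
  "wf_cnode bm ar \<longleftrightarrow> length ar = bit_count bm \<and> (\<forall>b. bit bm b \<longrightarrow> b < 2 ^ W)"

definition cmap :: "nat \<Rightarrow> ref list \<Rightarrow> nat \<rightharpoonup> ref" where
  "cmap bm ar = map_of (entries bm ar)"

lemma chunk_less: "chunk l k < 2 ^ W"
  by (simp add: chunk_def)

lemma bit_count_eq:
  assumes "\<And>b. bit n b \<Longrightarrow> b < m"
  shows "bit_count n = length (filter (bit n) [0..<m])"
proof -
  have "{b. bit n b} = set (filter (bit n) [0..<m])"
    using assms by auto
  then show ?thesis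
    unfolding bit_count_def by (metis distinct_card distinct_filter distinct_upt)
qed

text \<open>The number \<open>push_bit c 1 - 1\<close> is the mask of the \<open>c\<close> lowest
  bits, so the bit count is the number of entries preceding bit \<open>c\<close> in the
  array.\<close>

lemma pos_eq: "pos bm l k = length (filter (bit bm) [0..<chunk l k])"
proof -
  have "push_bit (chunk l k) 1 - 1 = (mask (chunk l k) :: nat)"
    by (simp add: mask_eq_exp_minus_1 push_bit_eq_mult)
  then have "pos bm l k = bit_count (mask (chunk l k) AND bm)"
    by (simp add: pos_def)
  also have "\<dots> = length (filter (bit (mask (chunk l k) AND bm)) [0..<chunk l k])"
    by (rule bit_count_eq) (simp add: bit_simps)
  also have "filter (bit (mask (chunk l k) AND bm)) [0..<chunk l k] = filter (bit bm) [0..<chunk l k]"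
    by (rule filter_cong) (auto simp: bit_simps)
  finally show ?thesis .
qed

lemma upt_split: "b < (n::nat) \<Longrightarrow> [0..<n] = [0..<b] @ b # [Suc b..<n]"
  using upt_add_eq_append[of 0 b "n - b"] by (simp add: upt_conv_Cons)

text \<open>Cutting a cnode at the bit of a key: all operations on it act at the cut.\<close>

lemma cnode_cut:
  assumes "wf_cnode bm ar"
  obtains F1 F2 a1 a2 where
    "\<And>bm' :: nat. (\<And>b. b \<noteq> chunk l k \<Longrightarrow> bit bm' b = bit bm b) \<Longrightarrow>
       filter (bit bm') [0..<2 ^ W] = F1 @ (if bit bm' (chunk l k) then [chunk l k] else []) @ F2"
    "chunk l k \<notin> set F1" "chunk l k \<notin> set F2" "length a1 = length F1" "length a2 = length F2"
    "pos bm l k = length a1"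
    "bit bm (chunk l k) \<Longrightarrow> \<exists>e. ar = a1 @ e # a2"
    "\<not> bit bm (chunk l k) \<Longrightarrow> ar = a1 @ a2"
proof -
  let ?b = "chunk l k"
  let ?F1 = "filter (bit bm) [0..<?b]" and ?F2 = "filter (bit bm) [Suc ?b..<2 ^ W]"
  \<comment> \<open>Stated for every bitmap that agrees with \<open>bm\<close> off the cut bit, so
    that one cut describes the cnode both before and after this bit is set or cleared.\<close>
  have cut: "filter (bit bm') [0..<2 ^ W] = ?F1 @ (if bit bm' ?b then [?b] else []) @ ?F2"
    if "\<And>b. b \<noteq> ?b \<Longrightarrow> bit bm' b = bit bm b" for bm' :: nat
  proof -
    have "filter (bit bm') [0..<?b] = ?F1" "filter (bit bm') [Suc ?b..<2 ^ W] = ?F2"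
      using that by (auto intro!: filter_cong)
    then show ?thesis
      by (simp add: upt_split[OF chunk_less[of l k]])
  qed
  have len: "length ar = length (?F1 @ (if bit bm ?b then [?b] else []) @ ?F2)"
    using assms bit_count_eq[of bm "2 ^ W"] cut[of bm] by (simp add: wf_cnode_def)
  show thesis
  proof (cases "bit bm ?b")
    case True
    let ?a1 = "take (length ?F1) ar" and ?a2 = "drop (Suc (length ?F1)) ar"
    show thesis
    proof (rule that[of ?F1 ?F2 ?a1 ?a2])
      show "\<exists>e. ar = ?a1 @ e # ?a2"
        by (intro exI, rule id_take_nth_drop) (use len True in simp)
    qed (use len True cut in \<open>auto simp: pos_eq\<close>)
  next
    case False
    let ?a1 = "take (length ?F1) ar" and ?a2 = "drop (length ?F1) ar"
    show thesis
      by (rule that[of ?F1 ?F2 ?a1 ?a2]) (use len False cut in \<open>auto simp: pos_eq\<close>)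
  qed
qed

lemma bit_count_length:
  "(\<forall>b. bit bm b \<longrightarrow> b < 2 ^ W) \<Longrightarrow> bit_count bm = length (filter (bit bm) [0..<2 ^ W])"
  by (rule bit_count_eq) auto

text \<open>As \<open>map_of\<close> takes the first match, only an occurrence of \<open>b\<close>
  in \<open>F1\<close> could hide the new pair.\<close>

lemma map_of_zip_cut:
  assumes "b \<notin> set F1" "length a1 = length F1"
  shows "map_of (zip (F1 @ b # F2) (a1 @ e # a2)) = (map_of (zip (F1 @ F2) (a1 @ a2)))(b \<mapsto> e)"
proof -
  have "map_of (zip F1 a1) b = None"
    using assms by (simp add: map_of_zip_is_None)
  moreover have "zip (F1 @ b # F2) (a1 @ e # a2) = zip F1 a1 @ (b, e) # zip F2 a2"
    "zip (F1 @ F2) (a1 @ a2) = zip F1 a1 @ zip F2 a2"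
    using assms by simp_all
  ultimately show ?thesis
    by (auto simp: fun_eq_iff map_add_def split: option.splits)
qed

lemma map_of_zip_cut_None:
  assumes "b \<notin> set F1" "b \<notin> set F2" "length a1 = length F1" "length a2 = length F2"
  shows "map_of (zip (F1 @ F2) (a1 @ a2)) b = None"
proof -
  have "map_of (zip F1 a1) b = None" "map_of (zip F2 a2) b = None"
    using assms by (simp_all add: map_of_zip_is_None)
  moreover have "zip (F1 @ F2) (a1 @ a2) = zip F1 a1 @ zip F2 a2"
    using assms by simp
  ultimately show ?thesis
    by (simp only: map_of_append map_add_None)
qed

text \<open>Links the indexing by bit counts in the algorithm with the finite map: by the cut, the
  index of the entry is the length of the part of the array before it.\<close>

lemma entry_eq_cmap:
  assumes "wf_cnode bm ar"
  shows "entry bm ar l k = cmap bm ar (chunk l k)"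
proof -
  obtain F1 F2 a1 a2 where
    F: "\<And>bm' :: nat. (\<And>b. b \<noteq> chunk l k \<Longrightarrow> bit bm' b = bit bm b) \<Longrightarrow>
       filter (bit bm') [0..<2 ^ W] = F1 @ (if bit bm' (chunk l k) then [chunk l k] else []) @ F2"
    and c: "chunk l k \<notin> set F1" "chunk l k \<notin> set F2" "length a1 = length F1" "length a2 = length F2"
    "pos bm l k = length a1"
    "bit bm (chunk l k) \<Longrightarrow> \<exists>e. ar = a1 @ e # a2"
    "\<not> bit bm (chunk l k) \<Longrightarrow> ar = a1 @ a2"
    by (rule cnode_cut[OF assms, of l k]) blast
  note F = F[of bm, OF refl]
  show ?thesis
  proof (cases "bit bm (chunk l k)")
    case True
    with c(6) obtain e where "ar = a1 @ e # a2" by blast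
    then show ?thesis
      using True F c(1-5) by (simp add: nth_append entry_def flag_def cmap_def entries_def map_of_zip_cut del: zip_append)
  next
    case False
    then show ?thesis
      using F c by (simp add: entry_def flag_def cmap_def entries_def map_of_zip_cut_None del: zip_append)
  qed
qed

lemma inserted_cnode:
  assumes "wf_cnode bm ar" "entry bm ar l k = None"
  obtains bm' ar' where "inserted bm ar l k e = CNode bm' ar'" "wf_cnode bm' ar'"
    "cmap bm' ar' = (cmap bm ar)(chunk l k \<mapsto> e)"
proof -
  obtain F1 F2 a1 a2 where
    F: "\<And>bm' :: nat. (\<And>b. b \<noteq> chunk l k \<Longrightarrow> bit bm' b = bit bm b) \<Longrightarrow>
       filter (bit bm') [0..<2 ^ W] = F1 @ (if bit bm' (chunk l k) then [chunk l k] else []) @ F2"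
    and c: "chunk l k \<notin> set F1" "chunk l k \<notin> set F2" "length a1 = length F1" "length a2 = length F2"
    "pos bm l k = length a1"
    "bit bm (chunk l k) \<Longrightarrow> \<exists>e. ar = a1 @ e # a2"
    "\<not> bit bm (chunk l k) \<Longrightarrow> ar = a1 @ a2"
    by (rule cnode_cut[OF assms(1), of l k]) blast
  have nb: "\<not> bit bm (chunk l k)"
    using assms(2) by (auto simp: entry_def flag_def split: if_splits)
  let ?bm = "set_bit (chunk l k) bm" and ?ar = "a1 @ e # a2"
  have bnd: "\<forall>b. bit ?bm b \<longrightarrow> b < 2 ^ W"
    using assms(1) chunk_less by (auto simp: wf_cnode_def bit_simps)
  have F': "filter (bit ?bm) [0..<2 ^ W] = F1 @ chunk l k # F2"
    using F[of ?bm] by (auto simp: bit_simps)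
  show thesis
  proof (rule that)
    show "inserted bm ar l k e = CNode ?bm ?ar"
      using c nb by (simp add: inserted_def)
    show "wf_cnode ?bm ?ar"
      using bnd bit_count_length[OF bnd] c F' by (simp add: wf_cnode_def)
    show "cmap ?bm ?ar = (cmap bm ar)(chunk l k \<mapsto> e)"
      using c nb F[of bm] F' by (simp add: cmap_def entries_def map_of_zip_cut del: zip_append)
  qed
qed

lemma replaced_cnode:
  assumes "wf_cnode bm ar" "entry bm ar l k = Some e0"
  obtains bm' ar' where "replaced bm ar l k e = CNode bm' ar'" "wf_cnode bm' ar'"
    "cmap bm' ar' = (cmap bm ar)(chunk l k \<mapsto> e)"
proof -
  have b: "bit bm (chunk l k)"
    using assms(2) by (auto simp: entry_def flag_def split: if_splits)
  obtain F1 F2 a1 a2 where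
    F: "\<And>bm' :: nat. (\<And>b. b \<noteq> chunk l k \<Longrightarrow> bit bm' b = bit bm b) \<Longrightarrow>
       filter (bit bm') [0..<2 ^ W] = F1 @ (if bit bm' (chunk l k) then [chunk l k] else []) @ F2"
    and c: "chunk l k \<notin> set F1" "chunk l k \<notin> set F2" "length a1 = length F1" "length a2 = length F2"
    "pos bm l k = length a1"
    "bit bm (chunk l k) \<Longrightarrow> \<exists>e. ar = a1 @ e # a2"
    "\<not> bit bm (chunk l k) \<Longrightarrow> ar = a1 @ a2"
    by (rule cnode_cut[OF assms(1), of l k]) blast
  obtain e1 where e1: "ar = a1 @ e1 # a2"
    using b c(6) by blast
  let ?ar = "a1 @ e # a2"
  show thesis
  proof (rule that)
    show "replaced bm ar l k e = CNode bm ?ar"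
      using c(1-5) by (simp add: replaced_def e1 list_update_append)
    show "wf_cnode bm ?ar"
      using assms c(1-5) e1 by (simp add: wf_cnode_def)
    show "cmap bm ?ar = (cmap bm ar)(chunk l k \<mapsto> e)"
      using c(1-5) e1 b F[of bm] by (simp add: cmap_def entries_def map_of_zip_cut del: zip_append)
  qed
qed

lemma removed_cnode:
  assumes "wf_cnode bm ar" "entry bm ar l k = Some e0"
  obtains bm' ar' where "removed bm ar l k = CNode bm' ar'" "wf_cnode bm' ar'"
    "cmap bm' ar' = (cmap bm ar)(chunk l k := None)"
proof -
  have b: "bit bm (chunk l k)"
    using assms(2) by (auto simp: entry_def flag_def split: if_splits)
  obtain F1 F2 a1 a2 where
    F: "\<And>bm' :: nat. (\<And>b. b \<noteq> chunk l k \<Longrightarrow> bit bm' b = bit bm b) \<Longrightarrow>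
       filter (bit bm') [0..<2 ^ W] = F1 @ (if bit bm' (chunk l k) then [chunk l k] else []) @ F2"
    and c: "chunk l k \<notin> set F1" "chunk l k \<notin> set F2" "length a1 = length F1" "length a2 = length F2"
    "pos bm l k = length a1"
    "bit bm (chunk l k) \<Longrightarrow> \<exists>e. ar = a1 @ e # a2"
    "\<not> bit bm (chunk l k) \<Longrightarrow> ar = a1 @ a2"
    by (rule cnode_cut[OF assms(1), of l k]) blast
  obtain e1 where e1: "ar = a1 @ e1 # a2"
    using b c(6) by blast
  let ?bm = "unset_bit (chunk l k) bm" and ?ar = "a1 @ a2"
  have bnd: "\<forall>b. bit ?bm b \<longrightarrow> b < 2 ^ W"
    using assms(1) by (auto simp: wf_cnode_def bit_simps)
  have F': "filter (bit ?bm) [0..<2 ^ W] = F1 @ F2"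
    using F[of ?bm] by (auto simp: bit_simps)
  show thesis
  proof (rule that)
    show "removed bm ar l k = CNode ?bm ?ar"
      using c(1-5) by (simp add: removed_def e1)
    show "wf_cnode ?bm ?ar"
      using bnd bit_count_length[OF bnd] c F' by (simp add: wf_cnode_def)
    have "cmap ?bm ?ar (chunk l k) = None"
      using c F' by (simp add: cmap_def entries_def map_of_zip_cut_None del: zip_append)
    then show "cmap ?bm ?ar = (cmap bm ar)(chunk l k := None)"
      using c(1-5) e1 b F[of bm] F' by (auto simp: cmap_def entries_def map_of_zip_cut fun_eq_iff simp del: zip_append)
  qed
qed

text \<open>Strict order makes such a list coincide with the enumeration that \<open>entries\<close>
  reads off the bitmap, so that bits and array positions of \<open>mk_cnode\<close> match.\<close>

definition bit_list :: "(nat \<times> ref) list \<Rightarrow> bool" where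
  "bit_list es \<longleftrightarrow> sorted_wrt (<) (map fst es) \<and> (\<forall>b\<in>set (map fst es). b < 2 ^ W)"

lemma bit_list_drop: "bit_list (xs @ x # ys) \<Longrightarrow> bit_list (xs @ ys)"
  by (auto simp: bit_list_def sorted_wrt_append)

lemma bit_list_update: "bit_list (xs @ (b, e) # ys) \<Longrightarrow> bit_list (xs @ (b, e') # ys)"
  by (auto simp: bit_list_def sorted_wrt_append)

lemma bit_list_entries: "wf_cnode bm ar \<Longrightarrow> bit_list (entries bm ar)"
proof -
  assume "wf_cnode bm ar"
  then have "map fst (entries bm ar) = filter (bit bm) [0..<2 ^ W]"
    using bit_count_length[of bm] by (simp add: wf_cnode_def entries_def)
  then show ?thesis
    by (simp add: bit_list_def sorted_wrt_filter)
qed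

lemma bit_foldr_set_bit:
  "bit (foldr (\<lambda>(b, _). set_bit b) es 0 :: nat) n \<longleftrightarrow> n \<in> fst ` set es"
  by (induction es) (auto simp: bit_simps)

lemma mk_cnode:
  assumes "bit_list es"
  obtains bm ar where "mk_cnode es = CNode bm ar" "wf_cnode bm ar" "cmap bm ar = map_of es"
proof -
  let ?bm = "foldr (\<lambda>(b, _). set_bit b) es 0 :: nat"
  have bnd: "\<forall>b. bit ?bm b \<longrightarrow> b < 2 ^ W"
    using assms by (auto simp: bit_foldr_set_bit bit_list_def)
  have "sorted_wrt (<) (filter (bit ?bm) [0..<2 ^ W])"
    by (simp add: sorted_wrt_filter)
  moreover have "set (filter (bit ?bm) [0..<2 ^ W]) = set (map fst es)"
    using assms by (auto simp: bit_foldr_set_bit bit_list_def)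
  ultimately have F: "filter (bit ?bm) [0..<2 ^ W] = map fst es"
    using assms by (metis bit_list_def strict_sorted_equal)
  show thesis
  proof (rule that)
    show "mk_cnode es = CNode ?bm (map snd es)"
      by (simp add: mk_cnode_def)
    show "wf_cnode ?bm (map snd es)"
      using bnd bit_count_length[OF bnd] F by (simp add: wf_cnode_def)
    show "cmap ?bm (map snd es) = map_of es"
      by (simp add: cmap_def entries_def F zip_map_fst_snd)
  qed
qed

lemma length_one_entries:
  assumes "wf_cnode bm ar" "length ar = 1"
  obtains b e where "cmap bm ar = [b \<mapsto> e]" "ar = [e]"
proof -
  from assms(2) obtain e where e: "ar = [e]"
    by (auto simp: length_Suc_conv)
  have "length (filter (bit bm) [0..<2 ^ W]) = 1"
    using assms bit_count_length[of bm] by (simp add: wf_cnode_def)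
  then obtain b where "filter (bit bm) [0..<2 ^ W] = [b]"
    by (auto simp: length_Suc_conv)
  then show thesis
    using that e by (simp add: cmap_def entries_def)
qed

end


section \<open>Heap invariants\<close>

text \<open>The ghost location of an inode or cnode: its level, and the keys whose paths lead to it.\<close>

type_synonym 'k loc = "ref \<Rightarrow> nat \<times> 'k set"

context ctrie
begin

definition child :: "nat \<times> 'k set \<Rightarrow> nat \<Rightarrow> nat \<times> 'k set" where
  "child x b = (fst x + W, {k \<in> snd x. chunk (fst x) k = b})"

text \<open>An snode has no location of its own: \<open>branch\<close> reuses an existing snode at a
  deeper level. Only membership of its key in the key set of the place is required. Tombed snodes
  occur as contents of inodes, never as entries.\<close>

definition ok_entry :: "('k, 'v) heap \<Rightarrow> 'k loc \<Rightarrow> nat \<times> 'k set \<Rightarrow> ref \<Rightarrow> bool" where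
  "ok_entry H loc x e \<longleftrightarrow> (\<exists>y. H e = Some (INode y) \<and> loc e = x) \<or>
     (\<exists>k v. H e = Some (SNode k v False) \<and> k \<in> snd x)"

text \<open>The first two alternatives are the dead inodes and the third one the live inodes. A
  cnode has the location of the inode holding it, so a copy meant for the same inode has to be given
  the same location.\<close>

definition ok_main :: "('k, 'v) heap \<Rightarrow> 'k loc \<Rightarrow> nat \<times> 'k set \<Rightarrow> ref option \<Rightarrow> bool" where
  "ok_main H loc x w \<longleftrightarrow> w = None \<or>
     (\<exists>s k v. w = Some s \<and> H s = Some (SNode k v True) \<and> k \<in> snd x) \<or>
     (\<exists>c bm ar. w = Some c \<and> H c = Some (CNode bm ar) \<and> loc c = x)"

fun ok_node :: "('k, 'v) heap \<Rightarrow> 'k loc \<Rightarrow> nat \<times> 'k set \<Rightarrow> ('k, 'v) node \<Rightarrow> bool" where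
  "ok_node H loc x (INode w) \<longleftrightarrow> ok_main H loc x w"
| "ok_node H loc x (CNode bm ar) \<longleftrightarrow> wf_cnode bm ar \<and>
     (\<forall>b e. cmap bm ar b = Some e \<longrightarrow> ok_entry H loc (child x b) e)"
| "ok_node H loc x (SNode k v t) \<longleftrightarrow> True"

definition ok_heap :: "('k, 'v) heap \<Rightarrow> 'k loc \<Rightarrow> bool" where
  "ok_heap H loc \<longleftrightarrow> (\<forall>a n. H a = Some n \<longrightarrow> ok_node H loc (loc a) n)"

definition alive :: "('k, 'v) heap \<Rightarrow> ref \<Rightarrow> bool" where
  "alive H i \<longleftrightarrow> (\<exists>c bm ar. H i = Some (INode (Some c)) \<and> H c = Some (CNode bm ar))"

text \<open>No CAS changes a dead inode, so what was read from it remains valid.\<close>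

definition dead :: "('k, 'v) heap \<Rightarrow> ref \<Rightarrow> ref option \<Rightarrow> bool" where
  "dead H i x \<longleftrightarrow> H i = Some (INode x) \<and>
     (x = None \<or> (\<exists>s k v. x = Some s \<and> H s = Some (SNode k v True)))"

definition entry_of :: "('k, 'v) heap \<Rightarrow> ref option \<Rightarrow> ref \<Rightarrow> bool" where
  "entry_of H w j \<longleftrightarrow>
     (\<exists>c bm ar b. w = Some c \<and> H c = Some (CNode bm ar) \<and> cmap bm ar b = Some j)"

definition linked :: "('k, 'v) heap \<Rightarrow> ref \<Rightarrow> bool" where
  "linked H j \<longleftrightarrow> (\<exists>i w. H i = Some (INode w) \<and> entry_of H w j)"

text \<open>\<open>R\<close> consists of the root and, in the middle of a CAS step, of new inodes
  that are not linked yet.\<close>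

definition rooted :: "('k, 'v) heap \<Rightarrow> ref set \<Rightarrow> bool" where
  "rooted H R \<longleftrightarrow> (\<forall>j. alive H j \<longrightarrow> j \<in> R \<or> linked H j)"

definition ok_mem :: "('k, 'v) mem \<Rightarrow> 'k loc \<Rightarrow> bool" where
  "ok_mem m loc \<longleftrightarrow> ok_heap (heap m) loc \<and> rooted (heap m) (set_option (rootp m)) \<and>
     (\<forall>r. rootp m = Some r \<longrightarrow> (\<exists>w. heap m r = Some (INode w)) \<and> loc r = (0, UNIV))"

text \<open>The rely condition: everything that other threads can do to the heap. Each fact
  remembered in a control state has to be stable under it.\<close>

definition evolves ::
  "('k, 'v) heap \<Rightarrow> 'k loc \<Rightarrow> ('k, 'v) heap \<Rightarrow> 'k loc \<Rightarrow> bool" where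
  "evolves H loc H' loc' \<longleftrightarrow>
     (\<forall>a n. H a = Some n \<longrightarrow> loc' a = loc a \<and>
        (case n of INode x \<Rightarrow> \<exists>y. H' a = Some (INode y) | _ \<Rightarrow> H' a = Some n)) \<and>
     (\<forall>i x. dead H i x \<longrightarrow> H' i = Some (INode x))"

lemma evolvesD:
  assumes "evolves H loc H' loc'"
  shows "H a = Some n \<Longrightarrow> loc' a = loc a"
    and "H a = Some (INode x) \<Longrightarrow> \<exists>y. H' a = Some (INode y)"
    and "H a = Some (CNode bm ar) \<Longrightarrow> H' a = Some (CNode bm ar)"
    and "H a = Some (SNode k v t) \<Longrightarrow> H' a = Some (SNode k v t)"
    and "dead H a x \<Longrightarrow> dead H' a x"
proof -
  have *: "loc' a = loc a \<and>
        (case n of INode x \<Rightarrow> \<exists>y. H' a = Some (INode y) | _ \<Rightarrow> H' a = Some n)"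
    if "H a = Some n" for a n
    using assms that unfolding evolves_def by blast
  show "H a = Some n \<Longrightarrow> loc' a = loc a"
    using *[of a n] by simp
  show "H a = Some (INode x) \<Longrightarrow> \<exists>y. H' a = Some (INode y)"
    using *[of a "INode x"] by simp
  show "H a = Some (CNode bm ar) \<Longrightarrow> H' a = Some (CNode bm ar)"
    using *[of a "CNode bm ar"] by simp
  have sn: "H' a = Some (SNode k v t)" if "H a = Some (SNode k v t)" for a k v t
    using *[of a "SNode k v t"] that by simp
  show "H a = Some (SNode k v t) \<Longrightarrow> H' a = Some (SNode k v t)"
    by (rule sn)
  have "dead H a x \<Longrightarrow> H' a = Some (INode x)"
    using assms by (simp add: evolves_def)
  then show "dead H a x \<Longrightarrow> dead H' a x"
    using sn unfolding dead_def by blast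
qed

lemma evolves_refl: "evolves H loc H loc"
  by (auto simp: evolves_def dead_def split: node.splits)

lemma evolves_trans:
  assumes 1: "evolves H loc H1 loc1" and 2: "evolves H1 loc1 H2 loc2"
  shows "evolves H loc H2 loc2"
  unfolding evolves_def
proof (intro conjI allI impI)
  fix a n assume a: "H a = Some n"
  show "loc2 a = loc a"
    using evolvesD[OF 1, of a] evolvesD[OF 2, of a] a by (cases n; force)
  show "case n of INode x \<Rightarrow> \<exists>y. H2 a = Some (INode y) | _ \<Rightarrow> H2 a = Some n"
    using evolvesD[OF 1, of a] evolvesD[OF 2, of a] a by (cases n) (force+)
next
  fix i x assume "dead H i x"
  then have "dead H2 i x"
    using evolvesD(5)[OF 1] evolvesD(5)[OF 2] by blast
  then show "H2 i = Some (INode x)"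
    by (simp add: dead_def)
qed

lemma ok_entry_evolves:
  assumes "evolves H loc H' loc'" "ok_entry H loc x e"
  shows "ok_entry H' loc' x e"
  using assms(2) evolvesD(1,2,4)[OF assms(1)] unfolding ok_entry_def by metis

lemma ok_main_evolves:
  assumes "evolves H loc H' loc'" "ok_main H loc x w"
  shows "ok_main H' loc' x w"
  using assms(2) evolvesD(1,3,4)[OF assms(1)] unfolding ok_main_def by metis

lemma ok_node_evolves:
  assumes "evolves H loc H' loc'" "ok_node H loc x n"
  shows "ok_node H' loc' x n"
  using assms(2) ok_entry_evolves[OF assms(1)] ok_main_evolves[OF assms(1)] by (cases n) simp_all

lemma map_le_evolves:
  assumes "H \<subseteq>\<^sub>m H'" "\<And>a. a \<in> dom H \<Longrightarrow> loc' a = loc a"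
  shows "evolves H loc H' loc'"
proof -
  have "H' a = Some n" if "H a = Some n" for a n
    using assms(1) that by (metis domI map_le_def)
  then show ?thesis
    using assms(2) unfolding evolves_def dead_def by (auto split: node.splits)
qed

section \<open>Allocations and writes to an inode preserve the heap invariants\<close>

lemma alloc_map_le: "alloc H n H' a \<Longrightarrow> H \<subseteq>\<^sub>m H'"
  by (auto simp: alloc_def map_le_def)

lemma alloc_at: "alloc H n H' a \<Longrightarrow> H' a = Some n"
  by (auto simp: alloc_def)

lemma alloc_evolves: "alloc H n H' a \<Longrightarrow> evolves H loc H' (loc(a := x))"
  by (rule map_le_evolves[OF alloc_map_le]) (auto simp: alloc_def)

lemma alloc_ok_heap:
  assumes "ok_heap H loc" "alloc H n H' a" "ok_node H loc x n"
  shows "ok_heap H' (loc(a := x))"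
proof -
  have ev: "evolves H loc H' (loc(a := x))"
    by (rule alloc_evolves[OF assms(2)])
  have "ok_node H' (loc(a := x)) ((loc(a := x)) b) n'" if "H' b = Some n'" for b n'
  proof (cases "b = a")
    case True
    then show ?thesis
      using that assms(2) ok_node_evolves[OF ev assms(3)] by (auto simp: alloc_def)
  next
    case False
    then have "H b = Some n'"
      using that assms(2) by (auto simp: alloc_def)
    then show ?thesis
      using False assms(1) ok_node_evolves[OF ev] by (simp add: ok_heap_def)
  qed
  then show ?thesis
    by (simp add: ok_heap_def)
qed

lemma ok_heap_main: "ok_heap H loc \<Longrightarrow> H i = Some (INode w) \<Longrightarrow> ok_main H loc (loc i) w"
  unfolding ok_heap_def by (metis ok_node.simps(1))

lemma ok_heap_wf: "ok_heap H loc \<Longrightarrow> H c = Some (CNode bm ar) \<Longrightarrow> wf_cnode bm ar"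
  unfolding ok_heap_def by (metis ok_node.simps(2))

lemma ok_heap_entry:
  "ok_heap H loc \<Longrightarrow> H c = Some (CNode bm ar) \<Longrightarrow> cmap bm ar b = Some e \<Longrightarrow>
   ok_entry H loc (child (loc c) b) e"
  unfolding ok_heap_def by (metis ok_node.simps(2))

lemma ok_heap_loc:
  assumes "ok_heap H loc" "H i = Some (INode (Some c))" "H c = Some (CNode bm ar)"
  shows "loc c = loc i"
  using ok_heap_main[OF assms(1,2)] assms(3) by (auto simp: ok_main_def)

lemma linked_map_le:
  assumes "H \<subseteq>\<^sub>m H'" "linked H j"
  shows "linked H' j"
proof -
  have "H' a = Some n" if "H a = Some n" for a n
    using assms(1) that by (metis domI map_le_def)
  then show ?thesis
    using assms(2) unfolding linked_def entry_of_def by blast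
qed

lemma rooted_alloc:
  assumes "ok_heap H loc" "alloc H n H' a" "rooted H R"
  shows "rooted H' (insert a R)"
  unfolding rooted_def
proof (intro allI impI)
  fix j assume j: "alive H' j"
  show "j \<in> insert a R \<or> linked H' j"
  proof (cases "j = a")
    case False
    then obtain c bm ar where c: "H j = Some (INode (Some c))" "H' c = Some (CNode bm ar)"
      using j assms(2) by (auto simp: alive_def alloc_def)
    \<comment> \<open>There are no dangling references, so filling the free address \<open>a\<close>
      cannot turn an old inode into a live one.\<close>
    have "c \<in> dom H"
      using ok_heap_main[OF assms(1) c(1)] by (auto simp: ok_main_def)
    then have "alive H j"
      using c assms(2) by (auto simp: alive_def alloc_def split: if_splits)
    then show ?thesis
      using assms(3) linked_map_le[OF alloc_map_le[OF assms(2)]] by (auto simp: rooted_def)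
  qed simp
qed

text \<open>Only inodes can be alive, hence cnodes and snodes can be allocated in advance without
  ever being linked.\<close>

lemma rooted_alloc_no_inode:
  assumes "ok_heap H loc" "alloc H n H' a" "rooted H R" "\<And>w. n \<noteq> INode w"
  shows "rooted H' R"
proof -
  have "\<not> alive H' a"
    using assms(2,4) by (auto simp: alive_def alloc_def)
  then show ?thesis
    using rooted_alloc[OF assms(1-3)] by (auto simp: rooted_def)
qed

lemma set_main_evolves:
  assumes "H p = Some (INode (Some c))" "H c = Some (CNode bm ar)"
  shows "evolves H loc (H(p \<mapsto> INode w)) loc"
  using assms unfolding evolves_def dead_def by (auto split: node.splits)

lemma set_main_ok_heap:
  assumes "ok_heap H loc" "H p = Some (INode (Some c))" "H c = Some (CNode bm ar)"
    "ok_main H loc (loc p) w"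
  shows "ok_heap (H(p \<mapsto> INode w)) loc"
proof -
  note ev = set_main_evolves[OF assms(2,3), of loc w]
  show ?thesis
    using assms(1) ok_node_evolves[OF ev] ok_main_evolves[OF ev assms(4)]
    by (auto simp: ok_heap_def)
qed

text \<open>Only inodes linked through \<open>p\<close> can lose their link. The live ones among
  them are entries of the new value by \<open>keep\<close>, and the new inodes \<open>J\<close> get
  their link from it.\<close>

lemma set_main_rooted:
  assumes "H p = Some (INode (Some c))" "H c = Some (CNode bm ar)"
    and "rooted H (R \<union> J)"
    and keep: "\<And>b j. cmap bm ar b = Some j \<Longrightarrow> alive H j \<Longrightarrow> entry_of H w j"
    and J: "\<And>j. j \<in> J \<Longrightarrow> entry_of H w j"
  shows "rooted (H(p \<mapsto> INode w)) R"
  unfolding rooted_def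
proof (intro allI impI)
  let ?H = "H(p \<mapsto> INode w)"
  have eo: "entry_of ?H w' j" if "entry_of H w' j" for w' j
    using that assms(1) unfolding entry_of_def by fastforce
  have new: "linked ?H j" if "entry_of H w j" for j
    using eo[OF that] unfolding linked_def by (metis fun_upd_same)
  \<comment> \<open>The write creates no live inode: the only changed one is \<open>p\<close>, which
    was alive already.\<close>
  fix j assume "alive ?H j"
  then have a: "alive H j"
    using assms(1,2) by (auto simp: alive_def split: if_splits)
  show "j \<in> R \<or> linked ?H j"
  proof (cases "j \<in> R \<union> J")
    case True
    then show ?thesis
      using J new by blast
  next
    case False
    then obtain i w' where i: "H i = Some (INode w')" "entry_of H w' j"
      using assms(3) a by (auto simp: rooted_def linked_def)
    show ?thesis
    proof (cases "i = p")
      case True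
      then have "entry_of H w j"
        using i assms(1,2) a keep by (auto simp: entry_of_def)
      then show ?thesis
        using new by blast
    next
      case False
      then show ?thesis
        using i eo unfolding linked_def by (metis fun_upd_other)
    qed
  qed
qed


subsection \<open>Following the path of a key\<close>

lemma not_reaches_null: "H i = Some (INode None) \<Longrightarrow> \<not> reaches H k l i v"
  by (auto elim: reaches.cases)

lemma reaches_tomb:
  "H i = Some (INode (Some s)) \<Longrightarrow> H s = Some (SNode k' v' t) \<Longrightarrow>
   reaches H k l i v \<longleftrightarrow> k = k' \<and> v = v'"
  by (auto elim: reaches.cases intro: main_snode)

text \<open>Covers both kinds of entries, an snode or an inode, so that one step of a path through a
  cnode is the single equivalence \<open>reaches_cnode\<close>.\<close>

definition holds :: "('k, 'v) heap \<Rightarrow> 'k \<Rightarrow> nat \<Rightarrow> ref \<Rightarrow> 'v \<Rightarrow> bool" where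
  "holds H k l e v \<longleftrightarrow> (\<exists>t. H e = Some (SNode k v t)) \<or> reaches H k l e v"

lemma holds_snode: "H e = Some (SNode k' v' t) \<Longrightarrow> holds H k l e v \<longleftrightarrow> k = k' \<and> v = v'"
  by (auto simp: holds_def elim: reaches.cases)

lemma holds_inode: "H e = Some (INode w) \<Longrightarrow> holds H k l e v \<longleftrightarrow> reaches H k l e v"
  by (auto simp: holds_def)

lemma reaches_cnode:
  assumes "H i = Some (INode (Some c))" "H c = Some (CNode bm ar)" "wf_cnode bm ar"
  shows "reaches H k l i v \<longleftrightarrow> (\<exists>e. cmap bm ar (chunk l k) = Some e \<and> holds H k (l + W) e v)"
proof
  assume "reaches H k l i v"
  then show "\<exists>e. cmap bm ar (chunk l k) = Some e \<and> holds H k (l + W) e v"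
    using assms by (cases rule: reaches.cases) (auto simp: holds_def entry_eq_cmap)
next
  assume "\<exists>e. cmap bm ar (chunk l k) = Some e \<and> holds H k (l + W) e v"
  then show "reaches H k l i v"
    using assms by (auto simp: holds_def intro: entry_snode entry_inode simp flip: entry_eq_cmap)
qed

lemma reaches_fun: "reaches H k l i v \<Longrightarrow> reaches H k l i v' \<Longrightarrow> v = v'"
proof (induction arbitrary: v' rule: reaches.induct)
  case (main_snode i s v t l)
  then show ?case
    by (auto simp: reaches_tomb)
next
  case (entry_snode i c bm ar l s v t)
  from entry_snode(5,1-4) show ?case
    by (cases rule: reaches.cases) (auto elim: reaches.cases)
next
  case (entry_inode i c bm ar l j v)
  from entry_inode(6,1-4) show ?case
    by (cases rule: reaches.cases) (auto elim: reaches.cases dest: entry_inode.IH)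
qed

text \<open>Along the path of \<open>k\<close> from \<open>i\<close> the level never decreases and
  \<open>k\<close> stays in the key set of each inode, so by \<open>off\<close> the path never meets
  a changed inode of \<open>X\<close>. For allocations \<open>X\<close> is empty; for a CAS on
  \<open>p\<close> it is \<open>{p}\<close>.\<close>

lemma reaches_unaffected:
  assumes ok: "ok_heap H loc"
    and same: "\<And>a n. H a = Some n \<Longrightarrow> a \<notin> X \<Longrightarrow> H' a = Some n"
    and X: "\<And>p. p \<in> X \<Longrightarrow> \<exists>w. H p = Some (INode w)"
    and off: "\<And>p. p \<in> X \<Longrightarrow> fst (loc p) < l \<or> k \<notin> snd (loc p)"
    and i: "H i = Some (INode w)" "fst (loc i) = l" "k \<in> snd (loc i)"
  shows "reaches H' k l i v \<longleftrightarrow> reaches H k l i v"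
proof
  have iX: "i \<notin> X" if "\<And>p. p \<in> X \<Longrightarrow> fst (loc p) < l \<or> k \<notin> snd (loc p)"
    "fst (loc i) = l" "k \<in> snd (loc i)" for i l
    using that by fastforce
  have cn: "H' c = Some (CNode bm ar)" if "H c = Some (CNode bm ar)" for c bm ar
    using same[OF that] X[of c] that by auto
  have sn: "H' c = Some (SNode k v t)" if "H c = Some (SNode k v t)" for c k v t
    using same[OF that] X[of c] that by auto
  have down: "fst (loc j) = l + W \<and> k \<in> snd (loc j) \<and> (\<forall>p\<in>X. fst (loc p) < l + W \<or> k \<notin> snd (loc p))"
    if "H i = Some (INode (Some c))" "H c = Some (CNode bm ar)" "entry bm ar l k = Some j"
      "H j = Some (INode y)" "fst (loc i) = l" "k \<in> snd (loc i)"
      "\<And>p. p \<in> X \<Longrightarrow> fst (loc p) < l \<or> k \<notin> snd (loc p)" for i c bm ar l j y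
  proof -
    have "ok_entry H loc (child (loc c) (chunk l k)) j"
      using that ok_heap_entry[OF ok] entry_eq_cmap ok_heap_wf[OF ok] by metis
    then show ?thesis
      using that ok_heap_loc[OF ok that(1,2)] by (fastforce simp: ok_entry_def child_def)
  qed
  show "reaches H k l i v" if "reaches H' k l i v"
    using that off i
  proof (induction arbitrary: w rule: reaches.induct)
    case (main_snode i s v t l)
    then have Hi: "H i = Some (INode (Some s))"
      using same[of i "INode w"] iX[of l i] by simp
    \<comment> \<open>\<open>H'\<close> may contain new nodes, but \<open>ok_main\<close> shows that
      \<open>s\<close> is already an snode or a cnode in \<open>H\<close>. Both are immutable, so
      what is found in \<open>H'\<close> was there in \<open>H\<close>.\<close>
    have "H s = Some (SNode k v t)"
      using ok_heap_main[OF ok Hi] main_snode(2) sn cn by (fastforce simp: ok_main_def)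
    then show ?case
      using Hi by (rule reaches.main_snode[rotated])
  next
    case (entry_snode i c bm ar l s v t)
    then have Hi: "H i = Some (INode (Some c))"
      using same[of i "INode w"] iX[of l i] by simp
    have Hc: "H c = Some (CNode bm ar)"
      using ok_heap_main[OF ok Hi] entry_snode(2) sn cn by (fastforce simp: ok_main_def)
    have "ok_entry H loc (child (loc c) (chunk l k)) s"
      using Hc entry_snode(3) ok_heap_entry[OF ok] entry_eq_cmap ok_heap_wf[OF ok] by metis
    then consider y where "H s = Some (INode y)" | k' v' where "H s = Some (SNode k' v' False)"
      by (auto simp: ok_entry_def)
    then have "H s = Some (SNode k v t)"
    proof cases
      case 1
      then have "H' s = Some (INode y)"
        using same[OF 1] down[OF Hi Hc entry_snode(3) 1] iX[of "l + W" s] entry_snode(5-8) by blast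
      then show ?thesis
        using entry_snode(4) by simp
    next
      case 2
      then show ?thesis
        using sn[OF 2] entry_snode(4) by simp
    qed
    then show ?case
      using Hi Hc entry_snode(3) by (blast intro: reaches.entry_snode)
  next
    case (entry_inode i c bm ar l j v)
    then have Hi: "H i = Some (INode (Some c))"
      using same[of i "INode w"] iX[of l i] by simp
    have Hc: "H c = Some (CNode bm ar)"
      using ok_heap_main[OF ok Hi] entry_inode(2) sn cn by (fastforce simp: ok_main_def)
    have "ok_entry H loc (child (loc c) (chunk l k)) j"
      using Hc entry_inode(3) ok_heap_entry[OF ok] entry_eq_cmap ok_heap_wf[OF ok] by metis
    then obtain y where j: "H j = Some (INode y)"
      using entry_inode(4) sn by (fastforce simp: ok_entry_def elim: reaches.cases)
    have "reaches H k (l + W) j v"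
      using entry_inode.IH[OF _ j] down[OF Hi Hc entry_inode(3) j] entry_inode(6-9) by blast
    then show ?case
      using Hi Hc entry_inode(3) by (blast intro: reaches.entry_inode)
  qed
  show "reaches H' k l i v" if "reaches H k l i v"
    using that off i
  proof (induction arbitrary: w rule: reaches.induct)
    case (main_snode i s v t l)
    then show ?case
      using same[of i "INode w"] iX[of l i] sn by (auto intro: reaches.main_snode)
  next
    case (entry_snode i c bm ar l s v t)
    then have "H' i = Some (INode (Some c))"
      using same[of i "INode w"] iX[of l i] by simp
    then show ?case
      using entry_snode(2-4) cn sn by (blast intro: reaches.entry_snode)
  next
    case (entry_inode i c bm ar l j v)
    obtain y where j: "H j = Some (INode y)"
      using entry_inode(4) by (auto elim: reaches.cases)
    have "reaches H' k (l + W) j v"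
      using entry_inode.IH[OF _ j] down[OF entry_inode(1-3) j] entry_inode(6-9) by blast
    moreover have "H' i = Some (INode (Some c))"
      using entry_inode same[of i "INode w"] iX[of l i] by simp
    ultimately show ?case
      using entry_inode(2-3) cn by (blast intro: reaches.entry_inode)
  qed
qed

lemma reaches_map_le:
  assumes "ok_heap H loc" "H \<subseteq>\<^sub>m H'" "H i = Some (INode w)" "k \<in> snd (loc i)"
  shows "reaches H' k (fst (loc i)) i v \<longleftrightarrow> reaches H k (fst (loc i)) i v"
  by (rule reaches_unaffected[where X = "{}"]) (use assms in \<open>auto simp: map_le_def\<close>, metis domI)

end


section \<open>The abstract state as seen from inodes in the tree\<close>

locale ctrie_wide = ctrie W hashcode for W :: nat and hashcode :: "'k \<Rightarrow> nat" +
  assumes W_pos: "W \<ge> 1"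
begin

definition stored :: "('k, 'v) mem \<Rightarrow> 'k \<Rightarrow> 'v \<Rightarrow> bool" where
  "stored m k v \<longleftrightarrow> (\<exists>r. rootp m = Some r \<and> reaches (heap m) k 0 r v)"

lemma ok_memD:
  assumes "ok_mem m loc"
  shows "ok_heap (heap m) loc" "rooted (heap m) (set_option (rootp m))"
    "rootp m = Some r \<Longrightarrow> (\<exists>w. heap m r = Some (INode w)) \<and> loc r = (0, UNIV)"
  using assms by (auto simp: ok_mem_def)

text \<open>The strict inequality of levels comes from \<open>W_pos\<close>. It makes the climb from
  an inode to its linking inodes well-founded.\<close>

lemma linked_cases:
  assumes "ok_heap H loc" "linked H j" "H j = Some (INode w)"
  obtains i c bm ar b where "H i = Some (INode (Some c))" "H c = Some (CNode bm ar)"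
    "wf_cnode bm ar" "cmap bm ar b = Some j" "loc j = child (loc i) b" "fst (loc i) < fst (loc j)"
proof -
  obtain i c bm ar b where i: "H i = Some (INode (Some c))" "H c = Some (CNode bm ar)"
    "cmap bm ar b = Some j"
    using assms(2) by (auto simp: linked_def entry_of_def)
  have "ok_entry H loc (child (loc c) b) j"
    using ok_heap_entry[OF assms(1)] i by blast
  then have "loc j = child (loc i) b"
    using assms(3) ok_heap_loc[OF assms(1) i(1,2)] by (auto simp: ok_entry_def)
  then show thesis
    using that i ok_heap_wf[OF assms(1) i(2)] W_pos by (auto simp: child_def)
qed

text \<open>Induction on the level: the inode linking \<open>j\<close> holds a cnode, so it is alive
  and by \<open>rooted\<close> again the root or linked. Since \<open>j\<close> is assumed to be
  linked rather than alive, the lemma also applies directly after a CAS that makes \<open>j\<close>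
  dead.\<close>

lemma stored_iff_reaches:
  assumes ok: "ok_mem m loc"
    and "rootp m = Some j \<or> linked (heap m) j" "heap m j = Some (INode w)" "k \<in> snd (loc j)"
  shows "stored m k v \<longleftrightarrow> reaches (heap m) k (fst (loc j)) j v"
  using assms(2-)
proof (induction "fst (loc j)" arbitrary: j w rule: less_induct)
  case less
  show ?case
  proof (cases "rootp m = Some j")
    case True
    then show ?thesis
      using ok_memD(3)[OF ok] by (auto simp: stored_def)
  next
    case False
    then have "linked (heap m) j"
      using less by blast
    then obtain i c bm ar b where i: "heap m i = Some (INode (Some c))"
      "heap m c = Some (CNode bm ar)" "wf_cnode bm ar" "cmap bm ar b = Some j"
      "loc j = child (loc i) b" "fst (loc i) < fst (loc j)"
      using linked_cases[OF ok_memD(1)[OF ok] _ less(3)] by metis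
    have "alive (heap m) i"
      using i by (auto simp: alive_def)
    then have "rootp m = Some i \<or> linked (heap m) i"
      using ok_memD(2)[OF ok] by (auto simp: rooted_def)
    then have "stored m k v \<longleftrightarrow> reaches (heap m) k (fst (loc i)) i v"
      using less(1)[OF i(6) _ i(1)] less(4) i(5) by (simp add: child_def)
    also have "\<dots> \<longleftrightarrow> reaches (heap m) k (fst (loc j)) j v"
      using reaches_cnode[OF i(1-3)] i(4,5) less(3,4) by (simp add: child_def holds_inode)
    finally show ?thesis .
  qed
qed

lemma alive_linked:
  "ok_mem m loc \<Longrightarrow> alive (heap m) j \<Longrightarrow> rootp m = Some j \<or> linked (heap m) j"
  by (auto simp: ok_mem_def rooted_def)

text \<open>The same climb. Its contrapositive justifies replacing a null root: then no inode at all
  is alive, and nothing can be lost.\<close>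

lemma alive_root:
  assumes ok: "ok_mem m loc" and "alive (heap m) j"
  shows "\<exists>r. rootp m = Some r \<and> alive (heap m) r"
  using assms(2)
proof (induction "fst (loc j)" arbitrary: j rule: less_induct)
  case less
  show ?case
  proof (cases "rootp m = Some j")
    case False
    then have "linked (heap m) j"
      using less alive_linked[OF ok] by blast
    moreover obtain w where "heap m j = Some (INode w)"
      using less by (auto simp: alive_def)
    ultimately obtain i c bm ar where "heap m i = Some (INode (Some c))"
      "heap m c = Some (CNode bm ar)" "fst (loc i) < fst (loc j)"
      using linked_cases[OF ok_memD(1)[OF ok]] by metis
    then show ?thesis
      using less by (auto simp: alive_def)
  qed (use less in blast)
qed

text \<open>A write to \<open>p\<close> is invisible below \<open>p\<close>: an inode that is an
  entry there has a level greater by \<open>W\<close>, and so have its descendants on the path or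
  more.\<close>

lemma holds_child_unaffected:
  assumes ok: "ok_heap H loc" and e: "ok_entry H loc (child (loc p) b) e"
    and p: "H p = Some (INode y0)"
    and same': "\<forall>a n. H a = Some n \<and> a \<noteq> p \<longrightarrow> H' a = Some n"
    and k: "k \<in> snd (loc p)" "chunk (fst (loc p)) k = b"
  shows "holds H' k (fst (loc p) + W) e v \<longleftrightarrow> holds H k (fst (loc p) + W) e v"
proof -
  have same: "H' a = Some n" if "H a = Some n" "a \<notin> {p}" for a n
    using same' that by simp
  consider k' v' where "H e = Some (SNode k' v' False)"
    | y where "H e = Some (INode y)" "loc e = child (loc p) b"
    using e by (auto simp: ok_entry_def)
  then show ?thesis
  proof cases
    case 1
    moreover have "e \<noteq> p"
      using 1 p by auto
    ultimately show ?thesis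
      using holds_snode[of H e] holds_snode[of H' e] same by (metis singletonD)
  next
    case 2
    then have "fst (loc e) = fst (loc p) + W" "k \<in> snd (loc e)"
      using k by (simp_all add: child_def)
    moreover from this have "e \<noteq> p"
      using W_pos by (metis add_eq_self_zero not_one_le_zero)
    ultimately have e: "fst (loc e) = fst (loc p) + W" "k \<in> snd (loc e)" "e \<noteq> p"
      by blast+
    have "reaches H' k (fst (loc p) + W) e v \<longleftrightarrow> reaches H k (fst (loc p) + W) e v"
      by (intro reaches_unaffected[OF ok, where X = "{p}" and w = y, OF same])
        (use 2(1) p e W_pos in simp_all)
    then show ?thesis
      using same[OF 2(1)] e(3) 2(1) by (simp add: holds_inode)
  qed
qed

text \<open>\<open>H\<close> is the heap after the allocations that precede the CAS, and \<open>J\<close> the set of new inodes that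
  only the CAS links to the tree.\<close>

lemma cas_update:
  assumes ok: "ok_mem m loc"
    and H: "ok_heap H loc'" "heap m \<subseteq>\<^sub>m H" "evolves (heap m) loc H loc'"
      "rooted H (set_option (rootp m) \<union> J)"
    and p: "heap m p = Some (INode (Some c))" "heap m c = Some (CNode bm ar)"
    and w: "ok_main H loc' (loc p) w"
    and keep: "\<forall>b j. cmap bm ar b = Some j \<and> alive (heap m) j \<longrightarrow> entry_of H w j"
    and J: "\<forall>j\<in>J. entry_of H w j"
  defines "m' \<equiv> m\<lparr>heap := H(p \<mapsto> INode w)\<rparr>"
  shows "ok_mem m' loc'"
    and "evolves (heap m) loc (heap m') loc'"
    and "k \<in> snd (loc p) \<Longrightarrow> stored m k v \<longleftrightarrow> reaches (heap m) k (fst (loc p)) p v"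
    and "k \<in> snd (loc p) \<Longrightarrow> stored m' k v \<longleftrightarrow> reaches (heap m') k (fst (loc p)) p v"
    and "k \<notin> snd (loc p) \<Longrightarrow> stored m' k v \<longleftrightarrow> stored m k v"
    and "ok_entry (heap m) loc (child (loc p) b) e \<Longrightarrow> k \<in> snd (loc p) \<Longrightarrow> chunk (fst (loc p)) k = b \<Longrightarrow>
      holds (heap m') k (fst (loc p) + W) e v \<longleftrightarrow> holds (heap m) k (fst (loc p) + W) e v"
proof -
  have le: "H a = Some n" if "heap m a = Some n" for a n
    using H(2) that by (metis domI map_le_def)
  have pH: "H p = Some (INode (Some c))" "H c = Some (CNode bm ar)" "loc' p = loc p"
    using le p evolvesD(1)[OF H(3)] by auto
  \<comment> \<open>Transfers \<open>keep\<close> across the allocations: an entry of the old cnode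
    that is alive afterwards was alive before, because the cnode it holds already existed.\<close>
  have keepH: "entry_of H w j" if cm: "cmap bm ar b = Some j" and al: "alive H j" for b j
  proof -
    have "ok_entry (heap m) loc (child (loc c) b) j"
      using ok_heap_entry[OF ok_memD(1)[OF ok] p(2) cm] .
    then obtain y where j: "heap m j = Some (INode y)"
      using al le by (fastforce simp: ok_entry_def alive_def)
    then obtain d bm' ar' where "y = Some d" "H d = Some (CNode bm' ar')"
      using al le[OF j] by (auto simp: alive_def)
    moreover from this have "heap m d = Some (CNode bm' ar')"
      using ok_heap_main[OF ok_memD(1)[OF ok] j] le by (fastforce simp: ok_main_def)
    ultimately show ?thesis
      using keep cm j by (auto simp: alive_def)
  qed
  have ev: "evolves H loc' (heap m') loc'"
    unfolding m'_def using set_main_evolves[OF pH(1,2)] by simp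
  show ev': "evolves (heap m) loc (heap m') loc'"
    by (rule evolves_trans[OF H(3) ev])
  show ok': "ok_mem m' loc'"
    unfolding ok_mem_def
  proof (intro conjI allI impI)
    show "ok_heap (heap m') loc'"
      unfolding m'_def using set_main_ok_heap[OF H(1) pH(1,2)] w pH(3) by simp
    show "rooted (heap m') (set_option (rootp m'))"
      unfolding m'_def using set_main_rooted[OF pH(1,2) H(4) keepH] J by simp
    fix r assume "rootp m' = Some r"
    then have "(\<exists>w. heap m r = Some (INode w)) \<and> loc r = (0, UNIV)"
      using ok_memD(3)[OF ok] by (simp add: m'_def)
    then show "\<exists>w. heap m' r = Some (INode w)" "loc' r = (0, UNIV)"
      using evolvesD(1,2)[OF ev'] by auto
  qed
  have lp: "rootp m = Some p \<or> linked (heap m) p"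
    using alive_linked[OF ok] p by (auto simp: alive_def)
  have same: "heap m' a = Some n" if "heap m a = Some n" "a \<notin> {p}" for a n
    using le[OF that(1)] that(2) by (simp add: m'_def)
  \<comment> \<open>Even if \<open>p\<close> is dead now, it has not been unlinked: the inode
    linking it has a smaller level, hence differs from \<open>p\<close> and was not written.\<close>
  have lp': "rootp m' = Some p \<or> linked (heap m') p"
  proof (cases "rootp m = Some p")
    case False
    then obtain i d bm' ar' b where i: "heap m i = Some (INode (Some d))"
      "heap m d = Some (CNode bm' ar')" "cmap bm' ar' b = Some p" "fst (loc i) < fst (loc p)"
      using lp linked_cases[OF ok_memD(1)[OF ok] _ p(1)] by metis
    moreover from this have "i \<noteq> p" "d \<noteq> p"
      using p(1) by auto
    ultimately have "heap m' i = Some (INode (Some d))" "heap m' d = Some (CNode bm' ar')"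
      using same by auto
    then show ?thesis
      using i(3) by (auto simp: linked_def entry_of_def)
  qed (simp add: m'_def)
  show "k \<in> snd (loc p) \<Longrightarrow> stored m k v \<longleftrightarrow> reaches (heap m) k (fst (loc p)) p v"
    using stored_iff_reaches[OF ok lp p(1)] .
  have "heap m' p = Some (INode w)"
    by (simp add: m'_def)
  from stored_iff_reaches[OF ok' lp' this] 
  show "k \<in> snd (loc p) \<Longrightarrow> stored m' k v \<longleftrightarrow> reaches (heap m') k (fst (loc p)) p v"
    using pH(3) by simp
  show "stored m' k v \<longleftrightarrow> stored m k v" if "k \<notin> snd (loc p)"
  proof (cases "rootp m")
    case (Some r)
    then obtain y where "heap m r = Some (INode y)" "loc r = (0, UNIV)"
      using ok_memD(3)[OF ok] by blast
    then have "reaches (heap m') k 0 r v \<longleftrightarrow> reaches (heap m) k 0 r v"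
      by (intro reaches_unaffected[OF ok_memD(1)[OF ok], where X = "{p}" and w = y, OF same])
        (use that p(1) in simp_all)
    then show ?thesis
      using Some by (simp add: stored_def m'_def)
  qed (simp add: stored_def m'_def)
  show "holds (heap m') k (fst (loc p) + W) e v \<longleftrightarrow> holds (heap m) k (fst (loc p) + W) e v"
    if "ok_entry (heap m) loc (child (loc p) b) e" "k \<in> snd (loc p)" "chunk (fst (loc p)) k = b"
    by (rule holds_child_unaffected[OF ok_memD(1)[OF ok] that(1) p(1) _ that(2,3)]) (use same in simp)
qed

lemma alloc_stored:
  assumes ok: "ok_mem m loc" and a: "alloc (heap m) n H a" "ok_node (heap m) loc x n" "\<And>w. n \<noteq> INode w"
  shows "ok_mem (m\<lparr>heap := H\<rparr>) (loc(a := x))"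
    and "stored (m\<lparr>heap := H\<rparr>) k v \<longleftrightarrow> stored m k v"
proof -
  have ev: "evolves (heap m) loc H (loc(a := x))"
    by (rule alloc_evolves[OF a(1)])
  show "ok_mem (m\<lparr>heap := H\<rparr>) (loc(a := x))"
    unfolding ok_mem_def
  proof (intro conjI allI impI)
    fix r assume "rootp (m\<lparr>heap := H\<rparr>) = Some r"
    then have "(\<exists>w. heap m r = Some (INode w)) \<and> loc r = (0, UNIV)"
      using ok_memD(3)[OF ok] by simp
    then show "\<exists>w. heap (m\<lparr>heap := H\<rparr>) r = Some (INode w)" "(loc(a := x)) r = (0, UNIV)"
      using evolvesD(1,2)[OF ev] by fastforce+
  qed (use alloc_ok_heap[OF ok_memD(1)[OF ok] a(1,2)]
      rooted_alloc_no_inode[OF ok_memD(1)[OF ok] a(1) ok_memD(2)[OF ok] a(3)] in simp_all)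
  show "stored (m\<lparr>heap := H\<rparr>) k v \<longleftrightarrow> stored m k v"
  proof (cases "rootp m")
    case (Some r)
    then obtain y where "heap m r = Some (INode y)" "loc r = (0, UNIV)"
      using ok_memD(3)[OF ok] by blast
    then show ?thesis
      using reaches_map_le[OF ok_memD(1)[OF ok] alloc_map_le[OF a(1)], of r y k v] Some
      by (simp add: stored_def)
  qed (simp add: stored_def)
qed

text \<open>In each round of \<open>deepen\<close> the inner inode is linked at once by the
  one-entry cnode around it. Only the outermost inode \<open>i\<close> still waits for a link, which
  explains \<open>insert i R\<close>. For keys in \<open>snd x\<close> the inner equivalence
  survives the later allocations by \<open>reaches_map_le\<close>.\<close>

lemma branch_ok:
  fixes H :: "('k, 'v) heap"
  assumes "branch H l k1 s1 k2 s2 H' i" "ok_heap H loc"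
    "H s1 = Some (SNode k1 v1 False)" "H s2 = Some (SNode k2 v2 False)" "k1 \<noteq> k2"
    "fst x = l" "k1 \<in> snd x" "k2 \<in> snd x"
  shows "\<exists>loc'. ok_heap H' loc' \<and> evolves H loc H' loc' \<and> H \<subseteq>\<^sub>m H' \<and>
    (\<forall>R. rooted H R \<longrightarrow> rooted H' (insert i R)) \<and> loc' i = x \<and> (\<exists>c. H' i = Some (INode (Some c))) \<and>
    (\<forall>k v. k \<in> snd x \<longrightarrow> (reaches H' k l i v \<longleftrightarrow> k = k1 \<and> v = v1 \<or> k = k2 \<and> v = v2))"
  using assms
proof (induction arbitrary: loc x rule: branch.induct)
  case (split l k1 k2 es s1 s2 H H1 c H2 i)
  have "bit_list es"
    using split(1,2) chunk_less by (auto simp: bit_list_def)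
  then obtain bm ar where es: "mk_cnode es = (CNode bm ar :: ('k, 'v) node)" "wf_cnode bm ar" "cmap bm ar = map_of es"
    by (rule mk_cnode)
  have cm: "cmap bm ar = [chunk l k1 \<mapsto> s1, chunk l k2 \<mapsto> s2]"
    using split(1,2) es(3) by auto
  have n1: "ok_node H loc x (mk_cnode es)"
    unfolding es(1) using es(2) cm split(6-11) by (auto simp: ok_entry_def child_def split: if_splits)
  note a1 = alloc_map_le[OF split(3)] alloc_evolves[OF split(3), of loc x]
    alloc_ok_heap[OF split(5,3) n1]
  have c: "H1 c = Some (CNode bm ar)"
    using alloc_at[OF split(3)] es by simp
  have n2: "ok_node H1 (loc(c := x)) x (INode (Some c))"
    using c by (simp add: ok_main_def)
  note a2 = alloc_map_le[OF split(4)] alloc_evolves[OF split(4), of "loc(c := x)" x]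
    alloc_ok_heap[OF a1(3) split(4) n2]
  have le: "H \<subseteq>\<^sub>m H2"
    using a1(1) a2(1) by (rule map_le_trans)
  have H2: "H2 a = Some n" if "H a = Some n" for a n
    using le that by (metis domI map_le_def)
  have H2c: "H2 c = Some (CNode bm ar)"
    using a2(1) c by (metis domI map_le_def)
  have "rooted H2 (insert i R)" if "rooted H R" for R
    using rooted_alloc[OF a1(3) split(4) rooted_alloc_no_inode[OF split(5,3) that]] es by simp
  moreover have "reaches H2 k l i v \<longleftrightarrow> k = k1 \<and> v = v1 \<or> k = k2 \<and> v = v2" for k v
    unfolding reaches_cnode[OF alloc_at[OF split(4)] H2c es(2)] cm
    using split(1) H2[OF split(6)] H2[OF split(7)]
    by (auto simp: holds_snode split: if_splits)
  moreover have "(loc(c := x, i := x)) i = x"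
    by simp
  moreover have "\<exists>c. H2 i = Some (INode (Some c))"
    using alloc_at[OF split(4)] by blast
  ultimately show ?case
    using a2(3) evolves_trans[OF a1(2) a2(2)] le
    by (intro exI[of _ "loc(c := x, i := x)"] conjI allI impI) (assumption | blast)+
next
  case (deepen l k1 k2 H s1 s2 H1 j H2 c H3 i)
  let ?b = "chunk l k1"
  have x': "fst (child x ?b) = l + W" "k1 \<in> snd (child x ?b)" "k2 \<in> snd (child x ?b)"
    using deepen by (auto simp: child_def)
  obtain loc1 y where IH: "ok_heap H1 loc1" "evolves H loc H1 loc1" "H \<subseteq>\<^sub>m H1"
    "\<And>R. rooted H R \<Longrightarrow> rooted H1 (insert j R)" "loc1 j = child x ?b" "H1 j = Some (INode (Some y))"
    "\<And>k v. k \<in> snd (child x ?b) \<Longrightarrow>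
       reaches H1 k (l + W) j v \<longleftrightarrow> k = k1 \<and> v = v1 \<or> k = k2 \<and> v = v2"
    using deepen.IH[OF deepen(6-9) x'] by blast
  have "bit_list [(?b, j)]"
    using chunk_less by (auto simp: bit_list_def)
  then obtain bm ar where es: "mk_cnode [(?b, j)] = (CNode bm ar :: ('k, 'v) node)" "wf_cnode bm ar"
    "cmap bm ar = map_of [(?b, j)]"
    by (rule mk_cnode)
  have n1: "ok_node H1 loc1 x (mk_cnode [(?b, j)])"
    using es IH(5,6) by (auto simp: ok_entry_def split: if_splits)
  note a1 = alloc_map_le[OF deepen(3)] alloc_evolves[OF deepen(3), of loc1 x]
    alloc_ok_heap[OF IH(1) deepen(3) n1]
  have c: "H2 c = Some (CNode bm ar)"
    using alloc_at[OF deepen(3)] es by simp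
  have n2: "ok_node H2 (loc1(c := x)) x (INode (Some c))"
    using c by (simp add: ok_main_def)
  note a2 = alloc_map_le[OF deepen(4)] alloc_evolves[OF deepen(4), of "loc1(c := x)" x]
    alloc_ok_heap[OF a1(3) deepen(4) n2]
  have le: "H1 \<subseteq>\<^sub>m H3"
    using a1(1) a2(1) by (rule map_le_trans)
  have H3c: "H3 c = Some (CNode bm ar)"
    using a2(1) c by (metis domI map_le_def)
  have H3j: "H3 j = Some (INode (Some y))"
    using le IH(6) by (metis domI map_le_def)
  have lj: "linked H3 j"
    unfolding linked_def entry_of_def using alloc_at[OF deepen(4)] H3c es(3) by fastforce
  have "rooted H3 (insert i R)" if "rooted H R" for R
  proof -
    have "rooted H3 (insert i (insert j R))"
      using rooted_alloc[OF a1(3) deepen(4) rooted_alloc_no_inode[OF IH(1) deepen(3) IH(4)[OF that]]] es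
      by simp
    then show ?thesis
      using lj by (auto simp: rooted_def)
  qed
  moreover have "reaches H3 k l i v \<longleftrightarrow> k = k1 \<and> v = v1 \<or> k = k2 \<and> v = v2" if "k \<in> snd x" for k v
  proof (cases "chunk l k = ?b")
    case True
    then have k: "k \<in> snd (child x ?b)"
      using that deepen by (simp add: child_def)
    have "reaches H3 k l i v \<longleftrightarrow> holds H3 k (l + W) j v"
      unfolding reaches_cnode[OF alloc_at[OF deepen(4)] H3c es(2)] es(3) using True by simp
    also have "\<dots> \<longleftrightarrow> reaches H1 k (l + W) j v"
      using reaches_map_le[OF IH(1) le IH(6), of k v] k IH(5) x'(1) H3j by (simp add: holds_inode)
    finally show ?thesis
      using IH(7)[OF k] by blast
  next
    case False
    then show ?thesis
      unfolding reaches_cnode[OF alloc_at[OF deepen(4)] H3c es(2)] es(3)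
      using deepen(1) by auto
  qed
  moreover have "(loc1(c := x, i := x)) i = x"
    by simp
  moreover have "\<exists>c. H3 i = Some (INode (Some c))"
    using alloc_at[OF deepen(4)] by blast
  ultimately show ?case
    using a2(3) evolves_trans[OF IH(2) evolves_trans[OF a1(2) a2(2)]] map_le_trans[OF IH(3) le]
    by (intro exI[of _ "loc1(c := x, i := x)"] conjI allI impI) (assumption | blast)+
qed


section \<open>Insertion and removal as updates of one entry\<close>

lemma ball_emptyI: "\<forall>x\<in>{}. P x"
  by simp

text \<open>Common core of all insertions and of removals from a cnode with several entries: exactly
  one entry changes, to \<open>eo\<close>, with \<open>None\<close> for a removal. Keys with another
  chunk keep their entry, and the subtree below it is unaffected. By \<open>old\<close> no live
  inode is cut off; \<open>J\<close> contains the new inode, if any, that becomes the entry.\<close>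

lemma entry_cas:
  fixes m :: "('k, 'v) mem"
  assumes ok: "ok_mem m loc"
    and i: "heap m i = Some (INode (Some c))" "heap m c = Some (CNode bm ar)"
      "fst (loc i) = l"
    and H1: "ok_heap H1 loc1" "heap m \<subseteq>\<^sub>m H1" "evolves (heap m) loc H1 loc1"
      "rooted H1 (set_option (rootp m) \<union> J)"
    and c': "alloc H1 (CNode bm' ar') H c'" "wf_cnode bm' ar'"
      "cmap bm' ar' = (cmap bm ar)(chunk l k := eo)"
    and eo: "\<forall>e. eo = Some e \<longrightarrow> ok_entry H1 loc1 (child (loc i) (chunk l k)) e"
      "\<forall>j\<in>J. eo = Some j"
    and old: "\<forall>j. cmap bm ar (chunk l k) = Some j \<longrightarrow> \<not> alive (heap m) j"
  defines "m' \<equiv> m\<lparr>heap := H(i \<mapsto> INode (Some c'))\<rparr>"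
  obtains loc' where "ok_mem m' loc'" "evolves (heap m) loc (heap m') loc'"
    "\<And>k' v'. stored m' k' v' \<longleftrightarrow>
       (if k' \<in> snd (loc i) \<and> chunk l k' = chunk l k then \<exists>e. eo = Some e \<and> holds H1 k' (l + W) e v'
        else stored m k' v')"
proof -
  let ?loc = "loc1(c' := loc i)"
  have le1: "H1 a = Some n" if "heap m a = Some n" for a n
    using H1(2) that by (metis domI map_le_def)
  have "ok_node H1 loc1 (loc i) (CNode bm' ar')"
  proof -
    have "ok_entry H1 loc1 (child (loc i) b) e" if "cmap bm' ar' b = Some e" for b e
    proof (cases "b = chunk l k")
      case False
      then have "ok_entry (heap m) loc (child (loc c) b) e"
        using that c'(3) ok_heap_entry[OF ok_memD(1)[OF ok] i(2)] by simp
      then show ?thesis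
        using ok_entry_evolves[OF H1(3)] ok_heap_loc[OF ok_memD(1)[OF ok] i(1,2)] by simp
    qed (use that c'(3) eo in simp)
    then show ?thesis
      using c'(2) by simp
  qed
  note okH = alloc_ok_heap[OF H1(1) c'(1) this]
  have le2: "heap m \<subseteq>\<^sub>m H"
    using H1(2) alloc_map_le[OF c'(1)] by (rule map_le_trans)
  have ev: "evolves (heap m) loc H ?loc"
    by (rule evolves_trans[OF H1(3) alloc_evolves[OF c'(1)]])
  have ro: "rooted H (set_option (rootp m) \<union> J)"
    by (rule rooted_alloc_no_inode[OF H1(1) c'(1) H1(4)]) simp
  have Hc': "H c' = Some (CNode bm' ar')"
    by (rule alloc_at[OF c'(1)])
  have "i \<noteq> c'"
    using c'(1) le1[OF i(1)] by (auto simp: alloc_def)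
  have w: "ok_main H ?loc (loc i) (Some c')"
    using Hc' by (simp add: ok_main_def)
  have keep: "\<forall>b j. cmap bm ar b = Some j \<and> alive (heap m) j \<longrightarrow> entry_of H (Some c') j"
    using old Hc' c'(3) unfolding entry_of_def by (metis fun_upd_other)
  have J: "\<forall>j\<in>J. entry_of H (Some c') j"
    using eo(2) Hc' c'(3) unfolding entry_of_def by (metis fun_upd_same)
  note upd = cas_update[OF ok okH le2 ev ro i(1,2) w keep J, folded m'_def]
  have stored: "stored m' k' v' \<longleftrightarrow>
       (if k' \<in> snd (loc i) \<and> chunk l k' = chunk l k then \<exists>e. eo = Some e \<and> holds H1 k' (l + W) e v'
        else stored m k' v')" for k' v'
  proof (cases "k' \<in> snd (loc i)")
    case True
    have m': "heap m' i = Some (INode (Some c'))" "heap m' c' = Some (CNode bm' ar')"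
      using Hc' \<open>i \<noteq> c'\<close> by (simp_all add: m'_def)
    have s': "stored m' k' v' \<longleftrightarrow>
        (\<exists>e. cmap bm' ar' (chunk l k') = Some e \<and> holds (heap m') k' (l + W) e v')"
      using upd(4)[OF True] reaches_cnode[OF m' c'(2)] i(3) by simp
    have s: "stored m k' v' \<longleftrightarrow>
        (\<exists>e. cmap bm ar (chunk l k') = Some e \<and> holds (heap m) k' (l + W) e v')"
      using upd(3)[OF True] reaches_cnode[OF i(1,2) ok_heap_wf[OF ok_memD(1)[OF ok] i(2)]] i(3)
      by simp
    show ?thesis
    proof (cases "chunk l k' = chunk l k")
      case ch: True
      have "holds (heap m') k' (l + W) e v' \<longleftrightarrow> holds H1 k' (l + W) e v'" if "eo = Some e" for e
      proof -
        have li: "loc1 i = loc i"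
          by (rule evolvesD(1)[OF H1(3) i(1)])
        have same: "\<forall>a n. H1 a = Some n \<and> a \<noteq> i \<longrightarrow> heap m' a = Some n"
          using c'(1) by (auto simp: m'_def alloc_def)
        show ?thesis
          using holds_child_unaffected[of H1 loc1 i "chunk l k" e "Some c" "heap m'" k' v',
              OF H1(1) _ le1[OF i(1)] same] eo(1) that li i(3) True ch by simp
      qed
      then show ?thesis
        using s' c'(3) True ch by auto
    next
      case False
      have "holds (heap m') k' (l + W) e v' \<longleftrightarrow> holds (heap m) k' (l + W) e v'"
        if "cmap bm ar (chunk l k') = Some e" for e
        using upd(6)[of "chunk l k'" e k'] that True i(3)
          ok_heap_entry[OF ok_memD(1)[OF ok] i(2) that] ok_heap_loc[OF ok_memD(1)[OF ok] i(1,2)]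
        by simp
      then show ?thesis
        using s s' c'(3) False by auto
    qed
  qed (use upd(5) in simp)
  show thesis
    by (rule that[OF upd(1,2) stored])
qed

lemma stored_fun: "stored m k v \<Longrightarrow> stored m k v' \<Longrightarrow> v = v'"
  by (auto simp: stored_def dest: reaches_fun)

text \<open>What a thread remembers about an inode that it visits. It stays true after the inode has
  been unlinked.\<close>

definition located :: "('k, 'v) heap \<Rightarrow> 'k loc \<Rightarrow> ref \<Rightarrow> nat \<Rightarrow> 'k \<Rightarrow> bool" where
  "located H loc i l k \<longleftrightarrow> (\<exists>x. H i = Some (INode x)) \<and> fst (loc i) = l \<and> k \<in> snd (loc i)"

text \<open>Finding a cnode in \<open>i\<close> proves that \<open>i\<close> is alive, hence in the
  tree at this very moment, so a single entry determines the abstract state at \<open>k\<close>.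
  This justifies the linearization points at reads and at CASes.\<close>

lemma stored_located:
  assumes ok: "ok_mem m loc" and a: "located (heap m) loc i l k"
    and i: "heap m i = Some (INode (Some c))" "heap m c = Some (CNode bm ar)"
  shows "stored m k v \<longleftrightarrow> (\<exists>e. entry bm ar l k = Some e \<and> holds (heap m) k (l + W) e v)"
proof -
  have "alive (heap m) i"
    using i by (auto simp: alive_def)
  then have "stored m k v \<longleftrightarrow> reaches (heap m) k (fst (loc i)) i v"
    using a stored_iff_reaches[OF ok alive_linked[OF ok] i(1)] by (simp add: located_def)
  then show ?thesis
    using a reaches_cnode[OF i] ok_heap_wf[OF ok_memD(1)[OF ok] i(2)]
    by (simp add: located_def entry_eq_cmap)
qed

text \<open>\<open>entry_cas\<close> gives the new state on all keys at this location that share the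
  chunk of \<open>k\<close>. It remains to see that the old entry stored nothing else for them: it
  was unset, or an snode whose key is \<open>k\<close>, or one whose key \<open>k0\<close> lives on
  in the new branch.\<close>

lemma insert_cas_ok:
  fixes m :: "('k, 'v) mem"
  assumes ok: "ok_mem m loc" and a: "located (heap m) loc i l k"
    and i: "heap m i = Some (INode (Some c))" and cp: "insert_copy (heap m) k v l c H c'"
  defines "m' \<equiv> m\<lparr>heap := H(i \<mapsto> INode (Some c'))\<rparr>"
  obtains loc' where "ok_mem m' loc'" "evolves (heap m) loc (heap m') loc'"
    "\<And>k' v'. stored m' k' v' \<longleftrightarrow> (if k' = k then v' = v else stored m k' v')"
proof -
  note okh = ok_memD(1)[OF ok]
  have l: "fst (loc i) = l" "k \<in> snd (loc i)"
    using a by (auto simp: located_def)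
  show thesis
    using cp
  proof cases
    case (add bm ar H1 s)
    note wf = ok_heap_wf[OF okh add(1)]
    obtain bm' ar' where c': "inserted bm ar l k s = (CNode bm' ar' :: ('k, 'v) node)"
      "wf_cnode bm' ar'" "cmap bm' ar' = (cmap bm ar)(chunk l k := Some s)"
      using inserted_cnode[OF wf add(2)] by blast
    \<comment> \<open>The location of the snode is a dummy: \<open>ok_node\<close> holds for snodes
      at any location.\<close>
    have H1: "ok_heap H1 (loc(s := loc i))" "heap m \<subseteq>\<^sub>m H1" "evolves (heap m) loc H1 (loc(s := loc i))"
      "rooted H1 (set_option (rootp m) \<union> {})"
      using alloc_ok_heap[OF okh add(3)] alloc_map_le[OF add(3)] alloc_evolves[OF add(3)]
        rooted_alloc_no_inode[OF okh add(3) ok_memD(2)[OF ok]] by simp_all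
    have s: "H1 s = Some (SNode k v False)"
      by (rule alloc_at[OF add(3)])
    have eo: "\<forall>e. Some s = Some e \<longrightarrow> ok_entry H1 (loc(s := loc i)) (child (loc i) (chunk l k)) e"
      using s l by (simp add: ok_entry_def child_def)
    have old: "\<forall>j. cmap bm ar (chunk l k) = Some j \<longrightarrow> \<not> alive (heap m) j"
      using add(2) by (simp add: entry_eq_cmap[OF wf])
    obtain loc' where loc': "ok_mem m' loc'" "evolves (heap m) loc (heap m') loc'"
      "\<And>k' v'. stored m' k' v' \<longleftrightarrow>
       (if k' \<in> snd (loc i) \<and> chunk l k' = chunk l k then \<exists>e. Some s = Some e \<and> holds H1 k' (l + W) e v'
        else stored m k' v')"
      by (rule entry_cas[OF ok i add(1) l(1) H1 add(4)[unfolded c'(1)] c'(2,3) eo ball_emptyI old, folded m'_def])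
        (rule that)
    have "stored m' k' v' \<longleftrightarrow> (if k' = k then v' = v else stored m k' v')" for k' v'
    proof -
      have "\<not> stored m k' v'" if "k' \<in> snd (loc i)" "chunk l k' = chunk l k"
        using stored_located[OF ok _ i add(1), of l k'] that add(2) a
        by (simp add: located_def entry_eq_cmap[OF wf])
      then show ?thesis
        unfolding loc'(3) using holds_snode[of H1 s k v False] s l by auto
    qed
    then show ?thesis
      by (rule that[OF loc'(1,2)])
  next
    case (overwrite bm ar e v0 H1 s)
    note wf = ok_heap_wf[OF okh overwrite(1)]
    obtain bm' ar' where c': "replaced bm ar l k s = (CNode bm' ar' :: ('k, 'v) node)"
      "wf_cnode bm' ar'" "cmap bm' ar' = (cmap bm ar)(chunk l k := Some s)"
      using replaced_cnode[OF wf overwrite(2)] by blast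
    have H1: "ok_heap H1 (loc(s := loc i))" "heap m \<subseteq>\<^sub>m H1" "evolves (heap m) loc H1 (loc(s := loc i))"
      "rooted H1 (set_option (rootp m) \<union> {})"
      using alloc_ok_heap[OF okh overwrite(4)] alloc_map_le[OF overwrite(4)]
        alloc_evolves[OF overwrite(4)] rooted_alloc_no_inode[OF okh overwrite(4) ok_memD(2)[OF ok]]
      by simp_all
    have s: "H1 s = Some (SNode k v False)"
      by (rule alloc_at[OF overwrite(4)])
    have eo: "\<forall>e. Some s = Some e \<longrightarrow> ok_entry H1 (loc(s := loc i)) (child (loc i) (chunk l k)) e"
      using s l by (simp add: ok_entry_def child_def)
    have old: "\<forall>j. cmap bm ar (chunk l k) = Some j \<longrightarrow> \<not> alive (heap m) j"
      using overwrite(2,3) by (auto simp: entry_eq_cmap[OF wf] alive_def)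
    obtain loc' where loc': "ok_mem m' loc'" "evolves (heap m) loc (heap m') loc'"
      "\<And>k' v'. stored m' k' v' \<longleftrightarrow>
       (if k' \<in> snd (loc i) \<and> chunk l k' = chunk l k then \<exists>e. Some s = Some e \<and> holds H1 k' (l + W) e v'
        else stored m k' v')"
      by (rule entry_cas[OF ok i overwrite(1) l(1) H1 overwrite(5)[unfolded c'(1)] c'(2,3) eo ball_emptyI old,
            folded m'_def]) (rule that)
    have "stored m' k' v' \<longleftrightarrow> (if k' = k then v' = v else stored m k' v')" for k' v'
    proof -
      have "\<not> stored m k' v'" if "k' \<in> snd (loc i)" "chunk l k' = chunk l k" "k' \<noteq> k"
        using stored_located[OF ok _ i overwrite(1), of l k'] that overwrite(2,3) a
          holds_snode[of "heap m" e k v0 False]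
        by (simp add: located_def entry_eq_cmap[OF wf])
      then show ?thesis
        unfolding loc'(3) using holds_snode[of H1 s k v False] s l by auto
    qed
    then show ?thesis
      by (rule that[OF loc'(1,2)])
  next
    case (extend bm ar e k0 v0 H1 s H2 j)
    note wf = ok_heap_wf[OF okh extend(1)]
    obtain bm' ar' where c': "replaced bm ar l k j = (CNode bm' ar' :: ('k, 'v) node)"
      "wf_cnode bm' ar'" "cmap bm' ar' = (cmap bm ar)(chunk l k := Some j)"
      using replaced_cnode[OF wf extend(2)] by blast
    have H1: "ok_heap H1 (loc(s := loc i))" "heap m \<subseteq>\<^sub>m H1" "evolves (heap m) loc H1 (loc(s := loc i))"
      "rooted H1 (set_option (rootp m))"
      using alloc_ok_heap[OF okh extend(5)] alloc_map_le[OF extend(5)]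
        alloc_evolves[OF extend(5)] rooted_alloc_no_inode[OF okh extend(5) ok_memD(2)[OF ok]]
      by simp_all
    have s: "H1 s = Some (SNode k v False)"
      by (rule alloc_at[OF extend(5)])
    have e: "H1 e = Some (SNode k0 v0 False)"
      using H1(2) extend(3) by (metis domI map_le_def)
    let ?x = "child (loc i) (chunk l k)"
    \<comment> \<open>The old snode was a legal entry at this bit, so its key \<open>k0\<close>
      belongs to the location of the new inode, as does \<open>k\<close>.\<close>
    have "ok_entry (heap m) loc ?x e"
      using ok_heap_entry[OF okh extend(1)] extend(2) ok_heap_loc[OF okh i extend(1)]
      by (simp add: entry_eq_cmap[OF wf])
    then have x: "k0 \<in> snd ?x" "k \<in> snd ?x" "fst ?x = l + W"
      using extend(3) l by (auto simp: ok_entry_def child_def)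
    obtain loc2 y where H2: "ok_heap H2 loc2" "evolves H1 (loc(s := loc i)) H2 loc2" "H1 \<subseteq>\<^sub>m H2"
      "\<And>R. rooted H1 R \<Longrightarrow> rooted H2 (insert j R)" "loc2 j = ?x" "H2 j = Some (INode (Some y))"
      "\<And>k' v'. k' \<in> snd ?x \<Longrightarrow>
        reaches H2 k' (l + W) j v' \<longleftrightarrow> k' = k0 \<and> v' = v0 \<or> k' = k \<and> v' = v"
      using branch_ok[OF extend(6) H1(1) e s extend(4) x(3,1,2)] by blast
    have old: "\<forall>j. cmap bm ar (chunk l k) = Some j \<longrightarrow> \<not> alive (heap m) j"
      using extend(2,3) by (auto simp: entry_eq_cmap[OF wf] alive_def)
    have ro: "rooted H2 (set_option (rootp m) \<union> {j})"
      using H2(4)[OF H1(4)] by simp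
    have eo: "\<forall>e. Some j = Some e \<longrightarrow> ok_entry H2 loc2 (child (loc i) (chunk l k)) e"
      using H2(5,6) by (simp add: ok_entry_def)
    obtain loc' where loc': "ok_mem m' loc'" "evolves (heap m) loc (heap m') loc'"
      "\<And>k' v'. stored m' k' v' \<longleftrightarrow>
       (if k' \<in> snd (loc i) \<and> chunk l k' = chunk l k then \<exists>e. Some j = Some e \<and> holds H2 k' (l + W) e v'
        else stored m k' v')"
      by (rule entry_cas[OF ok i extend(1) l(1) H2(1) map_le_trans[OF H1(2) H2(3)]
          evolves_trans[OF H1(3) H2(2)] ro extend(7)[unfolded c'(1)] c'(2,3) eo _ old, folded m'_def])
        (simp, rule that)
    have "stored m' k' v' \<longleftrightarrow> (if k' = k then v' = v else stored m k' v')" for k' v'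
    proof -
      have "stored m k' v' \<longleftrightarrow> k' = k0 \<and> v' = v0" if "k' \<in> snd (loc i)" "chunk l k' = chunk l k"
        using stored_located[OF ok _ i extend(1), of l k'] that extend(2,3) a
          holds_snode[of "heap m" e k0 v0 False]
        by (simp add: located_def entry_eq_cmap[OF wf])
      moreover have "holds H2 k' (l + W) j v' \<longleftrightarrow> k' = k0 \<and> v' = v0 \<or> k' = k \<and> v' = v"
        if "k' \<in> snd (loc i)" "chunk l k' = chunk l k"
        using H2(7)[of k' v'] that l(1) H2(6) by (simp add: child_def holds_inode)
      ultimately show ?thesis
        unfolding loc'(3) using l extend(4) by auto
    qed
    then show ?thesis
      by (rule that[OF loc'(1,2)])
  qed
qed

lemma remove_cas_ok:
  fixes m :: "('k, 'v) mem"
  assumes ok: "ok_mem m loc" and a: "located (heap m) loc i l k"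
    and i: "heap m i = Some (INode (Some c))" "heap m c = Some (CNode bm ar)"
    and e: "entry bm ar l k = Some s" "heap m s = Some (SNode k v False)"
    and cp: "remove_copy (heap m) k l c H w"
  defines "m' \<equiv> m\<lparr>heap := H(i \<mapsto> INode w)\<rparr>"
  obtains loc' where "ok_mem m' loc'" "evolves (heap m) loc (heap m') loc'" "stored m k v"
    "\<And>k' v'. stored m' k' v' \<longleftrightarrow> k' \<noteq> k \<and> stored m k' v'"
proof -
  note okh = ok_memD(1)[OF ok]
  note wf = ok_heap_wf[OF okh i(2)]
  have l: "fst (loc i) = l" "k \<in> snd (loc i)"
    using a by (auto simp: located_def)
  have st: "stored m k v"
    using stored_located[OF ok a i] e holds_snode[of "heap m" s k v False] by simp
  have old: "\<forall>j. cmap bm ar (chunk l k) = Some j \<longrightarrow> \<not> alive (heap m) j"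
    using e by (auto simp: entry_eq_cmap[OF wf] alive_def)
  \<comment> \<open>The entry is an snode with key \<open>k\<close>, so no other key sharing its
    chunk is stored, and dropping the entry loses \<open>k\<close> only.\<close>
  have not: "\<not> stored m k' v'" if "k' \<in> snd (loc i)" "chunk l k' = chunk l k" "k' \<noteq> k" for k' v'
    using stored_located[OF ok _ i, of l k'] that e a holds_snode[of "heap m" s k v False]
    by (simp add: located_def entry_eq_cmap[OF wf])
  show thesis
    using cp
  proof cases
    case (last bm1 ar1)
    then have "length ar = 1"
      using i(2) by simp
    then obtain b e0 where b: "cmap bm ar = [b \<mapsto> e0]"
      using length_one_entries[OF wf] by blast
    \<comment> \<open>The only entry is the one to be removed. Keys with another chunk have no entry
      at all, so null represents the right state.\<close>
    then have b': "b = chunk l k"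
      using e(1) by (auto simp: entry_eq_cmap[OF wf] split: if_splits)
    have keep: "\<forall>b j. cmap bm ar b = Some j \<and> alive (heap m) j \<longrightarrow> entry_of (heap m) None j"
      using old b b' by auto
    have ro: "rooted (heap m) (set_option (rootp m) \<union> {})"
      using ok_memD(2)[OF ok] by simp
    have w: "ok_main (heap m) loc (loc i) None"
      by (simp add: ok_main_def)
    note upd = cas_update[OF ok okh map_le_refl evolves_refl ro i w keep, OF ball_emptyI]
    have m': "m' = m\<lparr>heap := (heap m)(i \<mapsto> INode None)\<rparr>"
      using last by (simp add: m'_def)
    have "stored m' k' v' \<longleftrightarrow> k' \<noteq> k \<and> stored m k' v'" for k' v'
    proof (cases "k' \<in> snd (loc i)")
      case True
      have "\<not> stored m' k' v'"
        using upd(4)[OF True] not_reaches_null[of "heap m'" i] by (simp add: m')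
      moreover have "\<not> stored m k' v'" if "k' \<noteq> k"
      proof (cases "chunk l k' = chunk l k")
        case False
        then show ?thesis
          using stored_located[OF ok _ i, of l k'] True a b b' by (simp add: located_def entry_eq_cmap[OF wf])
      qed (use not True that in blast)
      ultimately show ?thesis
        by blast
    next
      case False
      then show ?thesis
        using upd(5)[OF False] l by (auto simp: m')
    qed
    then show thesis
      using that upd(1,2) st by (simp add: m')
  next
    case (drop bm1 ar1 c')
    then have al: "alloc (heap m) (removed bm ar l k) H c'"
      using i(2) by simp
    obtain bm' ar' where c': "removed bm ar l k = (CNode bm' ar' :: ('k, 'v) node)"
      "wf_cnode bm' ar'" "cmap bm' ar' = (cmap bm ar)(chunk l k := None)"
      using removed_cnode[OF wf e(1)] by blast
    have ro: "rooted (heap m) (set_option (rootp m) \<union> {})"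
      using ok_memD(2)[OF ok] by simp
    obtain loc' where loc': "ok_mem m' loc'" "evolves (heap m) loc (heap m') loc'"
      "\<And>k' v'. stored m' k' v' \<longleftrightarrow>
       (if k' \<in> snd (loc i) \<and> chunk l k' = chunk l k then \<exists>e. None = Some e \<and> holds (heap m) k' (l + W) e v'
        else stored m k' v')"
      by (rule entry_cas[OF ok i l(1) okh map_le_refl evolves_refl ro al[unfolded c'(1)] c'(2,3) _ ball_emptyI old,
            folded drop(1), folded m'_def]) (simp, rule that)
    have "stored m' k' v' \<longleftrightarrow> k' \<noteq> k \<and> stored m k' v'" for k' v'
      unfolding loc'(3) using not l by auto
    then show thesis
      by (rule that[OF loc'(1,2) st])
  qed
qed


subsection \<open>Compression\<close>

text \<open>A scan of a cnode is not atomic: \<open>o2\<close> is a possible outcome for the entry \<open>o1\<close>, and stays one, because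
  entries are only dropped or copied when they are dead. Nothing is claimed about entries that
  became dead after they were scanned.\<close>

definition scan_outcome :: "('k, 'v) heap \<Rightarrow> ref option \<Rightarrow> ref option \<Rightarrow> bool" where
  "scan_outcome H o1 o2 \<longleftrightarrow> o1 = o2 \<or> (\<exists>j. o1 = Some j \<and> dead H j None \<and> o2 = None) \<or>
     (\<exists>j s k v s'. o1 = Some j \<and> dead H j (Some s) \<and> H s = Some (SNode k v True) \<and>
        o2 = Some s' \<and> H s' = Some (SNode k v False))"

text \<open>The three shapes of results of \<open>toCompressed\<close> and
  \<open>toWeakTombed\<close>: null, a cnode, a tombed snode. Only immutable nodes and dead inodes
  are mentioned, so the property survives any delay before the CAS.\<close>

definition replacement :: "('k, 'v) heap \<Rightarrow> 'k loc \<Rightarrow> ref \<Rightarrow> ref option \<Rightarrow> bool" where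
  "replacement H loc c w \<longleftrightarrow> (\<exists>bm ar. H c = Some (CNode bm ar) \<and>
     ((w = None \<and> (\<forall>b j. cmap bm ar b = Some j \<longrightarrow> dead H j None)) \<or>
      (\<exists>c' bm' ar'. w = Some c' \<and> H c' = Some (CNode bm' ar') \<and> loc c' = loc c \<and>
         (\<forall>b. scan_outcome H (cmap bm ar b) (cmap bm' ar' b))) \<or>
      (\<exists>s k v b e. w = Some s \<and> H s = Some (SNode k v True) \<and> cmap bm ar b = Some e \<and>
         singleton H e k v \<and> (\<forall>b' j. b' \<noteq> b \<longrightarrow> cmap bm ar b' = Some j \<longrightarrow> dead H j None))))"

lemma dead_not_alive: "dead H j x \<Longrightarrow> \<not> alive H j"
  by (auto simp: dead_def alive_def)

lemma dead_not_holds: "dead H j None \<Longrightarrow> \<not> holds H k l j v"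
  by (auto simp: dead_def holds_inode not_reaches_null)

lemma holds_singleton: "singleton H e k v \<Longrightarrow> holds H k' l e v' \<longleftrightarrow> k' = k \<and> v' = v"
  by (auto simp: singleton_def holds_inode holds_snode reaches_tomb)

lemma dead_singleton:
  "dead H j (Some s) \<Longrightarrow> H s = Some (SNode k v True) \<Longrightarrow> singleton H j k v"
  by (auto simp: dead_def singleton_def)

lemma scan_outcome_holds:
  assumes "scan_outcome H o1 o2"
  shows "(\<exists>e. o1 = Some e \<and> holds H k l e v) \<longleftrightarrow> (\<exists>e. o2 = Some e \<and> holds H k l e v)"
  using assms unfolding scan_outcome_def
proof (elim disjE exE conjE)
  fix j s k' v' s'
  assume *: "o1 = Some j" "dead H j (Some s)" "H s = Some (SNode k' v' True)" "o2 = Some s'"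
    "H s' = Some (SNode k' v' False)"
  have "holds H k l j v \<longleftrightarrow> k = k' \<and> v = v'"
    by (rule holds_singleton[OF dead_singleton[OF *(2,3)]])
  moreover have "holds H k l s' v \<longleftrightarrow> k = k' \<and> v = v'"
    using *(5) by (rule holds_snode)
  ultimately show ?thesis
    using * by simp
qed (auto simp: dead_not_holds)

text \<open>If the CAS succeeds, \<open>p\<close> holds \<open>c\<close> now and is alive, so the
  entries of \<open>c\<close> give the state at all keys of \<open>p\<close>. In each of the three
  shapes \<open>w\<close> holds the same keys and values, because what was dropped or copied is
  dead. The lemma serves \<open>clean\<close>, \<open>tombCompress\<close> and
  \<open>contractParent\<close> alike.\<close>

lemma compress_cas:
  fixes m :: "('k, 'v) mem"
  assumes ok: "ok_mem m loc" and p: "heap m p = Some (INode (Some c))"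
    and r: "replacement (heap m) loc c w"
  defines "m' \<equiv> m\<lparr>heap := (heap m)(p \<mapsto> INode w)\<rparr>"
  shows "ok_mem m' loc" "evolves (heap m) loc (heap m') loc" "stored m' k v \<longleftrightarrow> stored m k v"
proof -
  let ?H = "heap m"
  note okh = ok_memD(1)[OF ok]
  obtain bm ar where c: "?H c = Some (CNode bm ar)" and r':
    "(w = None \<and> (\<forall>b j. cmap bm ar b = Some j \<longrightarrow> dead ?H j None)) \<or>
      (\<exists>c' bm' ar'. w = Some c' \<and> ?H c' = Some (CNode bm' ar') \<and> loc c' = loc c \<and>
         (\<forall>b. scan_outcome ?H (cmap bm ar b) (cmap bm' ar' b))) \<or>
      (\<exists>s k v b e. w = Some s \<and> ?H s = Some (SNode k v True) \<and> cmap bm ar b = Some e \<and>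
         singleton ?H e k v \<and> (\<forall>b' j. b' \<noteq> b \<longrightarrow> cmap bm ar b' = Some j \<longrightarrow> dead ?H j None))"
    using r unfolding replacement_def by blast
  note wf = ok_heap_wf[OF okh c]
  have lc: "loc c = loc p"
    by (rule ok_heap_loc[OF okh p c])
  \<comment> \<open>The key of a singleton belongs to the bit of its entry. This makes the tombed
    snode a legal content of \<open>p\<close>, and it shows below that the key was found under bit
    \<open>b\<close> before the CAS.\<close>
  have tomb: "k \<in> snd (child (loc p) b)"
    if b: "cmap bm ar b = Some e" and e: "singleton ?H e k v" for b e k v
  proof -
    have oe: "ok_entry ?H loc (child (loc p) b) e"
      using ok_heap_entry[OF okh c b] lc by simp
    from e consider t where "?H e = Some (SNode k v t)"
      | s where "?H e = Some (INode (Some s))" "?H s = Some (SNode k v True)"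
      by (auto simp: singleton_def)
    then show ?thesis
    proof cases
      case 1
      then show ?thesis
        using oe by (auto simp: ok_entry_def)
    next
      case 2
      then show ?thesis
        using oe ok_heap_main[OF okh 2(1)] by (auto simp: ok_entry_def ok_main_def)
    qed
  qed
  have w: "ok_main ?H loc (loc p) w"
    using r' lc tomb by (fastforce simp: ok_main_def child_def)
  \<comment> \<open>A live inode is neither dead nor a singleton, so it can only occur as an entry
    that was kept.\<close>
  have keep: "entry_of ?H w j" if b: "cmap bm ar b = Some j" and al: "alive ?H j" for b j
    using r'
  proof (elim disjE exE conjE)
    fix c' bm' ar'
    assume *: "w = Some c'" "?H c' = Some (CNode bm' ar')" "\<forall>b. scan_outcome ?H (cmap bm ar b) (cmap bm' ar' b)"
    have "cmap bm' ar' b = Some j"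
      using *(3)[rule_format, of b] b al dead_not_alive[of ?H j] by (auto simp: scan_outcome_def)
    then show ?thesis
      using * by (auto simp: entry_of_def)
  next
    fix s k v b' e
    assume "cmap bm ar b' = Some e" "singleton ?H e k v"
      "\<forall>b'' j. b'' \<noteq> b' \<longrightarrow> cmap bm ar b'' = Some j \<longrightarrow> dead ?H j None"
    then show ?thesis
      using b al dead_not_alive[of ?H j] by (cases "b = b'") (auto simp: alive_def singleton_def)
  qed (use b al dead_not_alive in blast)
  then have keep': "\<forall>b j. cmap bm ar b = Some j \<and> alive ?H j \<longrightarrow> entry_of ?H w j"
    by blast
  have ro: "rooted ?H (set_option (rootp m) \<union> {})"
    using ok_memD(2)[OF ok] by simp
  note upd = cas_update[OF ok okh map_le_refl evolves_refl ro p c w keep', OF ball_emptyI, folded m'_def]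
  show "ok_mem m' loc" "evolves ?H loc (heap m') loc"
    using upd(1,2) by simp_all
  show "stored m' k v \<longleftrightarrow> stored m k v"
  proof (cases "k \<in> snd (loc p)")
    case True
    let ?l = "fst (loc p)"
    have s: "stored m k v \<longleftrightarrow> (\<exists>e. cmap bm ar (chunk ?l k) = Some e \<and> holds ?H k (?l + W) e v)"
      using upd(3)[OF True] reaches_cnode[OF p c wf] by simp
    have s': "stored m' k v \<longleftrightarrow> reaches (heap m') k ?l p v"
      using upd(4)[OF True] by simp
    have m'p: "heap m' p = Some (INode w)"
      by (simp add: m'_def)
    show ?thesis
      using r'
    proof (elim disjE exE conjE)
      assume "w = None" "\<forall>b j. cmap bm ar b = Some j \<longrightarrow> dead ?H j None"
      then show ?thesis
        using s s' m'p dead_not_holds[of ?H] not_reaches_null[of "heap m'" p] by blast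
    next
      fix c' bm' ar'
      assume *: "w = Some c'" "?H c' = Some (CNode bm' ar')" "loc c' = loc c"
        "\<forall>b. scan_outcome ?H (cmap bm ar b) (cmap bm' ar' b)"
      have "heap m' c' = Some (CNode bm' ar')"
        using *(2) p by (auto simp: m'_def)
      then have "stored m' k v \<longleftrightarrow>
          (\<exists>e. cmap bm' ar' (chunk ?l k) = Some e \<and> holds (heap m') k (?l + W) e v)"
        using s' m'p *(1) reaches_cnode[of "heap m'" p c'] ok_heap_wf[OF okh *(2)] by simp
      also have "\<dots> \<longleftrightarrow> (\<exists>e. cmap bm' ar' (chunk ?l k) = Some e \<and> holds ?H k (?l + W) e v)"
        using upd(6)[OF _ True refl] ok_heap_entry[OF okh *(2)] *(3) lc by auto
      also have "\<dots> \<longleftrightarrow> stored m k v"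
        using s scan_outcome_holds[of ?H "cmap bm ar (chunk ?l k)" "cmap bm' ar' (chunk ?l k)"] *(4) by blast
      finally show ?thesis .
    next
      fix s0 k0 v0 b e
      assume *: "w = Some s0" "?H s0 = Some (SNode k0 v0 True)" "cmap bm ar b = Some e"
        "singleton ?H e k0 v0" "\<forall>b' j. b' \<noteq> b \<longrightarrow> cmap bm ar b' = Some j \<longrightarrow> dead ?H j None"
      have "heap m' s0 = Some (SNode k0 v0 True)"
        using *(2) p by (auto simp: m'_def)
      then have 1: "stored m' k v \<longleftrightarrow> k = k0 \<and> v = v0"
        using s' m'p *(1) reaches_tomb[of "heap m'" p s0] by simp
      have ch: "chunk ?l k0 = b"
        using tomb[OF *(3,4)] by (simp add: child_def)
      show ?thesis
      proof (cases "chunk ?l k = b")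
        case True
        then show ?thesis
          using 1 s *(3) holds_singleton[OF *(4)] by auto
      next
        case False
        then have "\<not> stored m k v"
          using s *(5) dead_not_holds[of ?H] by blast
        then show ?thesis
          using 1 ch False by auto
      qed
    qed
  qed (use upd(5) in simp)
qed


text \<open>An untombed copy has the key of the tombed snode, and \<open>ok_main\<close> places that
  key in the key set of the inode holding it.\<close>

lemma scan_outcome_ok_entry:
  assumes "ok_heap H loc" "ok_entry H loc x j" "scan_outcome H (Some j) (Some e)"
  shows "ok_entry H loc x e"
  using assms(3) unfolding scan_outcome_def
proof (elim disjE exE conjE)
  fix j' s k v s'
  assume *: "Some j = Some j'" "dead H j' (Some s)" "H s = Some (SNode k v True)" "Some e = Some s'"
    "H s' = Some (SNode k v False)"
  then have "H j = Some (INode (Some s))"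
    by (simp add: dead_def)
  then have "k \<in> snd x"
    using ok_heap_main[OF assms(1), of j "Some s"] assms(2) *(3) by (auto simp: ok_main_def ok_entry_def)
  then show ?thesis
    using * by (simp add: ok_entry_def)
qed (use assms in auto)

lemma scan_outcome_evolves:
  assumes "evolves H loc H' loc'" "scan_outcome H o1 o2"
  shows "scan_outcome H' o1 o2"
  using assms(2) evolvesD(4,5)[OF assms(1)] unfolding scan_outcome_def by metis

lemma singleton_evolves:
  assumes "evolves H loc H' loc'" "singleton H e k v"
  shows "singleton H' e k v"
  using assms(2) unfolding singleton_def
proof (elim disjE exE conjE)
  fix s assume s: "H e = Some (INode (Some s))" "H s = Some (SNode k v True)"
  then have "dead H e (Some s)"
    by (simp add: dead_def)
  from evolvesD(5)[OF assms(1) this] have "dead H' e (Some s)" .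
  then show "(\<exists>t. H' e = Some (SNode k v t)) \<or>
      (\<exists>s. H' e = Some (INode (Some s)) \<and> H' s = Some (SNode k v True))"
    using evolvesD(4)[OF assms(1) s(2)] by (auto simp: dead_def)
qed (use evolvesD(4)[OF assms(1)] in blast)

lemma replacement_evolves:
  assumes ev: "evolves H loc H' loc'" and r: "replacement H loc c w"
  shows "replacement H' loc' c w"
proof -
  obtain bm ar where c: "H c = Some (CNode bm ar)" and r':
    "(w = None \<and> (\<forall>b j. cmap bm ar b = Some j \<longrightarrow> dead H j None)) \<or>
      (\<exists>c' bm' ar'. w = Some c' \<and> H c' = Some (CNode bm' ar') \<and> loc c' = loc c \<and>
         (\<forall>b. scan_outcome H (cmap bm ar b) (cmap bm' ar' b))) \<or>
      (\<exists>s k v b e. w = Some s \<and> H s = Some (SNode k v True) \<and> cmap bm ar b = Some e \<and>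
         singleton H e k v \<and> (\<forall>b' j. b' \<noteq> b \<longrightarrow> cmap bm ar b' = Some j \<longrightarrow> dead H j None))"
    using r unfolding replacement_def by blast
  have "(w = None \<and> (\<forall>b j. cmap bm ar b = Some j \<longrightarrow> dead H' j None)) \<or>
      (\<exists>c' bm' ar'. w = Some c' \<and> H' c' = Some (CNode bm' ar') \<and> loc' c' = loc' c \<and>
         (\<forall>b. scan_outcome H' (cmap bm ar b) (cmap bm' ar' b))) \<or>
      (\<exists>s k v b e. w = Some s \<and> H' s = Some (SNode k v True) \<and> cmap bm ar b = Some e \<and>
         singleton H' e k v \<and> (\<forall>b' j. b' \<noteq> b \<longrightarrow> cmap bm ar b' = Some j \<longrightarrow> dead H' j None))"
    using r'
  proof (elim disjE exE conjE)
    assume "w = None" "\<forall>b j. cmap bm ar b = Some j \<longrightarrow> dead H j None"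
    then show ?thesis
      using evolvesD(5)[OF ev] by blast
  next
    fix c' bm' ar'
    assume *: "w = Some c'" "H c' = Some (CNode bm' ar')" "loc c' = loc c"
      "\<forall>b. scan_outcome H (cmap bm ar b) (cmap bm' ar' b)"
    then have "loc' c' = loc' c"
      using evolvesD(1)[OF ev *(2)] evolvesD(1)[OF ev c] by simp
    then show ?thesis
      using * evolvesD(3)[OF ev *(2)] scan_outcome_evolves[OF ev] by blast
  next
    fix s k v b e
    assume "w = Some s" "H s = Some (SNode k v True)" "cmap bm ar b = Some e" "singleton H e k v"
      "\<forall>b' j. b' \<noteq> b \<longrightarrow> cmap bm ar b' = Some j \<longrightarrow> dead H j None"
    then show ?thesis
      using evolvesD(4,5)[OF ev] singleton_evolves[OF ev] by blast
  qed
  then show ?thesis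
    using evolvesD(3)[OF ev c] unfolding replacement_def by blast
qed

text \<open>\<open>xs\<close> stands for the kept entries followed by those still to be visited. A
  scan starts with all entries and rewrites one of them per step, so one predicate serves both
  passes of \<open>toCompressed\<close> and the pass of \<open>toWeakTombed\<close>.\<close>

definition scanned :: "('k, 'v) heap \<Rightarrow> ref \<Rightarrow> (nat \<times> ref) list \<Rightarrow> bool" where
  "scanned H c xs \<longleftrightarrow> bit_list xs \<and> (\<exists>bm ar. H c = Some (CNode bm ar) \<and>
     (\<forall>b. scan_outcome H (cmap bm ar b) (map_of xs b)))"

lemma scanned_evolves:
  "evolves H loc H' loc' \<Longrightarrow> scanned H c xs \<Longrightarrow> scanned H' c xs"
  unfolding scanned_def using evolvesD(3) scan_outcome_evolves by blast

lemma scanned_entries: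
  "ok_heap H loc \<Longrightarrow> H c = Some (CNode bm ar) \<Longrightarrow> scanned H c (entries bm ar)"
  unfolding scanned_def using bit_list_entries[OF ok_heap_wf[of H loc c bm ar]]
  by (auto simp: scan_outcome_def cmap_def)

lemma map_of_middle:
  assumes "bit_list (ks @ (b, e) # es)"
  shows "map_of (ks @ (b, e') # es) = (map_of (ks @ es))(b \<mapsto> e')" "map_of (ks @ es) b = None"
proof -
  have "b \<notin> fst ` set ks" "b \<notin> fst ` set es"
    using assms by (auto simp: bit_list_def sorted_wrt_append)
  then have "map_of ks b = None" "map_of es b = None"
    by (simp_all add: map_of_eq_None_iff)
  then show "map_of (ks @ (b, e') # es) = (map_of (ks @ es))(b \<mapsto> e')" "map_of (ks @ es) b = None"
    by (auto simp: map_add_def fun_eq_iff split: option.splits)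
qed

lemma scanned_drop:
  assumes "scanned H c (ks @ (b, e) # es)" "null_inode H e"
  shows "scanned H c (ks @ es)"
proof -
  obtain bm ar where c: "H c = Some (CNode bm ar)"
    "\<And>b'. scan_outcome H (cmap bm ar b') (map_of (ks @ (b, e) # es) b')"
    and bl: "bit_list (ks @ (b, e) # es)"
    using assms(1) by (auto simp: scanned_def)
  \<comment> \<open>At bit \<open>b\<close> the list contains an inode, which cannot be an untombed
    copy, so it is still the original entry of \<open>c\<close>.\<close>
  have "scan_outcome H (cmap bm ar b') (map_of (ks @ es) b')" for b'
    using c(2)[of b'] assms(2) map_of_middle(1)[OF bl, of e] map_of_middle(2)[OF bl]
    by (cases "b' = b") (auto simp: scan_outcome_def null_inode_def dead_def simp del: map_of_append)
  then show ?thesis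
    using c(1) bit_list_drop[OF bl] by (auto simp: scanned_def simp del: map_of_append)
qed

lemma scanned_untomb:
  assumes "scanned H c (ks @ (b, e) # es)" "H e = Some (INode (Some s))"
    "H s = Some (SNode k v True)" "H s' = Some (SNode k v False)"
  shows "scanned H c (ks @ (b, s') # es)"
proof -
  obtain bm ar where c: "H c = Some (CNode bm ar)"
    "\<And>b'. scan_outcome H (cmap bm ar b') (map_of (ks @ (b, e) # es) b')"
    and bl: "bit_list (ks @ (b, e) # es)"
    using assms(1) by (auto simp: scanned_def)
  have "scan_outcome H (cmap bm ar b') (map_of (ks @ (b, s') # es) b')" for b'
    using c(2)[of b'] assms(2-) map_of_middle(1)[OF bl]
    by (cases "b' = b") (auto simp: scan_outcome_def dead_def simp del: map_of_append)
  then show ?thesis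
    using c(1) bit_list_update[OF bl] by (auto simp: scanned_def simp del: map_of_append)
qed

lemma alloc_replacement:
  fixes m :: "('k, 'v) mem"
  assumes ok: "ok_mem m loc" and c: "heap m c = Some (CNode bm ar)"
    and al: "alloc (heap m) (CNode bm' ar') H c'" and wf: "wf_cnode bm' ar'"
    and scan_outcome: "\<And>b. scan_outcome (heap m) (cmap bm ar b) (cmap bm' ar' b)"
  shows "ok_mem (m\<lparr>heap := H\<rparr>) (loc(c' := loc c))" "evolves (heap m) loc H (loc(c' := loc c))"
    "replacement H (loc(c' := loc c)) c (Some c')" "stored (m\<lparr>heap := H\<rparr>) k v \<longleftrightarrow> stored m k v"
proof -
  have "ok_entry (heap m) loc (child (loc c) b) e" if be: "cmap bm' ar' b = Some e" for b e
  proof -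
    obtain j where "cmap bm ar b = Some j"
      using scan_outcome[of b] be by (auto simp: scan_outcome_def)
    then show ?thesis
      using scan_outcome_ok_entry[OF ok_memD(1)[OF ok]] ok_heap_entry[OF ok_memD(1)[OF ok] c] scan_outcome[of b] be
      by metis
  qed
  then have n: "ok_node (heap m) loc (loc c) (CNode bm' ar')"
    using wf by simp
  show "ok_mem (m\<lparr>heap := H\<rparr>) (loc(c' := loc c))" "stored (m\<lparr>heap := H\<rparr>) k v \<longleftrightarrow> stored m k v"
    using alloc_stored[OF ok al n] by simp_all
  show ev: "evolves (heap m) loc H (loc(c' := loc c))"
    by (rule alloc_evolves[OF al])
  have "H c = Some (CNode bm ar)" "(loc(c' := loc c)) c' = (loc(c' := loc c)) c"
    using evolvesD(3)[OF ev c] by simp_all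
  then show "replacement H (loc(c' := loc c)) c (Some c')"
    unfolding replacement_def using alloc_at[OF al] scan_outcome_evolves[OF ev scan_outcome] by blast
qed

lemma alloc_mk_cnode_replacement:
  fixes m :: "('k, 'v) mem"
  assumes ok: "ok_mem m loc" and sc: "scanned (heap m) c ks"
    and al: "alloc (heap m) (mk_cnode ks) H c'"
  obtains loc' where "ok_mem (m\<lparr>heap := H\<rparr>) loc'" "evolves (heap m) loc H loc'"
    "replacement H loc' c (Some c')" "\<And>k v. stored (m\<lparr>heap := H\<rparr>) k v \<longleftrightarrow> stored m k v"
proof -
  obtain bm ar where c: "heap m c = Some (CNode bm ar)" "\<And>b. scan_outcome (heap m) (cmap bm ar b) (map_of ks b)"
    and bl: "bit_list ks"
    using sc by (auto simp: scanned_def)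
  obtain bm' ar' where mk: "mk_cnode ks = (CNode bm' ar' :: ('k, 'v) node)" "wf_cnode bm' ar'"
    "cmap bm' ar' = map_of ks"
    using mk_cnode[OF bl] by blast
  note rep = alloc_replacement[OF ok c(1) al[unfolded mk(1)] mk(2)]
  show thesis
    by (rule that[of "loc(c' := loc c)"]; rule rep) (use c(2) mk(3) in simp_all)
qed

lemma weak_tombed_ok:
  fixes m :: "('k, 'v) mem"
  assumes ok: "ok_mem m loc" and sc: "scanned (heap m) c ks"
    and wt: "weak_tombed (heap m) c ks H w"
  obtains loc' where "ok_mem (m\<lparr>heap := H\<rparr>) loc'" "evolves (heap m) loc H loc'"
    "w \<noteq> Some c \<Longrightarrow> replacement H loc' c w" "\<And>k v. stored (m\<lparr>heap := H\<rparr>) k v \<longleftrightarrow> stored m k v"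
proof -
  obtain bm ar where c: "heap m c = Some (CNode bm ar)" "\<And>b. scan_outcome (heap m) (cmap bm ar b) (map_of ks b)"
    and bl: "bit_list ks"
    using sc by (auto simp: scanned_def)
  show thesis
    using wt
  proof cases
    case many
    then show thesis
      by (intro that[of loc]) (use ok in \<open>simp_all add: evolves_refl\<close>)
  next
    case none
    have "dead (heap m) j None" if "cmap bm ar b = Some j" for b j
      using c(2)[of b] none that by (auto simp: scan_outcome_def)
    then have "replacement (heap m) loc c None"
      using c(1) by (auto simp: replacement_def)
    then show thesis
      by (intro that[of loc]) (use none ok in \<open>simp_all add: evolves_refl\<close>)
  next
    case (single e k v s b)
    \<comment> \<open>Choosing \<open>loc s\<close> as the location of the new snode leaves the
      ghost map unchanged.\<close>
    have ev: "evolves (heap m) loc H loc"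
      using alloc_evolves[OF single(4), of loc "loc s"] by simp
    have null: "dead (heap m) j None" if "b' \<noteq> b" "cmap bm ar b' = Some j" for b' j
      using c(2)[of b'] single(1) that by (auto simp: scan_outcome_def)
    \<comment> \<open>As far as \<open>scanned\<close> tells, \<open>e\<close> could be an untombed
      copy; then the original entry is a tomb-inode with the same key and value, again a
      singleton.\<close>
    obtain e0 where e0: "cmap bm ar b = Some e0" "singleton (heap m) e0 k v"
    proof -
      have "scan_outcome (heap m) (cmap bm ar b) (Some e)"
        using c(2)[of b] single(1) by simp
      then show thesis
        unfolding scan_outcome_def
      proof (elim disjE exE conjE)
        fix j s0 k0 v0 s'
        assume *: "cmap bm ar b = Some j" "dead (heap m) j (Some s0)" "heap m s0 = Some (SNode k0 v0 True)"
          "Some e = Some s'" "heap m s' = Some (SNode k0 v0 False)"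
        then have "k0 = k" "v0 = v"
          using single(3) by (auto simp: singleton_def)
        then have "singleton (heap m) j k v"
          using dead_singleton[OF *(2,3)] by simp
        then show thesis
          by (rule that[OF *(1)])
      qed (use that single(3) in auto)
    qed
    have "replacement H loc c (Some s)"
      unfolding replacement_def
      using evolvesD(3)[OF ev c(1)] alloc_at[OF single(4)] e0(1) singleton_evolves[OF ev e0(2)]
        evolvesD(5)[OF ev null] by blast
    then show thesis
      using that[of loc] alloc_stored[OF ok single(4), of "loc s"] ev single(2) by simp
  next
    case (other e b c')
    have "alloc (heap m) (mk_cnode ks) H c'"
      using other by simp
    then show thesis
      by (rule alloc_mk_cnode_replacement[OF ok sc]) (use that other(2) in blast)
  qed
qed

text \<open>Contraction is compression of the parent at one entry: dropping or untombing the dead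
  \<open>i\<close> is a \<open>scan_outcome\<close>. The step splits into an invisible allocation
  followed by the write covered by \<open>compress_cas\<close>.\<close>

lemma contract_cas_ok:
  fixes m :: "('k, 'v) mem"
  assumes ok: "ok_mem m loc" and p: "heap m p = Some (INode (Some c))"
    and c: "heap m c = Some (CNode bm ar)" "entry bm ar l k = Some i"
    and d: "dead (heap m) i x" and cp: "contract_copy (heap m) k l x c H c'"
  defines "m' \<equiv> m\<lparr>heap := H(p \<mapsto> INode (Some c'))\<rparr>"
  obtains loc' where "ok_mem m' loc'" "evolves (heap m) loc (heap m') loc'"
    "\<And>k v. stored m' k v \<longleftrightarrow> stored m k v"
proof -
  note okh = ok_memD(1)[OF ok]
  note wf = ok_heap_wf[OF okh c(1)]
  have ci: "cmap bm ar (chunk l k) = Some i"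
    using c(2) by (simp add: entry_eq_cmap[OF wf])
  have "\<exists>loc1. ok_mem (m\<lparr>heap := H\<rparr>) loc1 \<and> evolves (heap m) loc H loc1 \<and>
    replacement H loc1 c (Some c') \<and> (\<forall>k v. stored (m\<lparr>heap := H\<rparr>) k v \<longleftrightarrow> stored m k v)"
    using cp
  proof cases
    case (null bm1 ar1)
    obtain bm' ar' where c': "removed bm ar l k = (CNode bm' ar' :: ('k, 'v) node)"
      "wf_cnode bm' ar'" "cmap bm' ar' = (cmap bm ar)(chunk l k := None)"
      using removed_cnode[OF wf c(2)] by blast
    have al: "alloc (heap m) (CNode bm' ar') H c'"
      using null c(1) c'(1) by simp
    have "scan_outcome (heap m) (cmap bm ar b) (cmap bm' ar' b)" for b
      using c'(3) ci d null(1) by (auto simp: scan_outcome_def)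
    from alloc_replacement[OF ok c(1) al c'(2) this] show ?thesis
      by blast
  next
    case (tombed bm1 ar1 s k' v' H1 s')
    obtain bm' ar' where c': "replaced bm ar l k s' = (CNode bm' ar' :: ('k, 'v) node)"
      "wf_cnode bm' ar'" "cmap bm' ar' = (cmap bm ar)(chunk l k := Some s')"
      using replaced_cnode[OF wf c(2)] by blast
    let ?m1 = "m\<lparr>heap := H1\<rparr>"
    have ok1: "ok_mem ?m1 loc" "\<And>k v. stored ?m1 k v \<longleftrightarrow> stored m k v"
      using alloc_stored[OF ok tombed(4), of "loc s'"] by simp_all
    have ev1: "evolves (heap m) loc H1 loc"
      using alloc_evolves[OF tombed(4), of loc "loc s'"] by simp
    have al: "alloc (heap ?m1) (CNode bm' ar') H c'"
      using tombed c(1) c'(1) by simp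
    have "scan_outcome H1 (Some i) (Some s')"
      using evolvesD(5)[OF ev1 d] evolvesD(4)[OF ev1 tombed(3)] alloc_at[OF tombed(4)] tombed(1)
      unfolding scan_outcome_def by blast
    then have "scan_outcome (heap ?m1) (cmap bm ar b) (cmap bm' ar' b)" for b
      using c'(3) ci by (cases "b = chunk l k") (simp_all add: scan_outcome_def)
    note rep = alloc_replacement[OF ok1(1) _ al c'(2) this]
    have c1: "heap ?m1 c = Some (CNode bm ar)"
      using evolvesD(3)[OF ev1 c(1)] by simp
    have "evolves (heap m) loc H (loc(c' := loc c))"
      using evolves_trans[OF ev1] rep(2)[OF c1] by simp
    then show ?thesis
      using rep(1,3,4)[OF c1] ok1(2) by (intro exI[of _ "loc(c' := loc c)"]) (simp del: fun_upd_apply)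
  qed
  then obtain loc1 where l1: "ok_mem (m\<lparr>heap := H\<rparr>) loc1" "evolves (heap m) loc H loc1"
    "replacement H loc1 c (Some c')" "\<And>k v. stored (m\<lparr>heap := H\<rparr>) k v \<longleftrightarrow> stored m k v"
    by blast
  have pH: "heap (m\<lparr>heap := H\<rparr>) p = Some (INode (Some c))"
    using cp p by cases (auto simp: alloc_def)
  note cc = compress_cas[OF l1(1) pH, of "Some c'"]
  have m': "m' = (m\<lparr>heap := H\<rparr>)\<lparr>heap := (heap (m\<lparr>heap := H\<rparr>))(p \<mapsto> INode (Some c'))\<rparr>"
    by (simp add: m'_def)
  show thesis
    by (rule that[of loc1, unfolded m']) (use cc l1(2,3,4) evolves_trans[OF l1(2)] in simp_all)
qed


subsection \<open>The root\<close>

text \<open>The premise fits both expected values of a CAS on the root: it is vacuous for null, and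
  a null-inode once seen stays null.\<close>

lemma root_dead:
  assumes ok: "ok_mem m loc" and r: "\<And>r. rootp m = Some r \<Longrightarrow> dead (heap m) r None"
  shows "\<not> alive (heap m) j" "\<not> stored m k v"
proof -
  show "\<not> alive (heap m) j"
    using alive_root[OF ok] r dead_not_alive by blast
  show "\<not> stored m k v"
    using r not_reaches_null[of "heap m"] by (auto simp: stored_def dead_def)
qed

lemma cas_root_insert_ok:
  fixes m :: "('k, 'v) mem"
  assumes ok: "ok_mem m loc" and r: "\<And>r. rootp m = Some r \<Longrightarrow> dead (heap m) r None"
    and al: "alloc (heap m) (SNode k v False) H1 s" "alloc H1 (mk_cnode [(chunk 0 k, s)]) H2 c"
      "alloc H2 (INode (Some c)) H3 i"
  defines "m' \<equiv> \<lparr>rootp = Some i, heap = H3\<rparr>"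
  obtains loc' where "ok_mem m' loc'" "evolves (heap m) loc (heap m') loc'"
    "\<And>k' v'. stored m' k' v' \<longleftrightarrow> k' = k \<and> v' = v"
proof -
  note okh = ok_memD(1)[OF ok]
  let ?x = "(0 :: nat, UNIV :: 'k set)"
  let ?loc1 = "loc(s := ?x)" let ?loc2 = "?loc1(c := ?x)" let ?loc3 = "?loc2(i := ?x)"
  have "bit_list [(chunk 0 k, s)]"
    using chunk_less by (simp add: bit_list_def)
  then obtain bm ar where mk: "mk_cnode [(chunk 0 k, s)] = (CNode bm ar :: ('k, 'v) node)"
    "wf_cnode bm ar" "cmap bm ar = map_of [(chunk 0 k, s)]"
    using mk_cnode by blast
  have s: "H1 s = Some (SNode k v False)"
    by (rule alloc_at[OF al(1)])
  have ok1: "ok_heap H1 ?loc1"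
    by (rule alloc_ok_heap[OF okh al(1)]) simp
  have n2: "ok_node H1 ?loc1 ?x (mk_cnode [(chunk 0 k, s)])"
    unfolding mk(1) using mk(2,3) s by (auto simp: ok_entry_def child_def split: if_splits)
  have ok2: "ok_heap H2 ?loc2"
    by (rule alloc_ok_heap[OF ok1 al(2) n2])
  have c: "H2 c = Some (CNode bm ar)"
    using alloc_at[OF al(2)] mk(1) by simp
  have ok3: "ok_heap H3 ?loc3"
    by (rule alloc_ok_heap[OF ok2 al(3)]) (use c in \<open>simp add: ok_main_def\<close>)
  have i: "H3 i = Some (INode (Some c))"
    by (rule alloc_at[OF al(3)])
  have ev: "evolves (heap m) loc H3 ?loc3"
    by (rule evolves_trans[OF alloc_evolves[OF al(1)]
          evolves_trans[OF alloc_evolves[OF al(2)] alloc_evolves[OF al(3)]]])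
  \<comment> \<open>With no live inode left, the old root can be given up before the new one is
    added.\<close>
  have "rooted (heap m) {}"
    using root_dead(1)[OF ok r] by (simp add: rooted_def)
  then have "rooted H1 {}"
    by (rule rooted_alloc_no_inode[OF okh al(1)]) simp
  then have "rooted H2 {}"
    by (rule rooted_alloc_no_inode[OF ok1 al(2)]) (simp add: mk(1))
  then have "rooted H3 {i}"
    by (rule rooted_alloc[OF ok2 al(3)])
  then have ok': "ok_mem m' ?loc3"
    using ok3 i by (simp add: ok_mem_def m'_def)
  have c3: "H3 c = Some (CNode bm ar)" and s3: "H3 s = Some (SNode k v False)"
    using alloc_map_le[OF al(2)] alloc_map_le[OF al(3)] c s by (metis domI map_le_def)+
  have "stored m' k' v' \<longleftrightarrow> k' = k \<and> v' = v" for k' v'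
    using reaches_cnode[OF i c3 mk(2), of k' 0 v'] mk(3) s3 holds_snode[of H3 s k v False k' W v']
    by (auto simp: stored_def m'_def split: if_splits)
  then show thesis
    using that[of ?loc3] ok' ev by (simp add: m'_def)
qed

lemma cas_root_clear_ok:
  assumes ok: "ok_mem m loc" and r: "\<And>r. rootp m = Some r \<Longrightarrow> dead (heap m) r None"
  shows "ok_mem (m\<lparr>rootp := None\<rparr>) loc" "stored (m\<lparr>rootp := None\<rparr>) k v \<longleftrightarrow> stored m k v"
proof -
  show "ok_mem (m\<lparr>rootp := None\<rparr>) loc"
    using ok root_dead(1)[OF ok r] by (simp add: ok_mem_def rooted_def)
  show "stored (m\<lparr>rootp := None\<rparr>) k v \<longleftrightarrow> stored m k v"
    using root_dead(2)[OF ok r] by (simp add: stored_def)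
qed


section \<open>Control states\<close>

text \<open>For \<open>InsertCas\<close> the location suffices, since the copy is computed from
  \<open>c\<close> in the CAS step. \<open>RemoveCas\<close> also has to remember that the value
  \<open>v\<close> to be returned is the one in the entry of \<open>c\<close>.\<close>

fun pc_ok :: "('k, 'v) heap \<Rightarrow> 'k loc \<Rightarrow> ('k, 'v) pc \<Rightarrow> bool" where
  "pc_ok H loc (CheckRoot op r) \<longleftrightarrow> (\<exists>x. H r = Some (INode x)) \<and> loc r = (0, UNIV)"
| "pc_ok H loc (CasRoot op (Some r)) \<longleftrightarrow> dead H r None"
| "pc_ok H loc (Walk op i l p) \<longleftrightarrow> located H loc i l (key op)"
| "pc_ok H loc (InsertCas k v i l c) \<longleftrightarrow> located H loc i l k"
| "pc_ok H loc (RemoveCas k v i l p c) \<longleftrightarrow> located H loc i l k \<and>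
     (\<exists>bm ar s. H c = Some (CNode bm ar) \<and> entry bm ar l k = Some s \<and> H s = Some (SNode k v False))"
| "pc_ok H loc (CompressDrop op p c es ks) \<longleftrightarrow> scanned H c (ks @ es)"
| "pc_ok H loc (CompressUntomb op p c es ks) \<longleftrightarrow> scanned H c (ks @ es)"
| "pc_ok H loc (CleanCas op p c w) \<longleftrightarrow> replacement H loc c w"
| "pc_ok H loc (TombDrop k v i l p c es ks) \<longleftrightarrow> scanned H c (ks @ es)"
| "pc_ok H loc (TombCas k v i l p c w) \<longleftrightarrow> replacement H loc c w"
| "pc_ok H loc (ContractParent k v p i l x) \<longleftrightarrow> dead H i x \<or>
     (\<exists>c bm ar. x = Some c \<and> H c = Some (CNode bm ar))"
| "pc_ok H loc (ContractCas k v p i l x c) \<longleftrightarrow> dead H i x \<and>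
     (\<exists>bm ar. H c = Some (CNode bm ar) \<and> entry bm ar l k = Some i)"
| "pc_ok H loc _ \<longleftrightarrow> True"

lemma located_evolves:
  assumes "evolves H loc H' loc'" "located H loc i l k"
  shows "located H' loc' i l k"
  using assms(2) evolvesD(1,2)[OF assms(1)] unfolding located_def by metis

text \<open>Freedom from interference: the steps of other threads cannot invalidate what a thread
  has learned.\<close>

lemma pc_ok_evolves:
  assumes ev: "evolves H loc H' loc'" and pc: "pc_ok H loc pc"
  shows "pc_ok H' loc' pc"
proof (cases pc)
  case (CheckRoot op r)
  then obtain x where "H r = Some (INode x)" "loc r = (0, UNIV)"
    using pc by auto
  then show ?thesis
    using CheckRoot evolvesD(1,2)[OF ev, of r] by auto
next
  case (CasRoot op r)
  then show ?thesis
    using pc evolvesD(5)[OF ev] by (cases r) auto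
next
  case (RemoveCas k v i l p c)
  then obtain bm ar s where "located H loc i l k" "H c = Some (CNode bm ar)"
    "entry bm ar l k = Some s" "H s = Some (SNode k v False)"
    using pc by auto
  then show ?thesis
    using RemoveCas located_evolves[OF ev] evolvesD(3,4)[OF ev] by auto
next
  case (ContractParent k v p i l x)
  then show ?thesis
    using pc evolvesD(3,5)[OF ev] by auto
next
  case (ContractCas k v p i l x c)
  then obtain bm ar where "dead H i x" "H c = Some (CNode bm ar)" "entry bm ar l k = Some i"
    using pc by auto
  then show ?thesis
    using ContractCas evolvesD(3,5)[OF ev] by auto
qed (use pc located_evolves[OF ev] scanned_evolves[OF ev] replacement_evolves[OF ev] in simp_all)

text \<open>A removal counts as \<open>After\<close> from its CAS on, so \<open>tombCompress\<close>
  and \<open>contractParent\<close> belong to an operation that has already taken effect, whereas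
  \<open>clean\<close> precedes a restart and is \<open>Before\<close>.\<close>

fun phase_of :: "('k, 'v) pc \<Rightarrow> ('k, 'v) phase" where
  "phase_of Idle = Quiet"
| "phase_of (Return r) = After r"
| "phase_of (Start op) = Before op"
| "phase_of (CheckRoot op r) = Before op"
| "phase_of (CasRoot op r) = Before op"
| "phase_of (Walk op i l p) = Before op"
| "phase_of (InsertCas k v i l c) = Before (Insert k v)"
| "phase_of (RemoveCas k v i l p c) = Before (Remove k)"
| "phase_of (Clean op p) = Before op"
| "phase_of (CompressOne op p c) = Before op"
| "phase_of (CompressDrop op p c es ks) = Before op"
| "phase_of (CompressUntomb op p c es ks) = Before op"
| "phase_of (CleanCas op p c w) = Before op"
| "phase_of (Tomb k v i l p) = After (Found v)"
| "phase_of (TombDrop k v i l p c es ks) = After (Found v)"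
| "phase_of (TombCas k v i l p c w) = After (Found v)"
| "phase_of (Contract k v p i l) = After (Found v)"
| "phase_of (ContractParent k v p i l x) = After (Found v)"
| "phase_of (ContractCas k v p i l x c) = After (Found v)"


section \<open>Each step is silent or the linearization point of its own operation\<close>

lemma represents_stored: "represents m A \<longleftrightarrow> (\<forall>k v. A k = Some v \<longleftrightarrow> stored m k v)"
  by (simp add: represents_def stored_def)

text \<open>In the second alternative the step is a linearization point.\<close>

definition step_ok ::
  "('k, 'v) mem \<Rightarrow> 'k loc \<Rightarrow> ('k \<rightharpoonup> 'v) \<Rightarrow> ('k, 'v) pc \<Rightarrow> ('k, 'v) mem \<Rightarrow> ('k, 'v) pc \<Rightarrow> bool" where
  "step_ok m loc A pc m' pc' \<longleftrightarrow> (\<exists>loc'. ok_mem m' loc' \<and> evolves (heap m) loc (heap m') loc' \<and>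
     pc_ok (heap m') loc' pc' \<and>
     (phase_of pc' = phase_of pc \<and> represents m' A \<or>
      (\<exists>op. phase_of pc = Before op \<and> phase_of pc' = After (spec_result op A) \<and>
        represents m' (spec_state op A))))"

lemma step_ok_local:
  assumes "ok_mem m loc" "represents m A" "pc_ok (heap m) loc pc'" "phase_of pc' = phase_of pc"
  shows "step_ok m loc A pc m pc'"
  unfolding step_ok_def using assms evolves_refl by blast

text \<open>Also covers the removal of an absent key, which leaves the abstract state
  unchanged.\<close>

lemma step_ok_read:
  assumes "ok_mem m loc" "represents m A" "pc_ok (heap m) loc pc'"
    "phase_of pc = Before op" "phase_of pc' = After (spec_result op A)" "spec_state op A = A"
  shows "step_ok m loc A pc m pc'"
  unfolding step_ok_def using assms evolves_refl by (metis (lifting))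

lemma step_ok_silent:
  assumes "represents m A" "ok_mem m' loc'" "evolves (heap m) loc (heap m') loc'"
    "\<And>k v. stored m' k v \<longleftrightarrow> stored m k v" "pc_ok (heap m') loc' pc'" "phase_of pc' = phase_of pc"
  shows "step_ok m loc A pc m' pc'"
proof -
  have "represents m' A"
    using assms(1,4) by (simp add: represents_stored)
  then show ?thesis
    unfolding step_ok_def using assms by blast
qed

lemma step_ok_write:
  assumes "ok_mem m' loc'" "evolves (heap m) loc (heap m') loc'"
    "\<And>k v. spec_state op A k = Some v \<longleftrightarrow> stored m' k v" "pc_ok (heap m') loc' pc'"
    "phase_of pc = Before op" "phase_of pc' = After (spec_result op A)"
  shows "step_ok m loc A pc m' pc'"
proof -
  have "represents m' (spec_state op A)"
    using assms(3) by (simp add: represents_stored)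
  then show ?thesis
    unfolding step_ok_def using assms by blast
qed

lemma not_stored_unset:
  assumes ok: "ok_mem m loc" and rep: "represents m A" and a: "located (heap m) loc i l k"
    and i: "heap m i = Some (INode (Some c))" "heap m c = Some (CNode bm ar)" "entry bm ar l k = None"
  shows "A k = None"
  using stored_located[OF ok a i(1,2)] i(3) rep
  by (metis not_None_eq option.distinct(1) represents_stored)

lemma stored_snode:
  assumes ok: "ok_mem m loc" and rep: "represents m A" and a: "located (heap m) loc i l k"
    and i: "heap m i = Some (INode (Some c))" "heap m c = Some (CNode bm ar)"
      "entry bm ar l k = Some s" "heap m s = Some (SNode k' v' False)"
  shows "A k = (if k' = k then Some v' else None)"
proof -
  have "A k = Some v \<longleftrightarrow> k = k' \<and> v = v'" for v
    using stored_located[OF ok a i(1,2), of v] i(3,4) rep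
      holds_snode[of "heap m" s k' v' False k "l + W" v] by (simp add: represents_stored)
  then show ?thesis
    by (cases "A k") auto
qed

lemma step_imp_step_ok:
  fixes m m' :: "('k, 'v) mem"
  assumes "step m pc m' pc'" "ok_mem m loc" "pc_ok (heap m) loc pc" "represents m A"
  shows "step_ok m loc A pc m' pc'"
  using assms
proof (induction rule: step.induct)
  case (start_null_lookup m k)
  then have "A k = None"
    by (cases "A k") (auto simp: represents_def)
  then show ?case
    using start_null_lookup by (intro step_ok_read[where op = "Lookup k"]) auto
next
  case (start_null_remove m k)
  then have "A k = None"
    by (cases "A k") (auto simp: represents_def)
  then show ?case
    using start_null_remove by (intro step_ok_read[where op = "Remove k"]) auto
next
  case (start m r op)
  then show ?case
    using ok_memD(3)[OF start(2)] by (intro step_ok_local) auto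
next
  case (check_root_null m r op)
  then show ?case
    by (intro step_ok_local) (auto simp: null_inode_def dead_def)
next
  case (check_root m r op)
  then show ?case
    by (intro step_ok_local) (auto simp: located_def)
next
  case (cas_root_insert m r k v H1 s H2 c H3 i)
  then have "\<And>r. rootp m = Some r \<Longrightarrow> dead (heap m) r None"
    by (cases r) auto
  from cas_root_insert_ok[OF cas_root_insert(5) this cas_root_insert(2-4)] root_dead(2)[OF cas_root_insert(5) this]
  obtain loc' where *: "ok_mem \<lparr>rootp = Some i, heap = H3\<rparr> loc'"
    "evolves (heap m) loc (heap (\<lparr>rootp = Some i, heap = H3\<rparr> :: ('k, 'v) mem)) loc'"
    "\<And>k' v'. stored \<lparr>rootp = Some i, heap = H3\<rparr> k' v' \<longleftrightarrow> k' = k \<and> v' = v"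
    "\<And>k v. \<not> stored m k v" by blast
  have "A k' = None" for k'
    using *(4) cas_root_insert(7) by (cases "A k'") (auto simp: represents_stored)
  then show ?case
    using * by (intro step_ok_write[where op = "Insert k v"]) auto
next
  case (cas_root_lookup m r k)
  then have "\<And>r. rootp m = Some r \<Longrightarrow> dead (heap m) r None"
    by (cases r) auto
  from cas_root_clear_ok[OF cas_root_lookup(2) this] show ?case
    using cas_root_lookup evolves_refl by (intro step_ok_silent) auto
next
  case (cas_root_remove m r k)
  then have "\<And>r. rootp m = Some r \<Longrightarrow> dead (heap m) r None"
    by (cases r) auto
  from cas_root_clear_ok[OF cas_root_remove(2) this] show ?case
    using cas_root_remove evolves_refl by (intro step_ok_silent) auto
next
  case (walk_down m i c bm ar l op j x p)
  note okh = ok_memD(1)[OF walk_down(5)]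
  have "ok_entry (heap m) loc (child (loc c) (chunk l (key op))) j"
    using ok_heap_entry[OF okh walk_down(2)] walk_down(3)
    by (simp add: entry_eq_cmap[OF ok_heap_wf[OF okh walk_down(2)]])
  then have "loc j = child (loc i) (chunk l (key op))"
    using walk_down(4) ok_heap_loc[OF okh walk_down(1,2)] by (auto simp: ok_entry_def)
  then show ?case
    using walk_down by (intro step_ok_local) (auto simp: located_def child_def)
next
  case (walk_unset_lookup m i c bm ar l k p)
  then have "A k = None"
    by (intro not_stored_unset[OF walk_unset_lookup(4,6)]) auto
  then show ?case
    using walk_unset_lookup by (intro step_ok_read[where op = "Lookup k"]) auto
next
  case (walk_snode_lookup m i c bm ar l k s k' v' p)
  then have "A k = (if k' = k then Some v' else None)"
    by (intro stored_snode[OF walk_snode_lookup(5,7)]) auto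
  then show ?case
    using walk_snode_lookup by (intro step_ok_read[where op = "Lookup k"]) auto
next
  case (walk_unset_remove m i c bm ar l k p)
  then have "A k = None"
    by (intro not_stored_unset[OF walk_unset_remove(4,6)]) auto
  then show ?case
    using walk_unset_remove by (intro step_ok_read[where op = "Remove k"]) auto
next
  case (walk_snode_remove m i c bm ar l k s k' v' p)
  show ?case
  proof (cases "k' = k")
    case True
    then show ?thesis
      using walk_snode_remove by (intro step_ok_local) auto
  next
    case False
    then have "A k = None"
      using walk_snode_remove stored_snode[OF walk_snode_remove(5,7) _ walk_snode_remove(1-4)] by simp
    then show ?thesis
      using walk_snode_remove False by (intro step_ok_read[where op = "Remove k"]) auto
  qed
next
  case (insert_cas m i c k v l H c')
  have "located (heap m) loc i l k"
    using insert_cas(4) by simp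
  from insert_cas_ok[OF insert_cas(3) this insert_cas(1,2)]
  obtain loc' where "ok_mem (m\<lparr>heap := H(i \<mapsto> INode (Some c'))\<rparr>) loc'"
    "evolves (heap m) loc (heap (m\<lparr>heap := H(i \<mapsto> INode (Some c'))\<rparr>)) loc'"
    "\<And>k' v'. stored (m\<lparr>heap := H(i \<mapsto> INode (Some c'))\<rparr>) k' v' \<longleftrightarrow>
      (if k' = k then v' = v else stored m k' v')" by blast
  then show ?case
    using insert_cas(5) by (intro step_ok_write[where op = "Insert k v"]) (auto simp: represents_stored)
next
  case (remove_cas m i c k l H w v p)
  obtain bm ar s where c: "located (heap m) loc i l k" "heap m c = Some (CNode bm ar)"
    "entry bm ar l k = Some s" "heap m s = Some (SNode k v False)"
    using remove_cas(4) by auto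
  from remove_cas_ok[OF remove_cas(3) c(1) remove_cas(1) c(2-4) remove_cas(2)]
  obtain loc' where *: "ok_mem (m\<lparr>heap := H(i \<mapsto> INode w)\<rparr>) loc'"
    "evolves (heap m) loc (heap (m\<lparr>heap := H(i \<mapsto> INode w)\<rparr>)) loc'" "stored m k v"
    "\<And>k' v'. stored (m\<lparr>heap := H(i \<mapsto> INode w)\<rparr>) k' v' \<longleftrightarrow> k' \<noteq> k \<and> stored m k' v'" by blast
  \<comment> \<open>The value read before the CAS is still the current one, because the successful
    CAS found the same cnode \<open>c\<close>.\<close>
  then have "A k = Some v"
    using remove_cas(5) by (simp add: represents_stored)
  then show ?case
    using * remove_cas(5)
    by (intro step_ok_write[where op = "Remove k"]) (auto simp: represents_stored dest: stored_fun split: option.splits)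
next
  case (clean m p c bm ar op)
  then show ?case
    using scanned_entries[OF ok_memD(1)] by (intro step_ok_local) auto
next
  case (compress_one_tomb m c bm e s k' v' op p)
  note okh = ok_memD(1)[OF compress_one_tomb(4)]
  have wf: "wf_cnode bm [e]"
    by (rule ok_heap_wf[OF okh compress_one_tomb(1)])
  obtain b where "cmap bm [e] = [b \<mapsto> e]"
    using length_one_entries[OF wf] by auto
  then have "replacement (heap m) loc c (Some s)"
    using compress_one_tomb(1-3) by (auto simp: replacement_def singleton_def intro!: exI[of _ b])
  then show ?case
    using compress_one_tomb by (intro step_ok_local) auto
next
  case (compress_one_other m c bm e op p)
  then show ?case
    using scanned_entries[OF ok_memD(1)] by (intro step_ok_local) auto
next
  case (compress_drop m op p c b e es ks)
  then show ?case
    using scanned_drop[of "heap m" c ks b e es] by (intro step_ok_local) auto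
next
  case (compress_untomb m e s k' v' H s' op p c b es ks)
  let ?m = "m\<lparr>heap := H\<rparr>"
  have ev: "evolves (heap m) loc (heap ?m) loc"
    using alloc_evolves[OF compress_untomb(3), of loc "loc s'"] by simp
  have ok: "ok_mem ?m loc" "\<And>k v. stored ?m k v \<longleftrightarrow> stored m k v"
    using alloc_stored[OF compress_untomb(4,3), of "loc s'"] by simp_all
  have "dead (heap m) e (Some s)"
    using compress_untomb(1,2) by (simp add: dead_def)
  from evolvesD(5)[OF ev this] have e: "H e = Some (INode (Some s))"
    by (simp add: dead_def)
  have "scanned H c (ks @ (b, e) # es)"
    using scanned_evolves[OF ev] compress_untomb(5) by simp
  from scanned_untomb[OF this e] have "scanned H c (ks @ (b, s') # es)"
    using evolvesD(4)[OF ev compress_untomb(2)] alloc_at[OF compress_untomb(3)] by simp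
  then show ?case
    using compress_untomb(6) ok ev by (intro step_ok_silent[where loc' = loc]) auto
next
  case (compress_null m op p c)
  then obtain bm ar where c: "heap m c = Some (CNode bm ar)" "\<And>b. scan_outcome (heap m) (cmap bm ar b) None"
    by (auto simp: scanned_def)
  have "dead (heap m) j None" if "cmap bm ar b = Some j" for b j
    using c(2)[of b] that by (auto simp: scan_outcome_def)
  then show ?case
    using compress_null c(1) by (intro step_ok_local) (auto simp: replacement_def)
next
  case (compress_cnode ks m H c' op p c)
  have "scanned (heap m) c ks"
    using compress_cnode(4) by simp
  from alloc_mk_cnode_replacement[OF compress_cnode(3) this compress_cnode(2)]
  obtain loc' where "ok_mem (m\<lparr>heap := H\<rparr>) loc'" "evolves (heap m) loc H loc'"
    "replacement H loc' c (Some c')" "\<And>k v. stored (m\<lparr>heap := H\<rparr>) k v \<longleftrightarrow> stored m k v" by blast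
  then show ?case
    using compress_cnode(5) by (intro step_ok_silent[where loc' = loc']) auto
next
  case (clean_cas m p c op w)
  have "replacement (heap m) loc c w"
    using clean_cas(3) by simp
  from compress_cas[OF clean_cas(2,1) this] show ?case
    using clean_cas(4) by (intro step_ok_silent[where loc' = loc]) auto
next
  case (tomb m i c bm ar k v l p)
  then show ?case
    using scanned_entries[OF ok_memD(1)] by (intro step_ok_local) auto
next
  case (tomb_drop m k v i l p c b e es ks)
  then show ?case
    using scanned_drop[of "heap m" c ks b e es] by (intro step_ok_local) auto
next
  case (tomb_drop_done m c ks H w k v i l p)
  have "scanned (heap m) c ks"
    using tomb_drop_done(3) by simp
  from weak_tombed_ok[OF tomb_drop_done(2) this tomb_drop_done(1)]
  obtain loc' where "ok_mem (m\<lparr>heap := H\<rparr>) loc'" "evolves (heap m) loc H loc'"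
    "w \<noteq> Some c \<Longrightarrow> replacement H loc' c w" "\<And>k v. stored (m\<lparr>heap := H\<rparr>) k v \<longleftrightarrow> stored m k v" by blast
  then show ?case
    using tomb_drop_done(4) by (intro step_ok_silent[where loc' = loc']) auto
next
  case (tomb_cas_contract m i c w k v l p)
  have "replacement (heap m) loc c w"
    using tomb_cas_contract(4) by simp
  from compress_cas[OF tomb_cas_contract(3,1) this] show ?case
    using tomb_cas_contract(5) by (intro step_ok_silent[where loc' = loc]) auto
next
  case (tomb_cas m i c w c' bm ar k v l p)
  have "replacement (heap m) loc c w"
    using tomb_cas(5) by simp
  from compress_cas[OF tomb_cas(4,1) this] show ?case
    using tomb_cas(6) by (intro step_ok_silent[where loc' = loc]) auto
next
  case (contract m i x k v p l)
  have "ok_main (heap m) loc (loc i) x"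
    by (rule ok_heap_main[OF ok_memD(1)[OF contract(2)] contract(1)])
  then show ?case
    using contract by (intro step_ok_local) (auto simp: ok_main_def dead_def)
next
  case (contract_parent m p c bm ar l k i x v)
  then have "dead (heap m) i x"
    by (auto simp: dead_def)
  then show ?case
    using contract_parent by (intro step_ok_local) auto
next
  case (contract_cas m p c k l x H c' v i)
  obtain bm ar where c: "dead (heap m) i x" "heap m c = Some (CNode bm ar)" "entry bm ar l k = Some i"
    using contract_cas(4) by auto
  from contract_cas_ok[OF contract_cas(3,1) c(2,3,1) contract_cas(2)]
  obtain loc' where "ok_mem (m\<lparr>heap := H(p \<mapsto> INode (Some c'))\<rparr>) loc'"
    "evolves (heap m) loc (heap (m\<lparr>heap := H(p \<mapsto> INode (Some c'))\<rparr>)) loc'"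
    "\<And>k v. stored (m\<lparr>heap := H(p \<mapsto> INode (Some c'))\<rparr>) k v \<longleftrightarrow> stored m k v" by blast
  then show ?case
    using contract_cas(5) by (intro step_ok_silent[where loc' = loc']) auto
\<comment> \<open>The remaining steps change neither the memory nor the phase: failed CASes,
  restarts, skipped helping, scan steps and the move to the CAS of an insertion.\<close>
qed (intro step_ok_local; auto split: option.splits)+

text \<open>One and the same \<open>A\<close> is the outcome of the linearization and the state
  represented by the memory; this ties the results read from memory to those of the specification.
  The stepping thread is handled by \<open>step_imp_step_ok\<close>, all others by
  \<open>pc_ok_evolves\<close>.\<close>

lemma execution_invariant:
  assumes "execution h m P"
  shows "\<exists>A loc. lin_inv h A (phase_of \<circ> P) \<and> represents m A \<and> ok_mem m loc \<and>
    (\<forall>t. pc_ok (heap m) loc (P t))"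
  using assms
proof (induction rule: execution.induct)
  case init
  \<comment> \<open>The constant ghost map is an arbitrary choice for the empty heap.\<close>
  have "ok_mem empty_mem (\<lambda>_. (0, UNIV))"
    by (simp add: ok_mem_def ok_heap_def rooted_def alive_def empty_mem_def)
  then show ?case
    using lin_inv_Nil by (intro exI[of _ Map.empty] exI[of _ "\<lambda>_. (0, UNIV)"])
      (auto simp: represents_def empty_mem_def comp_def)
next
  case (invoke h m P t op)
  then obtain A loc where *: "lin_inv h A (phase_of \<circ> P)" "represents m A" "ok_mem m loc"
    "\<And>t. pc_ok (heap m) loc (P t)" by blast
  have "phase_of \<circ> P(t := Start op) = (phase_of \<circ> P)(t := Before op)"
    by auto
  then have "lin_inv (h @ [Inv t op]) A (phase_of \<circ> P(t := Start op))"
    using lin_inv_invoke[OF *(1), of t op] invoke(2) by simp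
  moreover have "pc_ok (heap m) loc ((P(t := Start op)) u)" for u
    using *(4) by simp
  ultimately show ?case
    using *(2,3) by blast
next
  case (internal h m P t m' q)
  then obtain A loc where *: "lin_inv h A (phase_of \<circ> P)" "represents m A" "ok_mem m loc"
    "\<And>t. pc_ok (heap m) loc (P t)" by blast
  obtain loc' where loc': "ok_mem m' loc'" "evolves (heap m) loc (heap m') loc'" "pc_ok (heap m') loc' q"
    and ph: "phase_of q = phase_of (P t) \<and> represents m' A \<or>
      (\<exists>op. phase_of (P t) = Before op \<and> phase_of q = After (spec_result op A) \<and>
        represents m' (spec_state op A))"
    using step_imp_step_ok[OF internal(2) *(3,4,2)] unfolding step_ok_def by blast
  have pc: "pc_ok (heap m') loc' ((P(t := q)) u)" for u
    using loc'(3) pc_ok_evolves[OF loc'(2) *(4)] by simp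
  have upd: "phase_of \<circ> P(t := q) = (phase_of \<circ> P)(t := phase_of q)"
    by auto
  from ph show ?case
  proof (elim disjE exE conjE)
    assume "phase_of q = phase_of (P t)" "represents m' A"
    moreover from this have "lin_inv h A (phase_of \<circ> P(t := q))"
      unfolding upd using *(1) by (simp add: fun_upd_idem)
    ultimately show ?thesis
      using loc'(1) pc by blast
  next
    fix op
    assume op: "phase_of (P t) = Before op" "phase_of q = After (spec_result op A)"
      "represents m' (spec_state op A)"
    then have "lin_inv h (spec_state op A) (phase_of \<circ> P(t := q))"
      using lin_inv_point[OF *(1), of t op] upd by simp
    then show ?thesis
      using op(3) loc'(1) pc by blast
  qed
next
  case (respond h m P t r)
  then obtain A loc where *: "lin_inv h A (phase_of \<circ> P)" "represents m A" "ok_mem m loc"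
    "\<And>t. pc_ok (heap m) loc (P t)" by blast
  have "phase_of \<circ> P(t := Idle) = (phase_of \<circ> P)(t := Quiet)"
    by auto
  then have "lin_inv (h @ [Resp t r]) A (phase_of \<circ> P(t := Idle))"
    using lin_inv_respond[OF *(1), of t r] respond(2) by simp
  moreover have "pc_ok (heap m) loc ((P(t := Idle)) u)" for u
    using *(4) by simp
  ultimately show ?case
    using *(2,3) by blast
qed

end

theorem theorem2:
  fixes W :: nat
    and hashcode :: "'k \<Rightarrow> nat"
    and h :: "('t, 'k, 'v) history"
    and m :: "('k, 'v) mem"
    and P :: "'t \<Rightarrow> ('k, 'v) pc"
  assumes "W \<ge> 1"
    and "ctrie.execution W hashcode h m P"
  shows "\<exists>A. linearizable_to h A \<and> ctrie.represents W hashcode m A"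
proof -
  interpret ctrie_wide W hashcode
    by unfold_locales (rule assms(1))
  show ?thesis
    using execution_invariant[OF assms(2)] lin_inv_linearizable by blast
qed

end
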